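(* Let $n\ge1$. If $S_1,\dots,S_n$ are strictly singular operators on $\mathfrak Z_n$, then the composition $S_1S_2\cdots S_n$ is compact.
   Context: Let $\mathbb S=\{z\in\mathbb C:0<\mathrm{Re}\,z<1\}$ and let $\mathcal C$ be the Calderón space of the pair $(\ell_\infty,\ell_1)$: bounded continuous functions $f:\overline{\mathbb S}\to\ell_\infty$, holomorphic on $\mathbb S$, with $f(1+it)\in\ell_1$ for all real $t$ and $\|f\|_{\mathcal C}=\max(\sup_t\|f(it)\|_\infty,\sup_t\|f(1+it)\|_1)<\infty$. For $n\ge1$ the Rochberg space $\mathfrak Z_n$ is the space of arrays $(x_{n-1},\dots,x_0)\in\ell_\infty^n$ for which there is $f\in\mathcal C$ with $x_j=f^{(j)}(1/2)/j!$ for $0\le j\le n-1$, normed by the infimum of $\|f\|_{\mathcal C}$ over such $f$. An operator is strictly singular if its restriction to no infinite-dimensional closed subspace is an isomorphism. *)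

theory Defs
  imports "HOL-Complex_Analysis.Complex_Analysis"
begin

definition bounded_seq :: "(nat \<Rightarrow> complex) \<Rightarrow> bool" where
  "bounded_seq x \<longleftrightarrow> (\<exists>M. \<forall>k. cmod (x k) \<le> M)"

definition linf_norm :: "(nat \<Rightarrow> complex) \<Rightarrow> real" where
  "linf_norm x = (SUP k. cmod (x k))"

definition in_l1 :: "(nat \<Rightarrow> complex) \<Rightarrow> bool" where
  "in_l1 x \<longleftrightarrow> summable (\<lambda>k. cmod (x k))"

definition l1_norm :: "(nat \<Rightarrow> complex) \<Rightarrow> real" where
  "l1_norm x = (\<Sum>k. cmod (x k))"

definition strip :: "complex set" where
  "strip = {z. 0 < Re z \<and> Re z < 1}"

definition cstrip :: "complex set" where
  "cstrip = {z. 0 \<le> Re z \<and> Re z \<le> 1}"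

text \<open>A function f : closed strip -> l_infty is represented as complex => nat => complex
  (values off the closed strip are irrelevant).\<close>

definition calderon :: "(complex \<Rightarrow> nat \<Rightarrow> complex) set" where
  "calderon = {f.
     \<comment> \<open>bounded with values in l_infty on the closed strip\<close>
     (\<exists>M. \<forall>z\<in>cstrip. bounded_seq (f z) \<and> linf_norm (f z) \<le> M) \<and>
     \<comment> \<open>continuous on the closed strip for the l_infty norm\<close>
     (\<forall>z\<in>cstrip. \<forall>e>0. \<exists>d>0. \<forall>w\<in>cstrip. cmod (w - z) < d \<longrightarrow>
          linf_norm (\<lambda>k. f w k - f z k) < e) \<and>
     \<comment> \<open>holomorphic (as an l_infty-valued map) on the open strip\<close>
     (\<forall>z\<in>strip. \<exists>D. bounded_seq D \<and>
          ((\<lambda>w. linf_norm (\<lambda>k. (f w k - f z k) / (w - z) - D k)) \<longlongrightarrow> 0) (at z)) \<and>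
     \<comment> \<open>values on the line Re z = 1 lie in l_1, with bounded l_1 norm\<close>
     (\<forall>t::real. in_l1 (f (1 + \<i> * complex_of_real t))) \<and>
     (\<exists>M. \<forall>t::real. l1_norm (f (1 + \<i> * complex_of_real t)) \<le> M)}"

definition calderon_norm :: "(complex \<Rightarrow> nat \<Rightarrow> complex) \<Rightarrow> real" where
  "calderon_norm f = max (SUP t::real. linf_norm (f (\<i> * complex_of_real t)))
                         (SUP t::real. l1_norm (f (1 + \<i> * complex_of_real t)))"

text \<open>An array (x_{n-1},...,x_0) in l_infty^n is represented as x :: nat => nat => complex,
  where x j is the j-th entry x_j (for j < n) and x j = 0 for j >= n.
  The j-th Taylor coefficient f^(j)(1/2)/j! of the l_infty-valued holomorphic f is taken
  coordinatewise (coordinate functionals are bounded linear, so this is the same).\<close>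

definition taylor_coeff :: "(complex \<Rightarrow> nat \<Rightarrow> complex) \<Rightarrow> nat \<Rightarrow> nat \<Rightarrow> complex" where
  "taylor_coeff f j k = (deriv ^^ j) (\<lambda>z. f z k) (1/2) / of_nat (fact j)"

definition represents :: "nat \<Rightarrow> (complex \<Rightarrow> nat \<Rightarrow> complex) \<Rightarrow> (nat \<Rightarrow> nat \<Rightarrow> complex) \<Rightarrow> bool" where
  "represents n f x \<longleftrightarrow> f \<in> calderon \<and> (\<forall>j<n. x j = taylor_coeff f j)"

definition rochberg :: "nat \<Rightarrow> (nat \<Rightarrow> nat \<Rightarrow> complex) set" where
  "rochberg n = {x. (\<forall>j<n. bounded_seq (x j)) \<and> (\<forall>j\<ge>n. x j = (\<lambda>k. 0)) \<and>
                    (\<exists>f. represents n f x)}"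

definition rnorm :: "nat \<Rightarrow> (nat \<Rightarrow> nat \<Rightarrow> complex) \<Rightarrow> real" where
  "rnorm n x = Inf {calderon_norm f | f. represents n f x}"

definition vadd :: "(nat \<Rightarrow> nat \<Rightarrow> complex) \<Rightarrow> (nat \<Rightarrow> nat \<Rightarrow> complex) \<Rightarrow> (nat \<Rightarrow> nat \<Rightarrow> complex)" where
  "vadd x y = (\<lambda>j k. x j k + y j k)"

definition vsub :: "(nat \<Rightarrow> nat \<Rightarrow> complex) \<Rightarrow> (nat \<Rightarrow> nat \<Rightarrow> complex) \<Rightarrow> (nat \<Rightarrow> nat \<Rightarrow> complex)" where
  "vsub x y = (\<lambda>j k. x j k - y j k)"

definition scal :: "complex \<Rightarrow> (nat \<Rightarrow> nat \<Rightarrow> complex) \<Rightarrow> (nat \<Rightarrow> nat \<Rightarrow> complex)" where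
  "scal c x = (\<lambda>j k. c * x j k)"

definition bounded_operator :: "nat \<Rightarrow> ((nat \<Rightarrow> nat \<Rightarrow> complex) \<Rightarrow> (nat \<Rightarrow> nat \<Rightarrow> complex)) \<Rightarrow> bool" where
  "bounded_operator n T \<longleftrightarrow>
     (\<forall>x\<in>rochberg n. T x \<in> rochberg n) \<and>
     (\<forall>x\<in>rochberg n. \<forall>y\<in>rochberg n. T (vadd x y) = vadd (T x) (T y)) \<and>
     (\<forall>x\<in>rochberg n. \<forall>c. T (scal c x) = scal c (T x)) \<and>
     (\<exists>K. \<forall>x\<in>rochberg n. rnorm n (T x) \<le> K * rnorm n x)"

definition closed_subspace :: "nat \<Rightarrow> (nat \<Rightarrow> nat \<Rightarrow> complex) set \<Rightarrow> bool" where
  "closed_subspace n Y \<longleftrightarrow> Y \<subseteq> rochberg n \<and> (\<lambda>j k. 0) \<in> Y \<and>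
     (\<forall>x\<in>Y. \<forall>y\<in>Y. vadd x y \<in> Y) \<and> (\<forall>x\<in>Y. \<forall>c. scal c x \<in> Y) \<and>
     (\<forall>(s::nat\<Rightarrow>(nat\<Rightarrow>nat\<Rightarrow>complex)) x. (\<forall>i. s i \<in> Y) \<and> x \<in> rochberg n \<and>
        (\<lambda>i. rnorm n (vsub (s i) x)) \<longlonglongrightarrow> 0 \<longrightarrow> x \<in> Y)"

definition infinite_dimensional :: "(nat \<Rightarrow> nat \<Rightarrow> complex) set \<Rightarrow> bool" where
  "infinite_dimensional Y \<longleftrightarrow>
     (\<forall>B. finite B \<longrightarrow> \<not> (Y \<subseteq> {(\<lambda>j k. \<Sum>b\<in>B. c b * b j k) | c. True}))"

definition iso_on :: "nat \<Rightarrow> ((nat \<Rightarrow> nat \<Rightarrow> complex) \<Rightarrow> (nat \<Rightarrow> nat \<Rightarrow> complex)) \<Rightarrow>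
                      (nat \<Rightarrow> nat \<Rightarrow> complex) set \<Rightarrow> bool" where
  "iso_on n T Y \<longleftrightarrow> (\<exists>c>0. \<forall>y\<in>Y. c * rnorm n y \<le> rnorm n (T y))"

definition strictly_singular :: "nat \<Rightarrow> ((nat \<Rightarrow> nat \<Rightarrow> complex) \<Rightarrow> (nat \<Rightarrow> nat \<Rightarrow> complex)) \<Rightarrow> bool" where
  "strictly_singular n T \<longleftrightarrow> bounded_operator n T \<and>
     (\<forall>Y. closed_subspace n Y \<and> infinite_dimensional Y \<longrightarrow> \<not> iso_on n T Y)"

definition compact_operator :: "nat \<Rightarrow> ((nat \<Rightarrow> nat \<Rightarrow> complex) \<Rightarrow> (nat \<Rightarrow> nat \<Rightarrow> complex)) \<Rightarrow> bool" where
  "compact_operator n T \<longleftrightarrow> bounded_operator n T \<and>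
     (\<forall>s::nat\<Rightarrow>(nat\<Rightarrow>nat\<Rightarrow>complex). (\<forall>i. s i \<in> rochberg n) \<and> (\<exists>M. \<forall>i. rnorm n (s i) \<le> M) \<longrightarrow>
        (\<exists>(r::nat\<Rightarrow>nat) L. strict_mono r \<and> L \<in> rochberg n \<and>
           (\<lambda>i. rnorm n (vsub (T (s (r i))) L)) \<longlonglongrightarrow> 0))"

definition compose_ops :: "((nat \<Rightarrow> nat \<Rightarrow> complex) \<Rightarrow> (nat \<Rightarrow> nat \<Rightarrow> complex)) list \<Rightarrow>
                           (nat \<Rightarrow> nat \<Rightarrow> complex) \<Rightarrow> (nat \<Rightarrow> nat \<Rightarrow> complex)" where
  "compose_ops Ts = foldr (\<circ>) Ts id"

end

theory Submission
  imports Defs "HOL-Library.Function_Algebras"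
begin

text \<open>
  For \<open>l \<le> n\<close> the quantity \<open>rnorm l x\<close> is the distance of \<open>x\<close> in the space of order \<open>n\<close> to the arrays
  with \<open>x\<^sub>0 = \<dots> = x\<^sub>l\<^sub>-\<^sub>1 = 0\<close>. A bounded coordinatewise null sequence is, up to a small perturbation
  and a subsequence, a sequence of disjoint blocks. If \<open>rnorm l\<close> tends to zero along it, these blocks
  may be taken with \<open>x\<^sub>0 = \<dots> = x\<^sub>l\<^sub>-\<^sub>1 = 0\<close>, and multiplying representing functions shows that their
  linear combinations are dominated by those of the unit vectors placed in position \<open>0\<close> of the space
  of order \<open>n - l\<close>. If moreover \<open>rnorm (l + 1)\<close> stays away from zero, then pairing with extremal
  functions of the dual couple gives the converse estimate. Hence an operator \<open>T\<close> along which the level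
  \<open>l\<close> does not increase is bounded below on the span of a subsequence. A strictly singular operator
  therefore raises the level of every bounded coordinatewise null sequence, and \<open>n\<close> of them map
  such a sequence to a norm null sequence. Compactness follows by applying this to differences of a
  coordinatewise convergent subsequence.
\<close>

section \<open>Bounded holomorphic functions on the strip\<close>

abbreviation line0 :: "real \<Rightarrow> complex" where
  "line0 t \<equiv> \<i> * complex_of_real t"

abbreviation line1 :: "real \<Rightarrow> complex" where
  "line1 t \<equiv> 1 + \<i> * complex_of_real t"

lemma line0_in_cstrip [simp]: "line0 t \<in> cstrip"
  and line1_in_cstrip [simp]: "line1 t \<in> cstrip"
  by (auto simp: cstrip_def)

lemma cstrip_boundary_cases:
  assumes "Re z = 0 \<or> Re z = 1"
  obtains t where "z = line0 t" | t where "z = line1 t"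
  using assms that(1)[of "Im z"] that(2)[of "Im z"] by (auto simp: complex_eq_iff)

lemma strip_subset_cstrip: "strip \<subseteq> cstrip"
  by (auto simp: strip_def cstrip_def)

lemma open_strip: "open strip"
  unfolding strip_def by (intro open_Collect_conj open_Collect_less continuous_intros)

lemma half_in_strip: "1/2 \<in> strip"
  by (simp add: strip_def)

lemma half_in_cstrip [simp]: "1/2 \<in> cstrip"
  by (simp add: cstrip_def)

lemma cball_half_subset_strip: "r < 1/2 \<Longrightarrow> cball (1/2) r \<subseteq> strip"
proof
  fix z :: complex assume "r < 1/2" "z \<in> cball (1/2) r"
  then have "\<bar>Re (z - 1/2)\<bar> < 1/2"
    using abs_Re_le_cmod[of "z - 1/2"] by (simp add: dist_norm norm_minus_commute)
  then have "\<bar>Re z - 1/2\<bar> < 1/2" by simp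
  then show "z \<in> strip" unfolding strip_def mem_Collect_eq by linarith
qed

lemma half_le_cmod_line_diff_half:
  "1/2 \<le> cmod (line0 t - 1/2)" "1/2 \<le> cmod (line1 t - 1/2)"
  using abs_Re_le_cmod[of "line0 t - 1/2"] abs_Re_le_cmod[of "line1 t - 1/2"] by auto

definition strip_fun :: "(complex \<Rightarrow> complex) \<Rightarrow> bool" where
  "strip_fun g \<longleftrightarrow> continuous_on cstrip g \<and> g holomorphic_on strip \<and> bounded (g ` cstrip)"

lemma strip_fun_boundedE:
  assumes "strip_fun g"
  obtains B where "B > 0" "\<And>z. z \<in> cstrip \<Longrightarrow> cmod (g z) \<le> B"
  using assms unfolding strip_fun_def bounded_pos by auto

lemma strip_funI:
  assumes "continuous_on cstrip g" "g holomorphic_on strip" "\<And>z. z \<in> cstrip \<Longrightarrow> cmod (g z) \<le> B"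
  shows "strip_fun g"
  using assms unfolding strip_fun_def bounded_iff by auto

lemma strip_fun_holomorphic: "strip_fun g \<Longrightarrow> g holomorphic_on strip"
  and strip_fun_continuous: "strip_fun g \<Longrightarrow> continuous_on cstrip g"
  by (simp_all add: strip_fun_def)

lemma strip_fun_const [intro, simp]: "strip_fun (\<lambda>z. c)"
  by (rule strip_funI[where B = "cmod c"]) (auto intro!: continuous_intros)

lemma strip_fun_add [intro]:
  assumes "strip_fun f" "strip_fun g" shows "strip_fun (\<lambda>z. f z + g z)"
  using assms unfolding strip_fun_def
  by (auto intro!: continuous_intros holomorphic_intros bounded_plus_comp)

lemma strip_fun_mult [intro]:
  assumes "strip_fun f" "strip_fun g" shows "strip_fun (\<lambda>z. f z * g z)"
proof -
  obtain A B where "\<And>z. z \<in> cstrip \<Longrightarrow> cmod (f z) \<le> A" "\<And>z. z \<in> cstrip \<Longrightarrow> cmod (g z) \<le> B" "A > 0"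
    using assms strip_fun_boundedE by metis
  then show ?thesis using assms
    by (intro strip_funI[where B = "A * B"])
       (auto simp: strip_fun_def norm_mult intro!: continuous_intros holomorphic_intros mult_mono)
qed

lemma strip_fun_diff [intro]:
  assumes "strip_fun f" "strip_fun g" shows "strip_fun (\<lambda>z. f z - g z)"
  using strip_fun_add[OF assms(1) strip_fun_mult[OF strip_fun_const[of "-1"] assms(2)]] by simp

lemma strip_fun_sum [intro]:
  "(\<And>i. i \<in> A \<Longrightarrow> strip_fun (f i)) \<Longrightarrow> strip_fun (\<lambda>z. \<Sum>i\<in>A. f i z)"
  by (induction A rule: infinite_finite_induct) auto

lemma strip_fun_power [intro]: "strip_fun f \<Longrightarrow> strip_fun (\<lambda>z. f z ^ n)"
  by (induction n) auto

lemma strip_fun_exp: "strip_fun (\<lambda>z. exp (of_real a * z))"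
proof (rule strip_funI[where B = "exp \<bar>a\<bar>"])
  fix z assume "z \<in> cstrip"
  then have "\<bar>a\<bar> * Re z \<le> \<bar>a\<bar>" "0 \<le> Re z" by (simp_all add: cstrip_def mult_left_le)
  moreover have "a * Re z \<le> \<bar>a\<bar> * Re z" using \<open>0 \<le> Re z\<close> by (intro mult_right_mono) auto
  ultimately show "cmod (exp (of_real a * z)) \<le> exp \<bar>a\<bar>" by simp
qed (auto intro!: continuous_intros holomorphic_intros)

lemma strip_fun_reflect:
  assumes g: "strip_fun g"
  shows "strip_fun (\<lambda>z. g (1 - z))"
proof -
  obtain B where B: "\<And>z. z \<in> cstrip \<Longrightarrow> cmod (g z) \<le> B"
    using g strip_fun_boundedE by metis
  have reflect: "1 - z \<in> cstrip \<longleftrightarrow> z \<in> cstrip" "1 - z \<in> strip \<longleftrightarrow> z \<in> strip" for z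
    by (auto simp: cstrip_def strip_def)
  show ?thesis
  proof (rule strip_funI[where B = B])
    show "continuous_on cstrip (\<lambda>z. g (1 - z))"
      by (rule continuous_on_compose2[OF strip_fun_continuous[OF g]])
         (auto simp: reflect intro!: continuous_intros)
    have "(g \<circ> (\<lambda>z. 1 - z)) holomorphic_on strip"
      by (rule holomorphic_on_compose_gen[OF _ strip_fun_holomorphic[OF g]])
         (auto simp: reflect intro!: holomorphic_intros)
    then show "(\<lambda>z. g (1 - z)) holomorphic_on strip" by (simp add: o_def)
    show "cmod (g (1 - z)) \<le> B" if "z \<in> cstrip" for z using that by (simp add: B reflect)
  qed
qed

lemma strip_fun_uniform_limit:
  assumes g: "\<And>m::nat. strip_fun (g m)" and lim: "uniform_limit cstrip g G sequentially"
  shows "strip_fun G"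
proof -
  have "continuous_on cstrip G"
    by (rule uniform_limit_theorem[OF _ lim]) (auto simp: strip_fun_continuous[OF g])
  moreover have "G holomorphic_on strip"
  proof (rule holomorphic_uniform_sequence[OF open_strip])
    show "g m holomorphic_on strip" for m by (rule strip_fun_holomorphic[OF g])
    fix z assume "z \<in> strip"
    then obtain d where "d > 0" "cball z d \<subseteq> strip" using open_strip open_contains_cball by blast
    then show "\<exists>d>0. cball z d \<subseteq> strip \<and> uniform_limit (cball z d) g G sequentially"
      using uniform_limit_on_subset[OF lim] strip_subset_cstrip by blast
  qed
  moreover have "bounded (G ` cstrip)"
    by (rule uniform_limit_bounded[OF lim]) (use g in \<open>auto simp: strip_fun_def\<close>)
  ultimately show ?thesis by (simp add: strip_fun_def)
qed

lemma maximum_principle_bounded_imaginary: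
  assumes g: "strip_fun g"
    and edges: "\<And>t. cmod (g (line0 t)) \<le> M" "\<And>t. cmod (g (line1 t)) \<le> M"
    and far: "\<And>w. w \<in> cstrip \<Longrightarrow> R \<le> \<bar>Im w\<bar> \<Longrightarrow> cmod (g w) \<le> M"
    and z: "z \<in> cstrip"
  shows "cmod (g z) \<le> M"
proof (cases "R \<le> \<bar>Im z\<bar>")
  case True
  with z show ?thesis by (rule far)
next
  case False
  define S where "S = cbox (Complex 0 (-R)) (Complex 1 R)"
  have S: "S \<subseteq> cstrip" "interior S \<subseteq> strip"
    by (auto simp: S_def cstrip_def strip_def interior_cbox in_box_complex_iff in_cbox_complex_iff)
  show ?thesis
  proof (rule maximum_modulus_frontier[where S = S and f = g and \<xi> = z])
    show "g holomorphic_on interior S"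
      using strip_fun_holomorphic[OF g] S(2) by (rule holomorphic_on_subset)
    have "closure S = S" by (simp add: S_def)
    then show "continuous_on (closure S) g"
      using continuous_on_subset[OF strip_fun_continuous[OF g] S(1)] by simp
    show "bounded S" by (simp add: S_def)
    show "z \<in> S" using z False by (auto simp: S_def cstrip_def in_cbox_complex_iff)
    fix w assume "w \<in> frontier S"
    then have w: "w \<in> S" "w \<notin> interior S" by (auto simp: frontier_def S_def)
    then consider "Re w = 0 \<or> Re w = 1" | "R \<le> \<bar>Im w\<bar>"
      unfolding S_def interior_cbox by (fastforce simp: in_box_complex_iff in_cbox_complex_iff)
    then show "cmod (g w) \<le> M"
    proof cases
      case 1
      then show ?thesis by (rule cstrip_boundary_cases) (auto simp: edges)
    next
      case 2
      then show ?thesis using w S by (intro far) auto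
    qed
  qed
qed

lemma
  assumes g: "strip_fun g" and e: "e > 0"
  shows strip_fun_damped: "strip_fun (\<lambda>w. g w / (1 + of_real e * w))"
    and norm_damped_le: "w \<in> cstrip \<Longrightarrow> cmod (g w / (1 + of_real e * w)) \<le> cmod (g w)"
    and norm_damped_le_Im: "w \<in> cstrip \<Longrightarrow> cmod (g w / (1 + of_real e * w)) * (e * \<bar>Im w\<bar>) \<le> cmod (g w)"
proof -
  have denom: "1 \<le> cmod (1 + of_real e * w)" "e * \<bar>Im w\<bar> \<le> cmod (1 + of_real e * w)"
    if "w \<in> cstrip" for w
    using complex_Re_le_cmod[of "1 + of_real e * w"] abs_Im_le_cmod[of "1 + of_real e * w"] that e
    by (auto simp: cstrip_def abs_mult intro: order_trans[rotated])
  then have nonzero: "1 + of_real e * w \<noteq> 0" if "w \<in> cstrip" for w using that by force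
  have product: "cmod (g w) = cmod (g w / (1 + of_real e * w)) * cmod (1 + of_real e * w)"
    if "w \<in> cstrip" for w
    using nonzero[OF that] by (simp add: norm_divide)
  show le: "cmod (g w / (1 + of_real e * w)) \<le> cmod (g w)" if "w \<in> cstrip" for w
    using product[OF that] mult_left_mono[OF denom(1)[OF that] norm_ge_zero] by simp
  show "cmod (g w / (1 + of_real e * w)) * (e * \<bar>Im w\<bar>) \<le> cmod (g w)" if "w \<in> cstrip"
    using product[OF that] mult_left_mono[OF denom(2)[OF that] norm_ge_zero] by simp
  obtain B where B: "\<And>w. w \<in> cstrip \<Longrightarrow> cmod (g w) \<le> B"
    using g strip_fun_boundedE by metis
  show "strip_fun (\<lambda>w. g w / (1 + of_real e * w))"
  proof (rule strip_funI)
    show "continuous_on cstrip (\<lambda>w. g w / (1 + of_real e * w))"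
      by (intro continuous_intros strip_fun_continuous[OF g]) (use nonzero in auto)
    show "(\<lambda>w. g w / (1 + of_real e * w)) holomorphic_on strip"
      by (intro holomorphic_intros strip_fun_holomorphic[OF g])
         (use nonzero strip_subset_cstrip in auto)
    show "cmod (g w / (1 + of_real e * w)) \<le> B" if "w \<in> cstrip" for w
      using le[OF that] B[OF that] by linarith
  qed
qed

text \<open>The quotient \<open>g z / (1 + e z)\<close> tends to zero at infinity, so that only a bounded part of the strip
  matters for it; then \<open>e \<longrightarrow> 0\<close>.\<close>

theorem strip_fun_maximum_principle:
  assumes g: "strip_fun g"
    and edges: "\<And>t. cmod (g (line0 t)) \<le> M" "\<And>t. cmod (g (line1 t)) \<le> M"
    and z: "z \<in> cstrip"
  shows "cmod (g z) \<le> M"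
proof -
  obtain B where B: "B > 0" "\<And>w. w \<in> cstrip \<Longrightarrow> cmod (g w) \<le> B"
    using g strip_fun_boundedE by blast
  have M: "0 \<le> M" using edges(1)[of 0] norm_ge_zero order_trans by blast
  have damped: "cmod (g z / (1 + of_real e * z)) \<le> M + e" if e: "e > 0" for e :: real
  proof (rule maximum_principle_bounded_imaginary[OF strip_fun_damped[OF g e] _ _ _ z, where R = "B / (e * e)"])
    show "cmod (g (line0 t) / (1 + of_real e * line0 t)) \<le> M + e"
      "cmod (g (line1 t) / (1 + of_real e * line1 t)) \<le> M + e" for t
      using norm_damped_le[OF g e, of "line0 t"] norm_damped_le[OF g e, of "line1 t"] edges[of t] e by auto
    fix w assume w: "w \<in> cstrip" and far: "B / (e * e) \<le> \<bar>Im w\<bar>"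
    define q where "q = cmod (g w / (1 + of_real e * w))"
    have "q * (e * \<bar>Im w\<bar>) \<le> B" using norm_damped_le_Im[OF g e w] B(2)[OF w] by (simp add: q_def)
    also have "B \<le> e * (e * \<bar>Im w\<bar>)" using far e by (simp add: pos_divide_le_eq mult_ac)
    finally have "q * (e * \<bar>Im w\<bar>) \<le> e * (e * \<bar>Im w\<bar>)" .
    moreover have "0 < B / (e * e)" using e B(1) by simp
    then have "0 < e * \<bar>Im w\<bar>" using far by (intro mult_pos_pos[OF e]) linarith
    ultimately have "q \<le> e" by (rule mult_right_le_imp_le)
    then show "cmod (g w / (1 + of_real e * w)) \<le> M + e" using M by (simp add: q_def)
  qed
  have "((\<lambda>e::real. cmod (g z / (1 + of_real e * z))) \<longlongrightarrow> cmod (g z / (1 + of_real 0 * z))) (at_right 0)"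
    by (intro tendsto_intros) simp
  moreover have "((\<lambda>e::real. M + e) \<longlongrightarrow> M + 0) (at_right 0)" by (intro tendsto_intros)
  moreover have "\<forall>\<^sub>F e::real in at_right 0. cmod (g z / (1 + of_real e * z)) \<le> M + e"
    using eventually_at_right_less by eventually_elim (rule damped)
  ultimately have "cmod (g z / (1 + of_real 0 * z)) \<le> M + 0"
    by (intro tendsto_le[OF trivial_limit_at_right_real])
  then show ?thesis by simp
qed

section \<open>Germs at the centre of the strip\<close>

definition germ :: "(complex \<Rightarrow> complex) \<Rightarrow> complex fps" where
  "germ g = fps_expansion g (1/2)"

lemma taylor_coeff_germ: "taylor_coeff f j k = fps_nth (germ (\<lambda>z. f z k)) j"
  by (simp add: taylor_coeff_def germ_def fps_expansion_def)

lemma has_fps_expansion_germ: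
  assumes "strip_fun g"
  shows "(\<lambda>x. g (1/2 + x)) has_fps_expansion germ g"
  unfolding germ_def using strip_fun_holomorphic[OF assms] open_strip half_in_strip
  by (intro analytic_at_imp_has_fps_expansion) (auto simp: analytic_at)

lemma germ_eqI:
  assumes "(\<lambda>x. g (1/2 + x)) has_fps_expansion F"
  shows "germ g = F"
proof -
  have "germ g = fps_expansion (\<lambda>x. g (1/2 + x)) 0"
    by (simp add: germ_def fps_expansion_def higher_deriv_shift_0'[of "1/2"] o_def)
  then show ?thesis using fps_expansion_eqI[OF assms] by simp
qed

lemma germ_const [simp]: "germ (\<lambda>z. c) = fps_const c"
  by (rule germ_eqI) simp

lemma germ_add:
  "strip_fun f \<Longrightarrow> strip_fun g \<Longrightarrow> germ (\<lambda>z. f z + g z) = germ f + germ g"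
  by (intro germ_eqI has_fps_expansion_add has_fps_expansion_germ)

lemma germ_diff:
  "strip_fun f \<Longrightarrow> strip_fun g \<Longrightarrow> germ (\<lambda>z. f z - g z) = germ f - germ g"
  by (intro germ_eqI has_fps_expansion_diff has_fps_expansion_germ)

lemma germ_mult:
  "strip_fun f \<Longrightarrow> strip_fun g \<Longrightarrow> germ (\<lambda>z. f z * g z) = germ f * germ g"
  by (intro germ_eqI has_fps_expansion_mult has_fps_expansion_germ)

lemma germ_sum:
  "(\<And>i. i \<in> A \<Longrightarrow> strip_fun (f i)) \<Longrightarrow> germ (\<lambda>z. \<Sum>i\<in>A. f i z) = (\<Sum>i\<in>A. germ (f i))"
  by (intro germ_eqI has_fps_expansion_sum has_fps_expansion_germ)

lemma germ_power: "strip_fun f \<Longrightarrow> germ (\<lambda>z. f z ^ n) = germ f ^ n"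
  by (intro germ_eqI has_fps_expansion_power has_fps_expansion_germ)

lemma germ_nth_0 [simp]: "fps_nth (germ g) 0 = g (1/2)"
  by (simp add: germ_def fps_expansion_def)

lemma germ_nth_bound:
  assumes g: "strip_fun g"
    and edges: "\<And>t. cmod (g (line0 t)) \<le> M" "\<And>t. cmod (g (line1 t)) \<le> M"
  shows "cmod (fps_nth (germ g) j) \<le> 4 ^ j * M"
proof -
  have disc: "cball (1/2) (1/4) \<subseteq> strip" by (rule cball_half_subset_strip) simp
  have "cmod ((deriv ^^ j) g (1/2)) \<le> fact j * M / (1/4) ^ j"
  proof (rule Cauchy_inequality)
    show "g holomorphic_on ball (1/2) (1/4)"
      using strip_fun_holomorphic[OF g] disc by (meson ball_subset_cball holomorphic_on_subset order_trans)
    show "continuous_on (cball (1/2) (1/4)) g"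
      using strip_fun_continuous[OF g] disc strip_subset_cstrip by (meson continuous_on_subset order_trans)
    fix z :: complex assume "cmod (1/2 - z) = 1/4"
    then have "z \<in> cball (1/2) (1/4)" by (simp add: dist_norm)
    then show "cmod (g z) \<le> M"
      using disc strip_subset_cstrip by (intro strip_fun_maximum_principle[OF g edges]) auto
  qed simp
  then have "cmod ((deriv ^^ j) g (1/2)) / fact j \<le> 4 ^ j * M"
    by (simp add: field_simps power_one_over)
  then show ?thesis by (simp add: germ_def fps_expansion_def norm_divide)
qed

lemma germ_truncated_compose:
  assumes h: "strip_fun h" "h (1/2) = 0" and j: "j < n"
  shows "fps_nth (germ (\<lambda>z. \<Sum>i<n. fps_nth c i * h z ^ i)) j = fps_nth (c oo germ h) j"
proof -
  have high: "fps_nth (germ h ^ i) j = 0" if "j < i" for i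
    using startsby_zero_power_prefix[of "germ h" i] h(2) that by simp
  have "germ (\<lambda>z. \<Sum>i<n. fps_nth c i * h z ^ i) = (\<Sum>i<n. fps_const (fps_nth c i) * germ h ^ i)"
    using h by (subst germ_sum) (auto simp: germ_mult germ_power strip_fun_power)
  then have "fps_nth (germ (\<lambda>z. \<Sum>i<n. fps_nth c i * h z ^ i)) j = (\<Sum>i<n. fps_nth c i * fps_nth (germ h ^ i) j)"
    by (simp add: fps_sum_nth)
  also have "\<dots> = (\<Sum>i=0..j. fps_nth c i * fps_nth (germ h ^ i) j)"
    using j high by (intro sum.mono_neutral_right) auto
  finally show ?thesis by (simp add: fps_compose_nth)
qed

text \<open>Since \<open>exp (z - 1/2) - 1\<close> has a simple zero at \<open>1/2\<close>, its powers span all jets there.\<close>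

lemma strip_fun_prescribed_germ:
  obtains e where "strip_fun e" "\<And>i. i < n \<Longrightarrow> fps_nth (germ e) i = fps_nth F i"
proof -
  define h where "h z = exp (- 1/2) * exp (of_real 1 * z) - 1" for z :: complex
  have h: "strip_fun h"
    unfolding h_def by (intro strip_fun_diff strip_fun_mult strip_fun_const strip_fun_exp)
  have h_half: "h (1/2) = 0" by (simp add: h_def flip: exp_add)
  have germ_h: "germ h = fps_exp 1 - 1"
  proof (rule germ_eqI)
    have "h (1/2 + x) = exp (1 * x) - 1" for x by (simp add: h_def flip: exp_add)
    then show "(\<lambda>x. h (1/2 + x)) has_fps_expansion fps_exp 1 - 1"
      by (simp only:) (intro fps_expansion_intros)
  qed
  define c where "c = F oo fps_inv (fps_exp 1 - 1)"
  have "fps_nth (fps_inv (fps_exp 1 - 1)) 0 = (0::complex)" by (simp add: fps_inv_def)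
  then have "c oo germ h = F oo (fps_inv (fps_exp 1 - 1) oo (fps_exp 1 - 1))"
    unfolding c_def germ_h by (intro fps_compose_assoc[symmetric]) simp_all
  then have compose: "c oo germ h = F" by (simp add: fps_inv_fps_exp_compose)
  show ?thesis
  proof
    show "strip_fun (\<lambda>z. \<Sum>i<n. fps_nth c i * h z ^ i)"
      by (intro strip_fun_sum strip_fun_mult strip_fun_const strip_fun_power h)
    show "fps_nth (germ (\<lambda>z. \<Sum>i<n. fps_nth c i * h z ^ i)) i = fps_nth F i" if "i < n" for i
      using germ_truncated_compose[OF h h_half that, of c] by (simp add: compose)
  qed
qed

lemma strip_fun_monomials:
  obtains e C where "C > 0" "\<And>j. strip_fun (e j)"
    "\<And>i j. i < n \<Longrightarrow> fps_nth (germ (e j)) i = (if i = j then 1 else 0)"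
    "\<And>j z. j < n \<Longrightarrow> z \<in> cstrip \<Longrightarrow> cmod (e j z) \<le> C"
proof -
  have "\<exists>e. strip_fun e \<and> (\<forall>i<n. fps_nth (germ e) i = fps_nth (fps_X ^ j) i)" for j
    using strip_fun_prescribed_germ[of n "fps_X ^ j"] by metis
  then obtain e where e: "\<And>j. strip_fun (e j)"
    "\<And>i j. i < n \<Longrightarrow> fps_nth (germ (e j)) i = fps_nth (fps_X ^ j) i" by metis
  have "\<exists>b>0. \<forall>z\<in>cstrip. cmod (e j z) \<le> b" for j
    using strip_fun_boundedE[OF e(1)] by metis
  then obtain b where b: "\<And>j. b j > 0" "\<And>j z. z \<in> cstrip \<Longrightarrow> cmod (e j z) \<le> b j" by metis
  show ?thesis
  proof
    show "1 + (\<Sum>j<n. b j) > 0" by (intro add_pos_nonneg sum_nonneg less_imp_le[OF b(1)]) simp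
    show "strip_fun (e j)" for j by (rule e)
    show "fps_nth (germ (e j)) i = (if i = j then 1 else 0)" if "i < n" for i j using e(2)[OF that] by simp
    show "cmod (e j z) \<le> 1 + (\<Sum>j<n. b j)" if "j < n" "z \<in> cstrip" for j z
      using member_le_sum[of j "{..<n}" b] b(1) b(2)[OF that(2), of j] that(1)
      by (force intro: less_imp_le)
  qed
qed

definition truncated_inverse :: "nat \<Rightarrow> (complex \<Rightarrow> complex) \<Rightarrow> complex \<Rightarrow> complex" where
  "truncated_inverse m h z = (\<Sum>r<m. (1 - h z) ^ r)"

lemma strip_fun_truncated_inverse: "strip_fun h \<Longrightarrow> strip_fun (truncated_inverse m h)"
  unfolding truncated_inverse_def by (intro strip_fun_sum strip_fun_power strip_fun_diff strip_fun_const)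

lemma norm_truncated_inverse_le:
  assumes "cmod (h z) \<le> B"
  shows "cmod (truncated_inverse m h z) \<le> (\<Sum>r<m. (1 + B) ^ r)"
proof -
  have "cmod (1 - h z) \<le> 1 + B" using norm_triangle_ineq4[of 1 "h z"] assms by simp
  then show ?thesis
    unfolding truncated_inverse_def by (intro sum_norm_le) (simp add: norm_power power_mono)
qed

lemma germ_mult_truncated_inverse_nth:
  assumes h: "strip_fun h" "h (1/2) = 1" and j: "j < m"
  shows "fps_nth (germ h * germ (truncated_inverse m h)) j = (if j = 0 then 1 else 0)"
proof -
  have "germ (truncated_inverse m h) = (\<Sum>r<m. (1 - germ h) ^ r)"
    unfolding truncated_inverse_def[abs_def] using h
    by (subst germ_sum) (auto simp: germ_power germ_diff strip_fun_diff strip_fun_power)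
  then have "germ h * germ (truncated_inverse m h) = 1 - (1 - germ h) ^ m"
    using one_diff_power_eq[of "1 - germ h" m] by simp
  moreover have "fps_nth ((1 - germ h) ^ m) j = 0"
    using startsby_zero_power_prefix[of "1 - germ h" m] h j by simp
  ultimately show ?thesis by simp
qed

lemma strip_fun_cofactor:
  assumes g: "strip_fun g" and factor: "\<And>z. g z = (z - 1/2) * h z" and hol: "h holomorphic_on strip"
  shows "strip_fun h"
proof -
  have union: "strip \<union> (cstrip - {1/2}) = cstrip" using strip_subset_cstrip half_in_strip by auto
  have "continuous_on (strip \<union> (cstrip - {1/2})) h"
  proof (rule continuous_on_Un_local_open)
    show "openin (top_of_set (strip \<union> (cstrip - {1/2}))) strip"
      unfolding union using strip_subset_cstrip open_strip by (auto intro: open_subset)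
    show "openin (top_of_set (strip \<union> (cstrip - {1/2}))) (cstrip - {1/2})"
      unfolding union by (intro openin_delete openin_subtopology_self)
    show "continuous_on strip h" using hol by (rule holomorphic_on_imp_continuous_on)
    have "continuous_on (cstrip - {1/2}) (\<lambda>z. g z / (z - 1/2))"
      by (intro continuous_intros continuous_on_subset[OF strip_fun_continuous[OF g]]) auto
    then show "continuous_on (cstrip - {1/2}) h"
      by (rule continuous_on_eq) (simp add: factor)
  qed
  then have cont: "continuous_on cstrip h" unfolding union .
  have disc: "cball (1/2) (1/4) \<subseteq> cstrip"
    using cball_half_subset_strip[of "1/4"] strip_subset_cstrip by auto
  have "bounded (h ` cball (1/2) (1/4))"
    by (intro compact_imp_bounded compact_continuous_image compact_cball continuous_on_subset[OF cont disc])
  then obtain C where C: "\<And>z. z \<in> cball (1/2) (1/4) \<Longrightarrow> cmod (h z) \<le> C"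
    unfolding bounded_iff by blast
  obtain B where B: "\<And>z. z \<in> cstrip \<Longrightarrow> cmod (g z) \<le> B"
    using g strip_fun_boundedE by metis
  have "cmod (h z) \<le> max C (4 * B)" if z: "z \<in> cstrip" for z
  proof (cases "z \<in> cball (1/2) (1/4)")
    case True
    then have "cmod (h z) \<le> C" by (rule C)
    then show ?thesis by simp
  next
    case False
    then have "1/4 * cmod (h z) \<le> cmod (z - 1/2) * cmod (h z)"
      by (intro mult_right_mono) (auto simp: dist_norm norm_minus_commute)
    also have "\<dots> \<le> B" using B[OF z] by (simp only: factor[of z] norm_mult)
    finally show ?thesis by simp
  qed
  then show ?thesis by (rule strip_funI[OF cont hol])
qed

lemma strip_fun_divide_zero:
  assumes g: "strip_fun g" and zero: "g (1/2) = 0"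
  obtains h where "strip_fun h" "\<And>z. g z = (z - 1/2) * h z"
    "\<And>j. fps_nth (germ h) j = fps_nth (germ g) (Suc j)"
proof -
  define h where "h z = (if z = 1/2 then deriv g (1/2) else g z / (z - 1/2))" for z
  have factor: "g z = (z - 1/2) * h z" for z
  proof (cases "z = 1/2")
    case True
    show ?thesis unfolding True using zero by simp
  next
    case False
    then have "z - 1/2 \<noteq> 0" by simp
    with False show ?thesis unfolding h_def by simp
  qed
  have "h holomorphic_on strip"
    using pole_theorem_open[OF strip_fun_holomorphic[OF g] open_strip factor]
    by (rule holomorphic_transform) (use zero in \<open>auto simp: h_def\<close>)
  then have h: "strip_fun h" by (rule strip_fun_cofactor[OF g factor])
  have "(\<lambda>x. x * h (1/2 + x)) has_fps_expansion fps_X * germ h"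
    by (intro has_fps_expansion_mult has_fps_expansion_fps_X has_fps_expansion_germ h)
  then have "germ g = fps_X * germ h"
    by (intro germ_eqI) (simp add: factor[of "1/2 + _"])
  then have "fps_nth (germ h) j = fps_nth (germ g) (Suc j)" for j by simp
  then show ?thesis by (rule that[OF h factor])
qed

section \<open>The Calderon space\<close>

lemma bounded_seqI: "(\<And>k. cmod (x k) \<le> M) \<Longrightarrow> bounded_seq x"
  by (auto simp: bounded_seq_def)

lemma bounded_seq_diff: "bounded_seq x \<Longrightarrow> bounded_seq y \<Longrightarrow> bounded_seq (\<lambda>k. x k - y k)"
  unfolding bounded_seq_def by (meson add_mono norm_triangle_ineq4 order_trans)

lemma bounded_seq_divide: "bounded_seq x \<Longrightarrow> bounded_seq (\<lambda>k. x k / c)"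
  unfolding bounded_seq_def norm_divide by (meson divide_right_mono norm_ge_zero)

lemma linf_norm_le: "(\<And>k. cmod (x k) \<le> M) \<Longrightarrow> linf_norm x \<le> M"
  unfolding linf_norm_def by (rule cSUP_least) auto

lemma le_linf_norm: "bounded_seq x \<Longrightarrow> cmod (x k) \<le> linf_norm x"
  unfolding linf_norm_def bounded_seq_def by (intro cSUP_upper) (auto simp: bdd_above_def)

lemma linf_norm_nonneg: "bounded_seq x \<Longrightarrow> 0 \<le> linf_norm x"
  using le_linf_norm[of x 0] norm_ge_zero order_trans by blast

lemma
  assumes "\<And>K. (\<Sum>k<K. cmod (x k)) \<le> M"
  shows in_l1I: "in_l1 x" and l1_norm_le: "l1_norm x \<le> M"
proof -
  show "in_l1 x" unfolding in_l1_def
    by (rule summableI_nonneg_bounded[where x = M]) (use assms in auto)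
  then show "l1_norm x \<le> M" unfolding in_l1_def l1_norm_def
    by (intro suminf_le_const) (use assms in auto)
qed

lemma sum_le_l1_norm: "in_l1 x \<Longrightarrow> finite K \<Longrightarrow> (\<Sum>k\<in>K. cmod (x k)) \<le> l1_norm x"
  unfolding in_l1_def l1_norm_def by (rule sum_le_suminf) auto

lemma calderon_bounded_seq: "f \<in> calderon \<Longrightarrow> z \<in> cstrip \<Longrightarrow> bounded_seq (f z)"
  by (auto simp: calderon_def)

lemma calderon_uniform_limit:
  assumes f: "f \<in> calderon" and z: "z \<in> cstrip"
  shows "uniform_limit UNIV f (f z) (at z within cstrip)"
  unfolding uniform_limit_iff eventually_at
proof (intro allI impI)
  fix e :: real assume "e > 0"
  then obtain d where d: "d > 0" "\<And>w. w \<in> cstrip \<Longrightarrow> cmod (w - z) < d \<Longrightarrow> linf_norm (\<lambda>k. f w k - f z k) < e"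
    using f z unfolding calderon_def by blast
  have "dist (f w k) (f z k) < e" if "w \<in> cstrip" "cmod (w - z) < d" for w k
    using le_linf_norm[OF bounded_seq_diff[OF calderon_bounded_seq[OF f that(1)] calderon_bounded_seq[OF f z]], of k]
      d(2)[OF that] by (simp add: dist_norm)
  then show "\<exists>d>0. \<forall>w\<in>cstrip. w \<noteq> z \<and> dist w z < d \<longrightarrow> (\<forall>k\<in>UNIV. dist (f w k) (f z k) < e)"
    using d(1) by (auto simp: dist_norm)
qed

lemma calderon_differentiable:
  assumes "f \<in> calderon" "z \<in> strip"
  obtains D where "bounded_seq D"
    "((\<lambda>w. linf_norm (\<lambda>k. (f w k - f z k) / (w - z) - D k)) \<longlongrightarrow> 0) (at z)"
  using assms unfolding calderon_def mem_Collect_eq by meson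

lemma calderon_difference_quotient_le:
  assumes f: "f \<in> calderon" and "z \<in> cstrip" "w \<in> cstrip" "bounded_seq D"
  shows "cmod ((f w k - f z k) / (w - z) - D k) \<le> linf_norm (\<lambda>k. (f w k - f z k) / (w - z) - D k)"
proof (rule le_linf_norm[where x = "\<lambda>k. (f w k - f z k) / (w - z) - D k"])
  have "bounded_seq (\<lambda>k. f w k - f z k)"
    using assms by (intro bounded_seq_diff calderon_bounded_seq)
  then show "bounded_seq (\<lambda>k. (f w k - f z k) / (w - z) - D k)"
    using assms(4) by (rule bounded_seq_diff[OF bounded_seq_divide])
qed

lemma eventually_in_cstrip: "\<forall>\<^sub>F w in at z within cstrip. w \<in> cstrip"
  by (simp add: eventually_at_filter)

lemma eventually_in_cstrip_at: "z \<in> strip \<Longrightarrow> \<forall>\<^sub>F w in at z. w \<in> cstrip"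
  using eventually_at_in_open'[OF open_strip] by (rule eventually_mono) (use strip_subset_cstrip in auto)

lemma at_half_within_cstrip: "at (1/2) within cstrip = at (1/2)"
  using half_in_strip open_strip strip_subset_cstrip by (rule at_within_open_subset)

lemma calderon_coord_strip_fun:
  assumes f: "f \<in> calderon"
  shows "strip_fun (\<lambda>z. f z k)"
proof -
  obtain M where M: "\<And>z. z \<in> cstrip \<Longrightarrow> linf_norm (f z) \<le> M"
    using f unfolding calderon_def by blast
  have "continuous_on cstrip (\<lambda>z. f z k)"
    unfolding continuous_on_def using tendsto_uniform_limitI[OF calderon_uniform_limit[OF f]] by simp
  moreover have "(\<lambda>z. f z k) holomorphic_on strip"
    unfolding holomorphic_on_def
  proof
    fix z assume z: "z \<in> strip"
    then have zc: "z \<in> cstrip" using strip_subset_cstrip by blast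
    obtain D where D: "bounded_seq D"
        "((\<lambda>w. linf_norm (\<lambda>k. (f w k - f z k) / (w - z) - D k)) \<longlongrightarrow> 0) (at z)"
      by (rule calderon_differentiable[OF f z])
    have "\<forall>\<^sub>F w in at z. cmod ((f w k - f z k) / (w - z) - D k)
        \<le> linf_norm (\<lambda>k. (f w k - f z k) / (w - z) - D k)"
      using eventually_in_cstrip_at[OF z]
      by eventually_elim (rule calderon_difference_quotient_le[OF f zc _ D(1)])
    then have "((\<lambda>w. (f w k - f z k) / (w - z) - D k) \<longlongrightarrow> 0) (at z)"
      using D(2) by (rule Lim_null_comparison)
    then have "((\<lambda>z. f z k) has_field_derivative D k) (at z)"
      unfolding has_field_derivative_iff by (rule LIM_zero_cancel)
    then show "(\<lambda>z. f z k) field_differentiable at z within strip"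
      using field_differentiable_at_within field_differentiable_def by blast
  qed
  moreover have "cmod (f z k) \<le> M" if "z \<in> cstrip" for z
    using le_linf_norm[OF calderon_bounded_seq[OF f that]] M[OF that] order_trans by blast
  ultimately show ?thesis by (rule strip_funI)
qed

lemma difference_quotient_bound:
  assumes g: "g holomorphic_on ball z r" and r: "r > 0"
    and B: "\<And>w. w \<in> ball z r \<Longrightarrow> cmod (g w) \<le> B"
    and w: "w \<noteq> z" "cmod (w - z) \<le> r / 2"
  shows "cmod ((g w - g z) / (w - z) - deriv g z) \<le> 32 * B / r\<^sup>2 * cmod (w - z)"
proof -
  define S where "S = cball z (r/2)"
  have near: "cball x (r/4) \<subseteq> ball z r" if "x \<in> S" for x
  proof
    fix y assume "y \<in> cball x (r/4)"
    then have "dist z y \<le> r/2 + r/4" using that dist_triangle[of z y x] by (simp add: S_def)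
    then show "y \<in> ball z r" using r by simp
  qed
  have "cmod ((deriv ^^ 0) g w - (\<Sum>i\<le>1. (deriv ^^ i) g z * (w - z) ^ i / fact i))
      \<le> 32 * B / r\<^sup>2 * cmod (w - z) ^ Suc 1 / fact 1"
  proof (rule complex_Taylor[where f = "\<lambda>i. (deriv ^^ i) g" and S = S])
    show "convex S" "w \<in> S" "z \<in> S" using w r by (auto simp: S_def dist_norm norm_minus_commute)
    fix x assume x: "x \<in> S"
    then have "x \<in> ball z r" using r by (simp add: S_def)
    then show "((deriv ^^ i) g has_field_derivative (deriv ^^ Suc i) g x) (at x within S)" for i
      using holomorphic_derivI[OF holomorphic_higher_deriv[OF g open_ball] open_ball] by simp
    have "cmod ((deriv ^^ 2) g x) \<le> fact 2 * B / (r/4) ^ 2"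
    proof (rule Cauchy_inequality)
      show "g holomorphic_on ball x (r/4)"
        using g near[OF x] ball_subset_cball by (meson holomorphic_on_subset order_trans)
      show "continuous_on (cball x (r/4)) g"
        using g near[OF x] by (meson continuous_on_subset holomorphic_on_imp_continuous_on)
      show "cmod (g y) \<le> B" if "cmod (x - y) = r/4" for y
        using near[OF x] that by (intro B) (auto simp: dist_norm subset_iff)
    qed (use r in auto)
    then show "cmod ((deriv ^^ Suc 1) g x) \<le> 32 * B / r\<^sup>2"
      by (simp add: fact_2 power_divide numeral_2_eq_2)
  qed
  then have taylor: "cmod (g w - g z - deriv g z * (w - z)) \<le> 32 * B / r\<^sup>2 * cmod (w - z) * cmod (w - z)"
    by (simp add: power2_eq_square algebra_simps)
  have "(g w - g z) / (w - z) - deriv g z = (g w - g z - deriv g z * (w - z)) / (w - z)"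
    using w by (simp add: field_simps)
  then show ?thesis using taylor w(1) by (simp add: norm_divide pos_divide_le_eq)
qed

lemma uniformly_bounded_holomorphic_differentiable:
  assumes hol: "\<And>k. (\<lambda>w. f w k) holomorphic_on ball z r" and r: "r > 0"
    and B: "\<And>w k. w \<in> ball z r \<Longrightarrow> cmod (f w k) \<le> B"
  shows "\<exists>D. bounded_seq D \<and> ((\<lambda>w. linf_norm (\<lambda>k. (f w k - f z k) / (w - z) - D k)) \<longlongrightarrow> 0) (at z)"
proof (intro exI conjI)
  define D where "D k = deriv (\<lambda>w. f w k) z" for k
  have quotient: "cmod ((f w k - f z k) / (w - z) - D k) \<le> 32 * B / r\<^sup>2 * cmod (w - z)"
    if "w \<noteq> z" "cmod (w - z) \<le> r / 2" for w k
    unfolding D_def using that by (intro difference_quotient_bound[OF hol r B])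
  show "bounded_seq D"
  proof -
    define w where "w = z + of_real (r / 2)"
    have w: "w \<noteq> z" "cmod (w - z) = r / 2" "w \<in> ball z r"
      using r by (auto simp: w_def dist_norm)
    have "cmod (D k) \<le> 32 * B / r\<^sup>2 * (r / 2) + 2 * B / (r / 2)" for k
    proof -
      have "cmod (f w k - f z k) \<le> 2 * B"
        using norm_triangle_ineq4[of "f w k" "f z k"] B[OF w(3), of k] B[of z k] r by simp
      then have "cmod ((f w k - f z k) / (w - z)) \<le> 2 * B / (r / 2)"
        using r unfolding norm_divide w(2) by (intro divide_right_mono) auto
      then show ?thesis
        using norm_triangle_sub[of "D k" "(f w k - f z k) / (w - z)"] quotient[of w k] w
        by (simp add: norm_minus_commute)
    qed
    then show ?thesis by (rule bounded_seqI)
  qed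
  have "\<forall>\<^sub>F w in at z. w \<noteq> z \<and> cmod (w - z) \<le> r / 2"
    unfolding eventually_at using r by (intro exI[of _ "r/2"]) (auto simp: dist_norm)
  then have "\<forall>\<^sub>F w in at z. norm (linf_norm (\<lambda>k. (f w k - f z k) / (w - z) - D k)) \<le> 32 * B / r\<^sup>2 * cmod (w - z)"
  proof eventually_elim
    case (elim w)
    then have bound: "cmod ((f w k - f z k) / (w - z) - D k) \<le> 32 * B / r\<^sup>2 * cmod (w - z)" for k
      by (intro quotient) auto
    show ?case using linf_norm_le[OF bound] linf_norm_nonneg[OF bounded_seqI[OF bound]] by simp
  qed
  moreover have "((\<lambda>w. 32 * B / r\<^sup>2 * cmod (w - z)) \<longlongrightarrow> 0) (at z)"
    by (rule tendsto_eq_intros | simp)+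
  ultimately show "((\<lambda>w. linf_norm (\<lambda>k. (f w k - f z k) / (w - z) - D k)) \<longlongrightarrow> 0) (at z)"
    by (rule Lim_null_comparison)
qed

lemma
  assumes strip: "\<And>k. strip_fun (\<lambda>z. f z k)"
    and cont: "\<And>z. z \<in> cstrip \<Longrightarrow> uniform_limit UNIV f (f z) (at z within cstrip)"
    and line0: "\<And>t k. cmod (f (line0 t) k) \<le> M"
    and line1: "\<And>t K. (\<Sum>k<K. cmod (f (line1 t) k)) \<le> M"
  shows calderonI: "f \<in> calderon"
    and calderon_norm_le: "calderon_norm f \<le> M"
proof -
  have "cmod (f (line1 t) k) \<le> M" for t k
    using member_le_sum[of k "{..<Suc k}" "\<lambda>k. cmod (f (line1 t) k)"] line1[of t "Suc k"] by auto
  then have bound: "cmod (f z k) \<le> M" if "z \<in> cstrip" for z k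
    by (rule strip_fun_maximum_principle[OF strip line0 _ that])
  have bounded: "\<exists>M. \<forall>z\<in>cstrip. bounded_seq (f z) \<and> linf_norm (f z) \<le> M"
    using bound by (intro exI[of _ M]) (auto intro: bounded_seqI linf_norm_le)
  have continuous: "\<exists>d>0. \<forall>w\<in>cstrip. cmod (w - z) < d \<longrightarrow> linf_norm (\<lambda>k. f w k - f z k) < e"
    if z: "z \<in> cstrip" and e: "e > 0" for z and e :: real
  proof -
    obtain d where d: "d > 0" "\<And>w k. w \<in> cstrip \<Longrightarrow> w \<noteq> z \<Longrightarrow> dist w z < d \<Longrightarrow> dist (f w k) (f z k) < e/2"
      using uniform_limitD[OF cont[OF z] half_gt_zero[OF e]] unfolding eventually_at by auto
    have "linf_norm (\<lambda>k. f w k - f z k) < e" if w: "w \<in> cstrip" "cmod (w - z) < d" for w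
    proof -
      have "cmod (f w k - f z k) \<le> e/2" for k
        using d(2)[OF w(1), of k] w(2) e by (cases "w = z") (auto simp: dist_norm)
      then have "linf_norm (\<lambda>k. f w k - f z k) \<le> e/2" by (rule linf_norm_le)
      then show ?thesis using e by simp
    qed
    then show ?thesis using d(1) by blast
  qed
  have holomorphic: "\<exists>D. bounded_seq D \<and>
      ((\<lambda>w. linf_norm (\<lambda>k. (f w k - f z k) / (w - z) - D k)) \<longlongrightarrow> 0) (at z)" if z: "z \<in> strip" for z
  proof -
    obtain r where r: "r > 0" "ball z r \<subseteq> strip" using open_strip z by (rule openE)
    show ?thesis
    proof (rule uniformly_bounded_holomorphic_differentiable[OF _ r(1)])
      show "(\<lambda>w. f w k) holomorphic_on ball z r" for k
        using strip_fun_holomorphic[OF strip] r(2) by (rule holomorphic_on_subset)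
      show "cmod (f w k) \<le> M" if "w \<in> ball z r" for w k
        using that r(2) strip_subset_cstrip by (intro bound) blast
    qed
  qed
  show "f \<in> calderon"
    unfolding calderon_def mem_Collect_eq
    using bounded continuous holomorphic in_l1I[OF line1] l1_norm_le[OF line1] by blast
  show "calderon_norm f \<le> M"
    unfolding calderon_norm_def
    using line0 line1 by (intro max.boundedI cSUP_least linf_norm_le l1_norm_le) auto
qed

lemma calderon_norm_line0:
  assumes f: "f \<in> calderon"
  shows "cmod (f (line0 t) k) \<le> calderon_norm f"
proof -
  obtain M where "\<forall>z\<in>cstrip. linf_norm (f z) \<le> M" using f by (auto simp: calderon_def)
  then have "bdd_above (range (\<lambda>t::real. linf_norm (f (line0 t))))"
    by (intro bdd_aboveI[where M = M]) auto
  then have "linf_norm (f (line0 t)) \<le> (SUP t::real. linf_norm (f (line0 t)))"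
    by (intro cSUP_upper) auto
  moreover have "cmod (f (line0 t) k) \<le> linf_norm (f (line0 t))"
    by (intro le_linf_norm calderon_bounded_seq f) simp
  ultimately show ?thesis unfolding calderon_norm_def by linarith
qed

lemma calderon_norm_line1:
  assumes f: "f \<in> calderon" and K: "finite K"
  shows "(\<Sum>k\<in>K. cmod (f (line1 t) k)) \<le> calderon_norm f"
proof -
  obtain M where "\<forall>t::real. l1_norm (f (line1 t)) \<le> M" using f by (auto simp: calderon_def)
  then have "bdd_above (range (\<lambda>t::real. l1_norm (f (line1 t))))"
    by (intro bdd_aboveI[where M = M]) auto
  then have "l1_norm (f (line1 t)) \<le> (SUP t::real. l1_norm (f (line1 t)))"
    by (intro cSUP_upper) auto
  moreover have "(\<Sum>k\<in>K. cmod (f (line1 t) k)) \<le> l1_norm (f (line1 t))"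
    using f K by (intro sum_le_l1_norm) (auto simp: calderon_def)
  ultimately show ?thesis unfolding calderon_norm_def by linarith
qed

lemma calderon_norm_nonneg: "f \<in> calderon \<Longrightarrow> 0 \<le> calderon_norm f"
  using calderon_norm_line0[of f 0 0] norm_ge_zero order_trans by blast

lemma coord_le_calderon_norm:
  assumes f: "f \<in> calderon" and z: "z \<in> cstrip"
  shows "cmod (f z k) \<le> calderon_norm f"
  using calderon_norm_line1[OF f, of "{k}"]
  by (intro strip_fun_maximum_principle[OF calderon_coord_strip_fun[OF f] _ _ z])
     (auto intro: calderon_norm_line0[OF f])

lemma
  assumes f: "f \<in> calderon" and g: "g \<in> calderon" and c: "\<And>k. cmod (c k) \<le> C"
  shows calderon_add_coord_scale: "(\<lambda>z k. f z k + c k * g z k) \<in> calderon"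
    and calderon_norm_add_coord_scale_le:
      "calderon_norm (\<lambda>z k. f z k + c k * g z k) \<le> calderon_norm f + C * calderon_norm g"
proof -
  have C: "0 \<le> C" using c[of 0] norm_ge_zero order_trans by blast
  have strip: "strip_fun (\<lambda>z. f z k + c k * g z k)" for k
    by (intro strip_fun_add strip_fun_mult strip_fun_const calderon_coord_strip_fun f g)
  have cont: "uniform_limit UNIV (\<lambda>w k. f w k + c k * g w k) (\<lambda>k. f z k + c k * g z k) (at z within cstrip)"
    if z: "z \<in> cstrip" for z
  proof (intro uniform_limit_add uniform_lim_mult uniform_limit_const calderon_uniform_limit f g z)
    show "bounded (range c)" using c by (auto intro: boundedI)
    show "bounded (range (g z))" using coord_le_calderon_norm[OF g z] by (auto intro: boundedI)
  qed
  have line0: "cmod (f (line0 t) k + c k * g (line0 t) k) \<le> calderon_norm f + C * calderon_norm g" for t k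
    by (intro norm_triangle_mono calderon_norm_line0 f)
       (auto simp: norm_mult intro!: mult_mono c C calderon_norm_line0 g)
  have line1: "(\<Sum>k<K. cmod (f (line1 t) k + c k * g (line1 t) k)) \<le> calderon_norm f + C * calderon_norm g" for t K
  proof -
    have "(\<Sum>k<K. cmod (f (line1 t) k + c k * g (line1 t) k))
        \<le> (\<Sum>k<K. cmod (f (line1 t) k) + C * cmod (g (line1 t) k))"
      by (intro sum_mono norm_triangle_mono order_refl) (simp add: norm_mult mult_right_mono c)
    also have "\<dots> = (\<Sum>k<K. cmod (f (line1 t) k)) + C * (\<Sum>k<K. cmod (g (line1 t) k))"
      by (simp add: sum.distrib sum_distrib_left)
    finally show ?thesis
      using calderon_norm_line1[OF f, of "{..<K}" t] mult_left_mono[OF calderon_norm_line1[OF g, of "{..<K}" t] C]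
      by simp
  qed
  show "(\<lambda>z k. f z k + c k * g z k) \<in> calderon"
    by (rule calderonI[OF strip cont line0 line1])
  show "calderon_norm (\<lambda>z k. f z k + c k * g z k) \<le> calderon_norm f + C * calderon_norm g"
    by (rule calderon_norm_le[OF strip cont line0 line1])
qed

lemma calderon_diff: "f \<in> calderon \<Longrightarrow> g \<in> calderon \<Longrightarrow> (\<lambda>z k. f z k - g z k) \<in> calderon"
  using calderon_add_coord_scale[of f g "\<lambda>k. -1" 1] by simp

lemma
  assumes A: "finite A" and strip: "\<And>k. k \<in> A \<Longrightarrow> strip_fun (\<lambda>z. f z k)"
    and off: "\<And>z k. k \<notin> A \<Longrightarrow> f z k = 0"
    and line0: "\<And>t k. k \<in> A \<Longrightarrow> cmod (f (line0 t) k) \<le> M"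
    and line1: "\<And>t. (\<Sum>k\<in>A. cmod (f (line1 t) k)) \<le> M"
  shows calderon_finite_supportI: "f \<in> calderon"
    and calderon_norm_finite_support_le: "calderon_norm f \<le> M"
proof -
  have strip': "strip_fun (\<lambda>z. f z k)" for k
    using strip off by (cases "k \<in> A") auto
  have cont: "uniform_limit UNIV f (f z) (at z within cstrip)" if z: "z \<in> cstrip" for z
  proof (rule uniform_limitI)
    fix e :: real assume e: "e > 0"
    have "\<forall>\<^sub>F w in at z within cstrip. \<forall>k\<in>A. dist (f w k) (f z k) < e"
      using strip_fun_continuous[OF strip'] z e A
      by (intro eventually_ball_finite ballI tendstoD) (auto simp: continuous_on_def)
    then show "\<forall>\<^sub>F w in at z within cstrip. \<forall>k\<in>UNIV. dist (f w k) (f z k) < e"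
    proof eventually_elim
      case (elim w)
      then show ?case using e by (metis dist_self off)
    qed
  qed
  have M: "0 \<le> M" by (rule order_trans[OF sum_nonneg line1[of 0]]) simp
  have line0': "cmod (f (line0 t) k) \<le> M" for t k
    using line0 off M by (cases "k \<in> A") auto
  have line1': "(\<Sum>k<K. cmod (f (line1 t) k)) \<le> M" for t K
  proof -
    have "(\<Sum>k<K. cmod (f (line1 t) k)) = (\<Sum>k\<in>{..<K} \<inter> A. cmod (f (line1 t) k))"
      by (intro sum.mono_neutral_right) (auto simp: off)
    also have "\<dots> \<le> (\<Sum>k\<in>A. cmod (f (line1 t) k))" by (intro sum_mono2) (use A in auto)
    finally show ?thesis using line1[of t] by linarith
  qed
  show "f \<in> calderon" by (rule calderonI[OF strip' cont line0' line1'])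
  show "calderon_norm f \<le> M" by (rule calderon_norm_le[OF strip' cont line0' line1'])
qed

lemma calderon_zero: "(\<lambda>z k. 0) \<in> calderon"
  and calderon_norm_zero: "calderon_norm (\<lambda>z k. 0) = 0"
proof -
  show zero: "(\<lambda>z k. 0) \<in> calderon" by (rule calderon_finite_supportI[where A = "{}" and M = 0]) auto
  have "calderon_norm (\<lambda>z k. 0) \<le> 0" by (rule calderon_norm_finite_support_le[where A = "{}"]) auto
  then show "calderon_norm (\<lambda>z k. 0) = 0" using calderon_norm_nonneg[OF zero] by simp
qed

lemma calderon_cofactor_uniform_limit_half:
  assumes f: "f \<in> calderon" and strip: "\<And>k. strip_fun (\<lambda>z. h z k)"
    and factor: "\<And>z k. f z k = (z - 1/2) * h z k"
  shows "uniform_limit UNIV h (h (1/2)) (at (1/2))"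
proof -
  obtain D where D: "bounded_seq D"
    "((\<lambda>w. linf_norm (\<lambda>k. (f w k - f (1/2) k) / (w - 1/2) - D k)) \<longlongrightarrow> 0) (at (1/2))"
    by (rule calderon_differentiable[OF f half_in_strip])
  have "\<forall>\<^sub>F w in at (1/2). w \<noteq> 1/2 \<and> w \<in> cstrip"
    using eventually_neq_at_within eventually_in_cstrip_at[OF half_in_strip] by (rule eventually_conj)
  then have "\<forall>\<^sub>F w in at (1/2). \<forall>k\<in>UNIV. norm (h w k - D k)
      \<le> linf_norm (\<lambda>k. (f w k - f (1/2) k) / (w - 1/2) - D k)"
  proof eventually_elim
    case (elim w)
    then have "(f w k - f (1/2) k) / (w - 1/2) = h w k" for k by (simp add: factor)
    then show ?case
      using calderon_difference_quotient_le[OF f half_in_cstrip _ D(1), of w] elim by simp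
  qed
  moreover have "uniform_limit UNIV (\<lambda>w k. linf_norm (\<lambda>k. (f w k - f (1/2) k) / (w - 1/2) - D k)) (\<lambda>k. 0) (at (1/2))"
    using D(2) by (simp add: uniform_limit_iff tendsto_iff)
  ultimately have "uniform_limit UNIV (\<lambda>w k. h w k - D k) (\<lambda>k. 0) (at (1/2))"
    by (rule uniform_limit_null_comparison)
  then have lim: "uniform_limit UNIV h D (at (1/2))"
    by (simp add: uniform_limit_iff dist_norm)
  have "((\<lambda>w. h w k) \<longlongrightarrow> h (1/2) k) (at (1/2))" for k
    using strip_fun_continuous[OF strip[of k]] half_in_cstrip
    unfolding continuous_on_def at_half_within_cstrip[symmetric] by blast
  then have "h (1/2) = D"
    using tendsto_uniform_limitI[OF lim] by (blast intro: LIM_unique)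
  then show ?thesis using lim by simp
qed

lemma calderon_cofactor_uniform_limit:
  assumes f: "f \<in> calderon" and strip: "\<And>k. strip_fun (\<lambda>z. h z k)"
    and factor: "\<And>z k. f z k = (z - 1/2) * h z k" and z: "z \<in> cstrip"
  shows "uniform_limit UNIV h (h z) (at z within cstrip)"
proof (cases "z = 1/2")
  case True
  show ?thesis
    unfolding True at_half_within_cstrip by (rule calderon_cofactor_uniform_limit_half[OF f strip factor])
next
  case False
  have quotient: "f w k * (1 / (w - 1/2)) = h w k" if "w \<noteq> 1/2" for w k
  proof -
    have "w - 1/2 \<noteq> 0" using that by simp
    then show ?thesis unfolding factor by simp
  qed
  have "uniform_limit UNIV (\<lambda>w k. f w k * (1 / (w - 1/2))) (\<lambda>k. f z k * (1 / (z - 1/2))) (at z within cstrip)"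
  proof (rule uniform_lim_mult[OF calderon_uniform_limit[OF f z]])
    have "((\<lambda>w. 1 / (w - 1/2)) \<longlongrightarrow> 1 / (z - 1/2)) (at z within cstrip)"
      using False by (intro tendsto_intros) auto
    then show "uniform_limit UNIV (\<lambda>w k. 1 / (w - 1/2)) (\<lambda>k. 1 / (z - 1/2)) (at z within cstrip)"
      by (simp add: uniform_limit_iff tendsto_iff)
    show "bounded (range (f z))" using coord_le_calderon_norm[OF f z] by (auto intro: boundedI)
  qed simp
  moreover have "\<forall>\<^sub>F w in at z within cstrip. \<forall>k\<in>UNIV. f w k * (1 / (w - 1/2)) = h w k"
    using eventually_neq_at_within[of "1/2"] by eventually_elim (intro ballI quotient)
  ultimately show ?thesis
    by (rule iffD1[OF uniform_limit_cong, rotated 2]) (rule quotient[OF False])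
qed

lemma calderon_divide_zero:
  assumes f: "f \<in> calderon" and zero: "\<And>k. f (1/2) k = 0"
  obtains h where "h \<in> calderon" "calderon_norm h \<le> 2 * calderon_norm f"
    "\<And>j k. taylor_coeff h j k = taylor_coeff f (Suc j) k"
proof -
  have "\<exists>h. strip_fun h \<and> (\<forall>z. f z k = (z - 1/2) * h z) \<and>
      (\<forall>j. fps_nth (germ h) j = fps_nth (germ (\<lambda>z. f z k)) (Suc j))" for k
    using strip_fun_divide_zero[OF calderon_coord_strip_fun[OF f] zero] by metis
  then obtain g where g: "\<And>k. strip_fun (g k)" "\<And>k z. f z k = (z - 1/2) * g k z"
    "\<And>k j. fps_nth (germ (g k)) j = fps_nth (germ (\<lambda>z. f z k)) (Suc j)" by metis
  define h where "h z k = g k z" for z k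
  have strip: "strip_fun (\<lambda>z. h z k)" for k by (simp add: h_def g)
  have factor: "f z k = (z - 1/2) * h z k" for z k unfolding h_def by (rule g)
  have edge_le: "cmod (h z k) \<le> 2 * cmod (f z k)" if "1/2 \<le> cmod (z - 1/2)" for z k
    using mult_right_mono[OF that, of "cmod (h z k)"] unfolding factor norm_mult by simp
  have line0: "cmod (h (line0 t) k) \<le> 2 * calderon_norm f" for t k
    using edge_le[OF half_le_cmod_line_diff_half(1)[of t], of k] calderon_norm_line0[OF f, of t k] by linarith
  have line1: "(\<Sum>k<K. cmod (h (line1 t) k)) \<le> 2 * calderon_norm f" for t K
  proof -
    have "(\<Sum>k<K. cmod (h (line1 t) k)) \<le> (\<Sum>k<K. 2 * cmod (f (line1 t) k))"
      by (intro sum_mono edge_le half_le_cmod_line_diff_half)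
    then show ?thesis using calderon_norm_line1[OF f, of "{..<K}" t] by (simp flip: sum_distrib_left)
  qed
  note cont = calderon_cofactor_uniform_limit[OF f strip factor]
  show ?thesis
  proof
    show "h \<in> calderon" by (rule calderonI[OF strip cont line0 line1])
    show "calderon_norm h \<le> 2 * calderon_norm f" by (rule calderon_norm_le[OF strip cont line0 line1])
    show "taylor_coeff h j k = taylor_coeff f (Suc j) k" for j k
      unfolding taylor_coeff_germ h_def by (rule g)
  qed
qed

lemma
  assumes P: "\<And>m. P m \<in> calderon" and \<epsilon>: "\<epsilon> \<longlonglongrightarrow> 0"
    and close: "\<And>m z k. z \<in> cstrip \<Longrightarrow> cmod (F z k - P m z k) \<le> \<epsilon> m"
  shows calderon_limit_strip_fun: "strip_fun (\<lambda>z. F z k)"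
    and calderon_limit_uniform_limit: "z \<in> cstrip \<Longrightarrow> uniform_limit UNIV F (F z) (at z within cstrip)"
proof -
  show "strip_fun (\<lambda>z. F z k)"
  proof (rule strip_fun_uniform_limit)
    show "strip_fun (\<lambda>z. P m z k)" for m by (rule calderon_coord_strip_fun[OF P])
    show "uniform_limit cstrip (\<lambda>m z. P m z k) (\<lambda>z. F z k) sequentially"
    proof (rule uniform_limitI)
      fix e :: real assume "e > 0"
      then have "\<forall>\<^sub>F m in sequentially. \<epsilon> m < e" by (rule order_tendstoD(2)[OF \<epsilon>])
      then show "\<forall>\<^sub>F m in sequentially. \<forall>z\<in>cstrip. dist (P m z k) (F z k) < e"
        by eventually_elim
           (auto simp: dist_norm norm_minus_commute[of "P _ _ _"] intro: le_less_trans[OF close])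
    qed
  qed
  assume z: "z \<in> cstrip"
  show "uniform_limit UNIV F (F z) (at z within cstrip)"
  proof (rule uniform_limitI)
    fix e :: real assume "e > 0"
    then obtain m where m: "\<epsilon> m < e / 3"
      using order_tendstoD(2)[OF \<epsilon>, of "e/3"] by (auto simp: eventually_sequentially)
    have "\<forall>\<^sub>F w in at z within cstrip. \<forall>k\<in>UNIV. dist (P m w k) (P m z k) < e / 3"
      using calderon_uniform_limit[OF P z] \<open>e > 0\<close> by (intro uniform_limitD) auto
    with eventually_in_cstrip show "\<forall>\<^sub>F w in at z within cstrip. \<forall>k\<in>UNIV. dist (F w k) (F z k) < e"
    proof eventually_elim
      case (elim w)
      show ?case
      proof
        fix k
        have "dist (F w k) (F z k) \<le> dist (F w k) (P m w k) + dist (P m w k) (P m z k) + dist (P m z k) (F z k)"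
          by (meson add_right_mono dist_triangle order_trans)
        moreover have "dist (F w k) (P m w k) \<le> \<epsilon> m" "dist (P m z k) (F z k) \<le> \<epsilon> m"
          using close[OF elim(1), of k m] close[OF z, of k m] by (simp_all add: dist_norm norm_minus_commute)
        moreover have "dist (P m w k) (P m z k) < e / 3" using elim(2) by blast
        ultimately show "dist (F w k) (F z k) < e" using m by linarith
      qed
    qed
  qed
qed

lemma Cauchy_of_tail_bound:
  fixes x :: "nat \<Rightarrow> 'a::real_normed_vector"
  assumes tail: "\<And>p q. p \<le> q \<Longrightarrow> norm (x q - x p) \<le> \<epsilon> p" and \<epsilon>: "\<epsilon> \<longlonglongrightarrow> 0"
  shows "Cauchy x"
proof (rule metric_CauchyI)
  fix e :: real assume "e > 0"
  then obtain N where "\<epsilon> N < e / 2"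
    using order_tendstoD(2)[OF \<epsilon>, of "e/2"] by (auto simp: eventually_sequentially)
  then have "dist (x m) (x N) < e / 2" if "m \<ge> N" for m
    using tail[OF that] by (simp add: dist_norm)
  then show "\<exists>N. \<forall>m\<ge>N. \<forall>n\<ge>N. dist (x m) (x n) < e"
    using dist_triangle_half_l by blast
qed

text \<open>Both edge norms are lower semicontinuous under pointwise limits, so a Cauchy sequence converges
  in norm to its pointwise limit.\<close>

lemma calderon_complete:
  assumes P: "\<And>m. P m \<in> calderon"
    and cauchy: "\<And>p q. p \<le> q \<Longrightarrow> calderon_norm (\<lambda>z k. P q z k - P p z k) \<le> \<epsilon> p"
    and \<epsilon>: "\<epsilon> \<longlonglongrightarrow> 0"
  obtains F where "F \<in> calderon" "\<And>m. calderon_norm (\<lambda>z k. F z k - P m z k) \<le> \<epsilon> m"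
proof -
  have diff: "(\<lambda>z k. P q z k - P p z k) \<in> calderon" for p q by (intro calderon_diff P)
  have coord: "cmod (P q z k - P p z k) \<le> \<epsilon> p" if "z \<in> cstrip" "p \<le> q" for z k p q
    by (rule order_trans[OF coord_le_calderon_norm[OF diff that(1)] cauchy[OF that(2)]])
  define F where "F z k = lim (\<lambda>m. P m z k)" for z k
  have F: "(\<lambda>m. P m z k) \<longlonglongrightarrow> F z k" if "z \<in> cstrip" for z k
    unfolding F_def convergent_LIMSEQ_iff[symmetric]
    using coord[OF that] by (intro Cauchy_convergent Cauchy_of_tail_bound[OF _ \<epsilon>])
  have close: "cmod (F z k - P m z k) \<le> \<epsilon> m" if z: "z \<in> cstrip" for z k m
    by (rule tendsto_upperbound[OF tendsto_norm[OF tendsto_diff[OF F[OF z] tendsto_const]]])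
       (auto intro!: eventually_sequentiallyI[of m] coord[OF z])
  have line1: "(\<Sum>k<K. cmod (F (line1 t) k - P m (line1 t) k)) \<le> \<epsilon> m" for t K m
  proof (rule tendsto_upperbound)
    show "(\<lambda>q. \<Sum>k<K. cmod (P q (line1 t) k - P m (line1 t) k))
        \<longlonglongrightarrow> (\<Sum>k<K. cmod (F (line1 t) k - P m (line1 t) k))"
      by (intro tendsto_intros F) simp
    show "\<forall>\<^sub>F q in sequentially. (\<Sum>k<K. cmod (P q (line1 t) k - P m (line1 t) k)) \<le> \<epsilon> m"
      using order_trans[OF calderon_norm_line1[OF diff finite_lessThan] cauchy]
      by (intro eventually_sequentiallyI[of m])
  qed simp
  have line0: "cmod (F (line0 t) k - P m (line0 t) k) \<le> \<epsilon> m" for t k m by (rule close) simp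
  have strip: "strip_fun (\<lambda>z. F z k - P m z k)" for k m
    by (intro strip_fun_diff calderon_limit_strip_fun[OF P \<epsilon> close] calderon_coord_strip_fun P)
  have cont: "uniform_limit UNIV (\<lambda>w k. F w k - P m w k) (\<lambda>k. F z k - P m z k) (at z within cstrip)"
    if "z \<in> cstrip" for z m
    by (intro uniform_limit_minus calderon_limit_uniform_limit[OF P \<epsilon> close] calderon_uniform_limit P that)
  have "(\<lambda>z k. F z k - P 0 z k) \<in> calderon" by (rule calderonI[OF strip cont line0 line1])
  then have "F \<in> calderon"
    using calderon_add_coord_scale[OF _ P[of 0], of _ "\<lambda>k. 1" 1] by fastforce
  then show ?thesis by (rule that[OF _ calderon_norm_le[OF strip cont line0 line1]])
qed

section \<open>The Rochberg norms\<close>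

type_synonym array = "nat \<Rightarrow> nat \<Rightarrow> complex"

lemma vadd_eq_plus: "vadd x y = x + y"
  and vsub_eq_minus: "vsub x y = x - y"
  by (auto simp: vadd_def vsub_def fun_eq_iff)

lemma scal_apply [simp]: "scal c x j k = c * x j k"
  by (simp add: scal_def)

lemma sum_array_apply: "(\<Sum>i\<in>I. u i) j k = (\<Sum>i\<in>I. (u i :: array) j k)"
  by (induction I rule: infinite_finite_induct) auto

interpretation array: vector_space scal
  by unfold_locales (auto simp: fun_eq_iff algebra_simps)

definition representable :: "nat \<Rightarrow> array set" where
  "representable m = {x. \<exists>f. represents m f x}"

definition taylor_array :: "nat \<Rightarrow> (complex \<Rightarrow> nat \<Rightarrow> complex) \<Rightarrow> array" where
  "taylor_array n f = (\<lambda>j. if j < n then taylor_coeff f j else (\<lambda>k. 0))"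

lemma representsI: "f \<in> calderon \<Longrightarrow> (\<And>j k. j < m \<Longrightarrow> x j k = taylor_coeff f j k) \<Longrightarrow> represents m f x"
  by (auto simp: represents_def)

lemma representsD:
  assumes "represents m f x"
  shows "f \<in> calderon" "\<And>j k. j < m \<Longrightarrow> taylor_coeff f j k = x j k"
  using assms by (auto simp: represents_def)

lemma representableI: "represents m f x \<Longrightarrow> x \<in> representable m"
  by (auto simp: representable_def)

lemma representable_mono: "x \<in> representable n \<Longrightarrow> m \<le> n \<Longrightarrow> x \<in> representable m"
  unfolding representable_def represents_def mem_Collect_eq by (meson less_le_trans)

lemma taylor_coeff_bound:
  "f \<in> calderon \<Longrightarrow> cmod (taylor_coeff f j k) \<le> 4 ^ j * calderon_norm f"
  unfolding taylor_coeff_germ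
  by (intro germ_nth_bound calderon_coord_strip_fun coord_le_calderon_norm) auto

lemma taylor_coeff_0: "taylor_coeff f 0 k = f (1/2) k"
  by (simp add: taylor_coeff_germ)

lemma taylor_array_represents: "f \<in> calderon \<Longrightarrow> represents n f (taylor_array n f)"
  by (intro representsI) (auto simp: taylor_array_def)

lemma represents_add_coord_scale:
  assumes "represents m f x" "represents m g y" "\<And>k. cmod (c k) \<le> C"
  shows "represents m (\<lambda>z k. f z k + c k * g z k) (\<lambda>j k. x j k + c k * y j k)"
proof (rule representsI)
  note f = representsD[OF assms(1)] and g = representsD[OF assms(2)]
  show "(\<lambda>z k. f z k + c k * g z k) \<in> calderon"
    by (rule calderon_add_coord_scale[OF f(1) g(1) assms(3)])
  show "x j k + c k * y j k = taylor_coeff (\<lambda>z k. f z k + c k * g z k) j k" if "j < m" for j k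
    using f(2)[OF that, of k] g(2)[OF that, of k]
      calderon_coord_strip_fun[OF f(1), of k] calderon_coord_strip_fun[OF g(1), of k]
    by (simp add: taylor_coeff_germ germ_add germ_mult strip_fun_mult)
qed

lemma representable_add_coord_scale:
  "x \<in> representable m \<Longrightarrow> y \<in> representable m \<Longrightarrow> (\<And>k. cmod (c k) \<le> C)
    \<Longrightarrow> (\<lambda>j k. x j k + c k * y j k) \<in> representable m"
  unfolding representable_def using represents_add_coord_scale[where c = c and C = C] by blast

lemma represents_zero: "represents m (\<lambda>z k. 0) 0"
  by (intro representsI calderon_zero) (simp add: taylor_coeff_germ)

lemma subspace_representable: "array.subspace (representable m)"
proof (rule array.subspaceI)
  show zero: "0 \<in> representable m" by (rule representableI[OF represents_zero])
  show "x + y \<in> representable m" if "x \<in> representable m" "y \<in> representable m" for x y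
    using representable_add_coord_scale[OF that, of "\<lambda>k. 1" 1] by (simp add: plus_fun_def)
  show "scal c x \<in> representable m" if "x \<in> representable m" for c x
    using representable_add_coord_scale[OF zero that, of "\<lambda>k. c" "cmod c"] by (simp add: scal_def)
qed

lemma rochberg_iff: "x \<in> rochberg n \<longleftrightarrow> x \<in> representable n \<and> (\<forall>j\<ge>n. \<forall>k. x j k = 0)"
proof
  assume "x \<in> rochberg n"
  then show "x \<in> representable n \<and> (\<forall>j\<ge>n. \<forall>k. x j k = 0)"
    unfolding rochberg_def representable_def by auto
next
  assume x: "x \<in> representable n \<and> (\<forall>j\<ge>n. \<forall>k. x j k = 0)"
  then obtain f where f: "represents n f x" by (auto simp: representable_def)
  have "bounded_seq (x j)" if "j < n" for j
    using taylor_coeff_bound[OF representsD(1)[OF f], of j] representsD(2)[OF f that]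
    by (intro bounded_seqI[where M = "4 ^ j * calderon_norm f"]) simp
  then show "x \<in> rochberg n" using f x unfolding rochberg_def by auto
qed

lemma rochberg_representable: "x \<in> rochberg n \<Longrightarrow> x \<in> representable n"
  by (simp add: rochberg_iff)

lemma rochberg_representable_le: "x \<in> rochberg n \<Longrightarrow> m \<le> n \<Longrightarrow> x \<in> representable m"
  using representable_mono by (auto simp: rochberg_iff)

lemma taylor_array_rochberg: "f \<in> calderon \<Longrightarrow> taylor_array n f \<in> rochberg n"
  unfolding rochberg_iff
  using representableI[OF taylor_array_represents] by (auto simp: taylor_array_def)

lemma subspace_rochberg: "array.subspace (rochberg n)"
  using subspace_representable[of n] unfolding array.subspace_def by (auto simp: rochberg_iff)

lemmas representable_diff = array.subspace_diff[OF subspace_representable]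
  and representable_scal = array.subspace_scale[OF subspace_representable]
  and representable_sum = array.subspace_sum[OF subspace_representable]
  and rochberg_zero = array.subspace_0[OF subspace_rochberg]
  and rochberg_add = array.subspace_add[OF subspace_rochberg]
  and rochberg_diff = array.subspace_diff[OF subspace_rochberg]
  and rochberg_scal = array.subspace_scale[OF subspace_rochberg]
  and rochberg_sum = array.subspace_sum[OF subspace_rochberg]

lemma rnorm_bdd_below: "bdd_below {calderon_norm f | f. represents m f x}"
  by (rule bdd_belowI[where m = 0]) (auto simp: represents_def calderon_norm_nonneg)

lemma rnorm_le: "represents m f x \<Longrightarrow> rnorm m x \<le> calderon_norm f"
  unfolding rnorm_def by (intro cInf_lower rnorm_bdd_below) auto

lemma rnorm_obtain:
  assumes "x \<in> representable m" "rnorm m x < M"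
  obtains f where "represents m f x" "calderon_norm f < M"
proof -
  have "{calderon_norm f | f. represents m f x} \<noteq> {}" using assms by (auto simp: representable_def)
  then show ?thesis
    using assms(2) that unfolding rnorm_def by (subst (asm) cInf_less_iff[OF _ rnorm_bdd_below]) auto
qed

lemma le_rnormI:
  assumes "x \<in> representable m" "\<And>f. represents m f x \<Longrightarrow> K \<le> calderon_norm f"
  shows "K \<le> rnorm m x"
  unfolding rnorm_def using assms by (intro cInf_greatest) (auto simp: representable_def)

lemma rnorm_nonneg: "x \<in> representable m \<Longrightarrow> 0 \<le> rnorm m x"
  by (rule le_rnormI) (auto simp: represents_def calderon_norm_nonneg)

lemma rnorm_zero [simp]: "rnorm m 0 = 0"
  using rnorm_le[OF represents_zero, of m] rnorm_nonneg[OF representableI[OF represents_zero], of m]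
  by (simp add: calderon_norm_zero)

lemma rnorm_cong: "(\<And>j. j < m \<Longrightarrow> x j = y j) \<Longrightarrow> rnorm m x = rnorm m y"
  unfolding rnorm_def represents_def by simp

lemma rnorm_order_0: "rnorm 0 x = 0"
  using rnorm_cong[of 0 x 0] by simp

lemma rnorm_add_coord_scale_le:
  assumes x: "x \<in> representable m" and y: "y \<in> representable m" and c: "\<And>k. cmod (c k) \<le> C"
  shows "rnorm m (\<lambda>j k. x j k + c k * y j k) \<le> rnorm m x + C * rnorm m y"
proof (rule field_le_epsilon)
  fix e :: real assume "e > 0"
  have C: "0 \<le> C" using c[of 0] norm_ge_zero order_trans by blast
  define d where "d = e / (1 + C)"
  have "d > 0" "d * (1 + C) = e" using C \<open>e > 0\<close> by (simp_all add: d_def)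
  then have d: "d > 0" "d + C * d = e" by (simp_all add: algebra_simps)
  obtain f where f: "represents m f x" "calderon_norm f < rnorm m x + d"
    using rnorm_obtain[OF x] d(1) by (metis less_add_same_cancel1)
  obtain g where g: "represents m g y" "calderon_norm g < rnorm m y + d"
    using rnorm_obtain[OF y] d(1) by (metis less_add_same_cancel1)
  have "rnorm m (\<lambda>j k. x j k + c k * y j k) \<le> calderon_norm (\<lambda>z k. f z k + c k * g z k)"
    by (rule rnorm_le[OF represents_add_coord_scale[OF f(1) g(1) c]])
  also have "\<dots> \<le> calderon_norm f + C * calderon_norm g"
    by (intro calderon_norm_add_coord_scale_le representsD(1)[OF f(1)] representsD(1)[OF g(1)] c)
  also have "\<dots> \<le> (rnorm m x + d) + C * (rnorm m y + d)"
    using f(2) g(2) C by (intro add_mono mult_left_mono) auto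
  also have "\<dots> = rnorm m x + C * rnorm m y + e" using d(2) by (simp add: algebra_simps)
  finally show "rnorm m (\<lambda>j k. x j k + c k * y j k) \<le> rnorm m x + C * rnorm m y + e" .
qed

lemma rnorm_coord_scale_le:
  "x \<in> representable m \<Longrightarrow> (\<And>k. cmod (c k) \<le> C) \<Longrightarrow> rnorm m (\<lambda>j k. c k * x j k) \<le> C * rnorm m x"
  using rnorm_add_coord_scale_le[OF representableI[OF represents_zero], of x m c C] by simp

lemma rnorm_scal_le: "x \<in> representable m \<Longrightarrow> rnorm m (scal c x) \<le> cmod c * rnorm m x"
  unfolding scal_def by (rule rnorm_coord_scale_le) auto

lemma rnorm_triangle:
  "x \<in> representable m \<Longrightarrow> y \<in> representable m \<Longrightarrow> rnorm m (x + y) \<le> rnorm m x + rnorm m y"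
  using rnorm_add_coord_scale_le[of x m y "\<lambda>k. 1" 1] by (simp add: plus_fun_def)

lemma rnorm_triangle_diff:
  "x \<in> representable m \<Longrightarrow> y \<in> representable m \<Longrightarrow> rnorm m (x - y) \<le> rnorm m x + rnorm m y"
  using rnorm_add_coord_scale_le[of x m y "\<lambda>k. -1" 1] by (simp add: fun_diff_def)

lemma rnorm_triangle_sub:
  "x \<in> representable m \<Longrightarrow> y \<in> representable m \<Longrightarrow> rnorm m x \<le> rnorm m y + rnorm m (x - y)"
  using rnorm_triangle[OF _ representable_diff, of y m x y] by simp

text \<open>This holds off the representable arrays too, where both sides are the unspecified infimum of the
  empty set.\<close>

lemma rnorm_uminus [simp]: "rnorm m (- x) = rnorm m x"
proof (cases "x \<in> representable m")
  case True
  have le: "rnorm m (- y) \<le> rnorm m y" if "y \<in> representable m" for y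
    using rnorm_scal_le[OF that, of "-1"] by simp
  show ?thesis
    using le[OF True] le[OF array.subspace_neg[OF subspace_representable True]] by simp
next
  case False
  then have "- x \<notin> representable m"
    using array.subspace_neg[OF subspace_representable, of "- x" m] by auto
  with False show ?thesis by (simp add: rnorm_def representable_def)
qed

lemma rnorm_minus_commute: "rnorm m (x - y) = rnorm m (y - x)"
  using rnorm_uminus[of m "x - y"] by simp

lemma rnorm_sum:
  "(\<And>i. i \<in> I \<Longrightarrow> u i \<in> representable m) \<Longrightarrow> rnorm m (\<Sum>i\<in>I. u i) \<le> (\<Sum>i\<in>I. rnorm m (u i))"
proof (induction I rule: infinite_finite_induct)
  case (insert i I)
  then have "rnorm m (u i + (\<Sum>i\<in>I. u i)) \<le> rnorm m (u i) + rnorm m (\<Sum>i\<in>I. u i)"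
    by (intro rnorm_triangle representable_sum) auto
  moreover have "rnorm m (\<Sum>i\<in>I. u i) \<le> (\<Sum>i\<in>I. rnorm m (u i))"
    using insert.prems by (intro insert.IH) auto
  ultimately show ?case unfolding sum.insert[OF insert.hyps] by linarith
qed auto

lemma rnorm_mono:
  assumes "x \<in> representable n" "m \<le> n"
  shows "rnorm m x \<le> rnorm n x"
proof (rule le_rnormI[OF assms(1)])
  fix f assume "represents n f x"
  then have "represents m f x" using assms(2) by (auto simp: represents_def)
  then show "rnorm m x \<le> calderon_norm f" by (rule rnorm_le)
qed

lemma rnorm_le_add_rnorm_diff:
  assumes "x \<in> rochberg n" "y \<in> rochberg n" "m \<le> n"
  shows "rnorm m x \<le> rnorm m y + rnorm n (x - y)"
proof -
  have "rnorm m x \<le> rnorm m y + rnorm m (x - y)"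
    using assms by (intro rnorm_triangle_sub rochberg_representable_le)
  moreover have "rnorm m (x - y) \<le> rnorm n (x - y)"
    using assms by (intro rnorm_mono rochberg_representable rochberg_diff)
  ultimately show ?thesis by linarith
qed

lemma coord_le_rnorm:
  assumes "x \<in> representable m" "j < m"
  shows "cmod (x j k) \<le> 4 ^ j * rnorm m x"
proof -
  have "cmod (x j k) / 4 ^ j \<le> rnorm m x"
  proof (rule le_rnormI[OF assms(1)])
    fix f assume f: "represents m f x"
    then show "cmod (x j k) / 4 ^ j \<le> calderon_norm f"
      using taylor_coeff_bound[OF representsD(1)[OF f], of j k] representsD(2)[OF f assms(2)]
      by (simp add: field_simps)
  qed
  then show ?thesis by (simp add: field_simps)
qed

text \<open>The absolute value only matters for arrays outside \<open>rochberg n\<close>, where \<^const>\<open>rnorm\<close> is an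
  infimum of the empty set.\<close>

definition rdist :: "nat \<Rightarrow> array \<Rightarrow> array \<Rightarrow> real" where
  "rdist n x y = \<bar>rnorm n (x - y)\<bar>"

lemma rdist_rochberg: "x \<in> rochberg n \<Longrightarrow> y \<in> rochberg n \<Longrightarrow> rdist n x y = rnorm n (x - y)"
  unfolding rdist_def by (intro abs_of_nonneg rnorm_nonneg rochberg_representable rochberg_diff)

interpretation rochberg: Metric_space "rochberg n" "rdist n" for n :: nat
proof
  show "0 \<le> rdist n x y" "rdist n x y = rdist n y x" for x y
    by (simp_all add: rdist_def rnorm_minus_commute)
  fix x y assume x: "x \<in> rochberg n" and y: "y \<in> rochberg n"
  have "x = y" if "rnorm n (x - y) = 0"
  proof (intro ext)
    fix j k
    show "x j k = y j k"
      using coord_le_rnorm[OF rochberg_representable[OF rochberg_diff[OF x y]], of j k] that x y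
      by (cases "j < n") (auto simp: rochberg_iff)
  qed
  then show "rdist n x y = 0 \<longleftrightarrow> x = y" by (auto simp: rdist_def)
  fix z assume z: "z \<in> rochberg n"
  have "rnorm n ((x - y) + (y - z)) \<le> rnorm n (x - y) + rnorm n (y - z)"
    by (intro rnorm_triangle rochberg_representable rochberg_diff x y z)
  then show "rdist n x z \<le> rdist n x y + rdist n y z" by (simp add: rdist_rochberg x y z)
qed

lemma rochberg_limitin:
  assumes "\<And>i. s i \<in> rochberg n"
  shows "limitin (rochberg.mtopology n) s x F
    \<longleftrightarrow> x \<in> rochberg n \<and> ((\<lambda>i. rnorm n (s i - x)) \<longlongrightarrow> 0) F"
  using assms by (auto simp: rochberg.limitin_metric_dist_null rdist_def tendsto_rabs_zero_iff)

lemma fast_differences_lift: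
  assumes x: "\<And>i. x i \<in> representable n" and fast: "\<And>i. rnorm n (x (Suc i) - x i) < (1/2) ^ i"
  obtains P where "\<And>m. represents n (P m) (x m)"
    "\<And>p q. p \<le> q \<Longrightarrow> calderon_norm (\<lambda>z k. P q z k - P p z k) \<le> 2 * (1/2) ^ p"
proof -
  have diff: "x (Suc i) - x i \<in> representable n" for i by (intro representable_diff x)
  have "\<exists>f. represents n f (x (Suc i) - x i) \<and> calderon_norm f < (1/2) ^ i" for i
    using rnorm_obtain[OF diff fast] by metis
  then obtain f where f: "\<And>i. represents n (f i) (x (Suc i) - x i)"
    "\<And>i. calderon_norm (f i) < (1/2) ^ i" by metis
  obtain g where g: "represents n g (x 0)"
    using x by (auto simp: representable_def)
  define P where "P m z k = g z k + (\<Sum>i<m. f i z k)" for m z k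
  have P_Suc: "P (Suc m) = (\<lambda>z k. P m z k + 1 * f m z k)" for m by (simp add: P_def fun_eq_iff add.assoc)
  have rep: "represents n (P m) (x m)" for m
  proof (induction m)
    case 0
    show ?case using g by (simp add: P_def[abs_def])
  next
    case (Suc m)
    have "x (Suc m) = (\<lambda>j k. x m j k + 1 * (x (Suc m) - x m) j k)" by (simp add: fun_eq_iff)
    then show ?case
      unfolding P_Suc using represents_add_coord_scale[OF Suc f(1)[of m], of "\<lambda>k. 1" 1] by (simp only:) simp
  qed
  note Pc = representsD(1)[OF rep]
  have cauchy: "calderon_norm (\<lambda>z k. P q z k - P p z k) \<le> 2 * (1/2) ^ p - 2 * (1/2) ^ q" if "p \<le> q" for p q
    using that
  proof (induction q rule: dec_induct)
    case base
    then show ?case by (simp add: calderon_norm_zero)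
  next
    case (step q)
    have "calderon_norm (\<lambda>z k. P (Suc q) z k - P p z k) = calderon_norm (\<lambda>z k. (P q z k - P p z k) + 1 * f q z k)"
      by (simp add: P_Suc algebra_simps)
    also have "\<dots> \<le> calderon_norm (\<lambda>z k. P q z k - P p z k) + 1 * calderon_norm (f q)"
      by (intro calderon_norm_add_coord_scale_le calderon_diff Pc representsD(1)[OF f(1)]) simp
    finally show ?case using step.IH f(2)[of q] by simp
  qed
  have tail: "calderon_norm (\<lambda>z k. P q z k - P p z k) \<le> 2 * (1/2) ^ p" if "p \<le> q" for p q
  proof -
    have "(0::real) \<le> 2 * (1/2) ^ q" by simp
    then show ?thesis using cauchy[OF that] by linarith
  qed
  show ?thesis by (rule that[OF rep tail])
qed

lemma rochberg_complete_of_fast_differences: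
  assumes x: "\<And>i. x i \<in> rochberg n" and fast: "\<And>i. rnorm n (x (Suc i) - x i) < (1/2) ^ i"
  obtains y where "limitin (rochberg.mtopology n) x y sequentially"
proof -
  obtain P where rep: "\<And>m. represents n (P m) (x m)"
    and tail: "\<And>p q. p \<le> q \<Longrightarrow> calderon_norm (\<lambda>z k. P q z k - P p z k) \<le> 2 * (1/2) ^ p"
    by (rule fast_differences_lift[OF rochberg_representable[OF x] fast]) (rule that)
  have null: "(\<lambda>p. 2 * (1/2::real) ^ p) \<longlonglongrightarrow> 0"
    using tendsto_mult_right_zero[OF LIMSEQ_power_zero[of "1/2::real"]] by simp
  obtain F where F: "F \<in> calderon" "\<And>m. calderon_norm (\<lambda>z k. F z k - P m z k) \<le> 2 * (1/2) ^ m"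
    by (rule calderon_complete[OF representsD(1)[OF rep] tail null]) (assumption, rule that)
  define y where "y = taylor_array n F"
  have y: "y \<in> rochberg n" unfolding y_def by (rule taylor_array_rochberg[OF F(1)])
  have "rnorm n (x m - y) \<le> 2 * (1/2) ^ m" for m
  proof -
    have "represents n (\<lambda>z k. F z k + (-1) * P m z k) (\<lambda>j k. y j k + (-1) * x m j k)"
      unfolding y_def
      by (rule represents_add_coord_scale[OF taylor_array_represents[OF F(1)] rep, of _ 1]) simp
    then have "rnorm n (y - x m) \<le> calderon_norm (\<lambda>z k. F z k - P m z k)"
      using rnorm_le by (fastforce simp: fun_diff_def)
    then show ?thesis using F(2)[of m] by (simp add: rnorm_minus_commute)
  qed
  moreover have "0 \<le> rnorm n (x m - y)" for m
    by (intro rnorm_nonneg rochberg_representable rochberg_diff x y)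
  ultimately have "(\<lambda>m. rnorm n (x m - y)) \<longlonglongrightarrow> 0"
    by (intro tendsto_sandwich[OF _ _ tendsto_const null]) auto
  then show ?thesis using y by (intro that) (simp add: rochberg_limitin x)
qed

theorem rochberg_mcomplete: "rochberg.mcomplete n"
  unfolding rochberg.mcomplete_def
proof (intro allI impI)
  fix x assume cauchy: "rochberg.MCauchy n x"
  then have x: "x i \<in> rochberg n" for i by (auto simp: rochberg.MCauchy_def)
  have "\<exists>N. \<forall>p q. N \<le> p \<longrightarrow> N \<le> q \<longrightarrow> rdist n (x p) (x q) < (1/2) ^ i" for i
    using cauchy unfolding rochberg.MCauchy_def by simp
  then obtain N where N: "\<And>i p q. p \<ge> N i \<Longrightarrow> q \<ge> N i \<Longrightarrow> rdist n (x p) (x q) < (1/2) ^ i" by metis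
  define r where "r i = i + (\<Sum>l\<le>i. N l)" for i
  have r: "strict_mono r" by (auto simp: r_def strict_mono_Suc_iff)
  have "N i \<le> r i" for i using member_le_sum[of i "{..i}" N] by (simp add: r_def)
  then have "rdist n (x (r (Suc i))) (x (r i)) < (1/2) ^ i" for i
    using N strict_mono_less_eq[OF r, of i "Suc i"] by (meson le_SucI order_refl order_trans)
  then have "rnorm n (x (r (Suc i)) - x (r i)) < (1/2) ^ i" for i by (simp add: rdist_rochberg x)
  then obtain y where "limitin (rochberg.mtopology n) (\<lambda>i. x (r i)) y sequentially"
    by (rule rochberg_complete_of_fast_differences[of "\<lambda>i. x (r i)", OF x]) (rule that)
  then have "limitin (rochberg.mtopology n) x y sequentially"
    by (intro rochberg.MCauchy_convergent_subsequence[OF cauchy r]) (simp add: o_def)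
  then show "\<exists>y. limitin (rochberg.mtopology n) x y sequentially" by blast
qed

section \<open>Finitely supported arrays and coordinate projections\<close>

definition supported_in :: "nat set \<Rightarrow> array \<Rightarrow> bool" where
  "supported_in A x \<longleftrightarrow> (\<forall>j k. k \<notin> A \<longrightarrow> x j k = 0)"

definition coord_proj :: "nat set \<Rightarrow> array \<Rightarrow> array" where
  "coord_proj A x = (\<lambda>j k. if k \<in> A then x j k else 0)"

definition vanishes_below :: "nat \<Rightarrow> array \<Rightarrow> bool" where
  "vanishes_below l x \<longleftrightarrow> (\<forall>j<l. \<forall>k. x j k = 0)"

lemma supported_in_coord_proj: "supported_in A (coord_proj A x)"
  by (simp add: supported_in_def coord_proj_def)

lemma coord_proj_apply [simp]: "coord_proj A x j k = (if k \<in> A then x j k else 0)"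
  by (simp add: coord_proj_def)

lemma coord_proj_conv_coord_scale: "coord_proj A x = (\<lambda>j k. indicator A k * x j k)"
  by (auto simp: fun_eq_iff)

lemma rnorm_coord_proj_le: "x \<in> representable m \<Longrightarrow> rnorm m (coord_proj A x) \<le> rnorm m x"
  using rnorm_coord_scale_le[of x m "indicator A" 1] unfolding coord_proj_conv_coord_scale
  by (simp add: indicator_def)

lemma rochberg_coord_proj: "x \<in> rochberg n \<Longrightarrow> coord_proj A x \<in> rochberg n"
  using representable_add_coord_scale[OF representableI[OF represents_zero], of x n "indicator A" 1]
  by (simp add: rochberg_iff coord_proj_conv_coord_scale indicator_def)

lemma
  assumes A: "finite A" "supported_in A x"
    and strip: "\<And>k. k \<in> A \<Longrightarrow> strip_fun (f k)"
    and germ: "\<And>j k. j < m \<Longrightarrow> k \<in> A \<Longrightarrow> fps_nth (germ (f k)) j = x j k"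
    and line0: "\<And>t k. k \<in> A \<Longrightarrow> cmod (f k (line0 t)) \<le> M"
    and line1: "\<And>t. (\<Sum>k\<in>A. cmod (f k (line1 t))) \<le> M"
  shows representable_finite_supportI: "x \<in> representable m"
    and rnorm_finite_support_le: "rnorm m x \<le> M"
proof -
  define g where "g z k = (if k \<in> A then f k z else 0)" for z k
  have g: "g \<in> calderon" "calderon_norm g \<le> M"
    by (rule calderon_finite_supportI[where A = A and M = M] calderon_norm_finite_support_le[where A = A];
        simp add: g_def A strip line0 line1)+
  have "represents m g x"
  proof (rule representsI[OF g(1)])
    show "x j k = taylor_coeff g j k" if "j < m" for j k
      using A(2) germ[OF that] by (cases "k \<in> A") (simp_all add: taylor_coeff_germ g_def supported_in_def)
  qed
  then show "x \<in> representable m" "rnorm m x \<le> M"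
    using representableI rnorm_le g(2) order_trans by blast+
qed

lemma rnorm_le_sum_coords:
  obtains C where "C > 0"
    "\<And>A x. finite A \<Longrightarrow> supported_in A x \<Longrightarrow> x \<in> representable n \<and> rnorm n x \<le> C * (\<Sum>k\<in>A. \<Sum>j<n. cmod (x j k))"
proof -
  obtain e C where C: "C > 0" and e: "\<And>j. strip_fun (e j)"
    "\<And>i j. i < n \<Longrightarrow> fps_nth (germ (e j)) i = (if i = j then 1 else 0)"
    "\<And>j z. j < n \<Longrightarrow> z \<in> cstrip \<Longrightarrow> cmod (e j z) \<le> C"
    by (rule strip_fun_monomials[of n]) (rule that)
  show ?thesis
  proof (rule that[OF C])
    fix A x assume A: "finite A" "supported_in A x"
    define f where "f k z = (\<Sum>j<n. x j k * e j z)" for k z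
    have strip: "strip_fun (f k)" for k
      unfolding f_def by (intro strip_fun_sum strip_fun_mult strip_fun_const e)
    have germ: "fps_nth (germ (f k)) j = x j k" if "j < n" for j k
    proof -
      have "fps_nth (germ (f k)) j = (\<Sum>i<n. x i k * fps_nth (germ (e i)) j)"
        unfolding f_def using e(1) by (subst germ_sum) (auto simp: fps_sum_nth germ_mult)
      also have "\<dots> = (\<Sum>i<n. if j = i then x i k else 0)"
        using that by (intro sum.cong) (auto simp: e(2))
      finally show ?thesis using that by simp
    qed
    have f_le: "cmod (f k z) \<le> C * (\<Sum>j<n. cmod (x j k))" if "z \<in> cstrip" for z k
      unfolding f_def sum_distrib_left
      by (rule sum_norm_le) (use e(3)[OF _ that] in \<open>auto simp: norm_mult mult.commute[of C] intro!: mult_left_mono\<close>)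
    have line0: "cmod (f k (line0 t)) \<le> C * (\<Sum>k\<in>A. \<Sum>j<n. cmod (x j k))" if "k \<in> A" for t k
    proof -
      have "C * (\<Sum>j<n. cmod (x j k)) \<le> C * (\<Sum>k\<in>A. \<Sum>j<n. cmod (x j k))"
        using C A(1) that member_le_sum[of k A "\<lambda>k. \<Sum>j<n. cmod (x j k)"]
        by (intro mult_left_mono) (auto simp: sum_nonneg)
      then show ?thesis using f_le[OF line0_in_cstrip, of k t] by linarith
    qed
    have line1: "(\<Sum>k\<in>A. cmod (f k (line1 t))) \<le> C * (\<Sum>k\<in>A. \<Sum>j<n. cmod (x j k))" for t
      unfolding sum_distrib_left[of C _ A] by (intro sum_mono f_le) simp
    show "x \<in> representable n \<and> rnorm n x \<le> C * (\<Sum>k\<in>A. \<Sum>j<n. cmod (x j k))"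
      using representable_finite_supportI[OF A strip germ line0 line1]
        rnorm_finite_support_le[OF A strip germ line0 line1] by simp
  qed
qed

lemma finite_support_representable: "finite A \<Longrightarrow> supported_in A x \<Longrightarrow> x \<in> representable n"
  by (rule rnorm_le_sum_coords[of n]) blast

lemma perturb_to_vanishing:
  assumes x: "x \<in> rochberg n" "supported_in A x" and small: "rnorm l x < e" and l: "l \<le> n"
  obtains v where "v \<in> rochberg n" "supported_in A v" "vanishes_below l v" "rnorm n (x - v) < e"
proof -
  obtain f where f: "represents l f x" "calderon_norm f < e"
    by (rule rnorm_obtain[OF rochberg_representable_le[OF x(1) l] small])
  note fc = representsD(1)[OF f(1)]
  define u where "u = coord_proj A (taylor_array n f)"
  have u: "u \<in> rochberg n" unfolding u_def by (intro rochberg_coord_proj taylor_array_rochberg fc)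
  show ?thesis
  proof
    show "x - u \<in> rochberg n" by (intro rochberg_diff x u)
    show "supported_in A (x - u)" using x(2) by (simp add: supported_in_def u_def)
    show "vanishes_below l (x - u)"
      using representsD(2)[OF f(1)] x(2) l
      by (auto simp: vanishes_below_def u_def taylor_array_def supported_in_def)
    have "rnorm n u \<le> rnorm n (taylor_array n f)"
      unfolding u_def by (intro rnorm_coord_proj_le rochberg_representable[OF taylor_array_rochberg[OF fc]])
    also have "\<dots> \<le> calderon_norm f" by (rule rnorm_le[OF taylor_array_represents[OF fc]])
    finally show "rnorm n (x - (x - u)) < e" using f(2) by simp
  qed
qed

lemma
  assumes x: "x \<in> representable (Suc m)" "vanishes_below 1 x"
  shows representable_shift_1: "(\<lambda>j. x (Suc j)) \<in> representable m"
    and rnorm_shift_1: "rnorm m (\<lambda>j. x (Suc j)) \<le> 2 * rnorm (Suc m) x"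
proof -
  have divide: "\<exists>h. represents m h (\<lambda>j. x (Suc j)) \<and> calderon_norm h \<le> 2 * calderon_norm f"
    if f: "represents (Suc m) f x" for f
  proof -
    have "f (1/2) k = 0" for k
      using representsD(2)[OF f, of 0 k] x(2) by (simp add: taylor_coeff_0 vanishes_below_def)
    then obtain h where h: "h \<in> calderon" "calderon_norm h \<le> 2 * calderon_norm f"
      "\<And>j k. taylor_coeff h j k = taylor_coeff f (Suc j) k"
      by (rule calderon_divide_zero[OF representsD(1)[OF f]]) (rule that)
    then have "represents m h (\<lambda>j. x (Suc j))"
      using representsD(2)[OF f] by (intro representsI) simp_all
    with h(2) show ?thesis by blast
  qed
  show "(\<lambda>j. x (Suc j)) \<in> representable m"
    using x(1) divide representableI unfolding representable_def by blast
  have "rnorm m (\<lambda>j. x (Suc j)) / 2 \<le> rnorm (Suc m) x"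
  proof (rule le_rnormI[OF x(1)])
    fix f assume "represents (Suc m) f x"
    then show "rnorm m (\<lambda>j. x (Suc j)) / 2 \<le> calderon_norm f"
      using divide rnorm_le by fastforce
  qed
  then show "rnorm m (\<lambda>j. x (Suc j)) \<le> 2 * rnorm (Suc m) x" by simp
qed

lemma rnorm_shift:
  assumes "x \<in> representable (m + l)" "vanishes_below l x"
  shows "(\<lambda>j. x (j + l)) \<in> representable m \<and> rnorm m (\<lambda>j. x (j + l)) \<le> 2 ^ l * rnorm (m + l) x"
  using assms
proof (induction l arbitrary: x)
  case 0
  then show ?case by simp
next
  case (Suc l)
  have first: "(\<lambda>j. x (Suc j)) \<in> representable (m + l)"
      "rnorm (m + l) (\<lambda>j. x (Suc j)) \<le> 2 * rnorm (m + Suc l) x"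
    using Suc.prems representable_shift_1[of x "m + l"] rnorm_shift_1[of x "m + l"]
    by (auto simp: vanishes_below_def)
  have rest: "(\<lambda>j. x (Suc (j + l))) \<in> representable m \<and>
      rnorm m (\<lambda>j. x (Suc (j + l))) \<le> 2 ^ l * rnorm (m + l) (\<lambda>j. x (Suc j))"
    using Suc.IH[OF first(1)] Suc.prems(2) by (simp add: vanishes_below_def)
  have "2 ^ l * rnorm (m + l) (\<lambda>j. x (Suc j)) \<le> 2 ^ Suc l * rnorm (m + Suc l) x"
    using mult_left_mono[OF first(2), of "2 ^ l"] by simp
  with rest have "rnorm m (\<lambda>j. x (Suc (j + l))) \<le> 2 ^ Suc l * rnorm (m + Suc l) x" by linarith
  with rest show ?case by simp
qed

section \<open>Extremal functions and pairings\<close>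

text \<open>The extremal function of complex interpolation between \<open>\<ell>\<^sub>\<infinity>\<close> and \<open>\<ell>\<^sub>1\<close> at \<open>1/2\<close>.\<close>

lemma extremal_L2:
  assumes A: "finite A"
  obtains Y where "\<And>k. strip_fun (Y k)" "\<And>k. k \<in> A \<Longrightarrow> Y k (1/2) = v k"
    "\<And>k t. cmod (Y k (line0 t)) \<le> L2_set (\<lambda>k. cmod (v k)) A"
    "\<And>t. (\<Sum>k\<in>A. cmod (Y k (line1 t))) \<le> L2_set (\<lambda>k. cmod (v k)) A"
proof -
  define s where "s = L2_set (\<lambda>k. cmod (v k)) A"
  have s: "s \<ge> 0" "(\<Sum>k\<in>A. (cmod (v k))\<^sup>2) = s * s"
    unfolding s_def by (simp_all add: L2_set_def sum_nonneg)
  have s_pos: "s > 0" if "k \<in> A" "v k \<noteq> 0" for k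
    using member_le_L2_set[OF A that(1), of "\<lambda>k. cmod (v k)"] that(2)
    unfolding s_def[symmetric] by (simp add: less_le_trans[of 0 "cmod (v k)"])
  define Y where "Y k z = (if v k = 0 then 0 else
      of_real s * sgn (v k) * exp (of_real (2 * ln (cmod (v k) / s)) * z))" for k z
  have line1: "cmod (Y k (line1 t)) = (cmod (v k))\<^sup>2 / s" if "k \<in> A" for k t
  proof (cases "v k = 0")
    case False
    then have "cmod (Y k (line1 t)) = s * exp (2 * ln (cmod (v k) / s))"
      using s by (simp add: Y_def norm_mult norm_sgn)
    also have "exp (2 * ln (cmod (v k) / s)) = (cmod (v k) / s)\<^sup>2"
      using False s_pos[OF that] by (simp add: exp_double)
    finally show ?thesis using s_pos[OF that False] by (simp add: field_simps power2_eq_square)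
  qed (simp add: Y_def)
  show ?thesis
  proof
    show "strip_fun (Y k)" for k
      unfolding Y_def by (cases "v k = 0") (auto intro!: strip_fun_mult strip_fun_exp simp del: of_real_mult)
    show "Y k (1/2) = v k" if "k \<in> A" for k
    proof (cases "v k = 0")
      case False
      have "exp (of_real (2 * ln (cmod (v k) / s)) * (1/2)) = exp (of_real (ln (cmod (v k) / s)) :: complex)"
        by simp
      also have "\<dots> = of_real (cmod (v k) / s)"
        unfolding exp_of_real using False s_pos[OF that] by (subst exp_ln) auto
      finally show ?thesis using False s_pos[OF that] by (simp add: Y_def sgn_eq)
    qed (simp add: Y_def)
    show "cmod (Y k (line0 t)) \<le> L2_set (\<lambda>k. cmod (v k)) A" for k t
      using s(1) by (auto simp: Y_def norm_mult norm_sgn simp flip: s_def)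
    have "(\<Sum>k\<in>A. cmod (Y k (line1 t))) = s * s / s" for t
      using line1 s(2) by (simp flip: sum_divide_distrib)
    then show "(\<Sum>k\<in>A. cmod (Y k (line1 t))) \<le> L2_set (\<lambda>k. cmod (v k)) A" for t
      by (simp flip: s_def)
  qed
qed

text \<open>Bounded families for the dual couple \<open>(\<ell>\<^sub>1, \<ell>\<^sub>\<infinity>)\<close> over the coordinates in \<open>A\<close>.\<close>

definition dual_ball :: "nat set \<Rightarrow> real \<Rightarrow> (nat \<Rightarrow> complex \<Rightarrow> complex) set" where
  "dual_ball A D = {H. (\<forall>k. strip_fun (H k)) \<and> (\<forall>t. (\<Sum>k\<in>A. cmod (H k (line0 t))) \<le> D) \<and>
     (\<forall>t. \<forall>k\<in>A. cmod (H k (line1 t)) \<le> D)}"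

definition pairing :: "nat set \<Rightarrow> (nat \<Rightarrow> complex \<Rightarrow> complex) \<Rightarrow> (complex \<Rightarrow> nat \<Rightarrow> complex) \<Rightarrow> complex \<Rightarrow> complex" where
  "pairing A H F z = (\<Sum>k\<in>A. F z k * H k z)"

lemma dual_ballD:
  assumes "H \<in> dual_ball A D"
  shows "strip_fun (H k)" "(\<Sum>k\<in>A. cmod (H k (line0 t))) \<le> D"
    "k \<in> A \<Longrightarrow> cmod (H k (line1 t)) \<le> D"
  using assms by (auto simp: dual_ball_def)

lemma dual_ball_mono: "H \<in> dual_ball A D \<Longrightarrow> D \<le> D' \<Longrightarrow> H \<in> dual_ball A D'"
  by (simp add: dual_ball_def) (meson order_trans)

lemma dual_ball_mult:
  assumes H: "H \<in> dual_ball A D" and q: "strip_fun q"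
    and bound: "\<And>t. cmod (q (line0 t)) \<le> K" "\<And>t. cmod (q (line1 t)) \<le> K"
  shows "(\<lambda>k z. H k z * q z) \<in> dual_ball A (D * K)"
  unfolding dual_ball_def mem_Collect_eq
proof (intro conjI allI ballI)
  have D: "0 \<le> D" using dual_ballD(2)[OF H, of 0] sum_nonneg[of A "\<lambda>k. cmod (H k (line0 0))"] by simp
  show "strip_fun (\<lambda>z. H k z * q z)" for k by (intro strip_fun_mult dual_ballD[OF H] q)
  show "(\<Sum>k\<in>A. cmod (H k (line0 t) * q (line0 t))) \<le> D * K" for t
    using D bound(1)[of t] dual_ballD(2)[OF H, of t]
    by (simp add: norm_mult mult_mono flip: sum_distrib_right)
  show "cmod (H k (line1 t) * q (line1 t)) \<le> D * K" if "k \<in> A" for t k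
    using D bound(2)[of t] dual_ballD(3)[OF H that, of t] by (simp add: norm_mult mult_mono)
qed

lemma pairing_mult: "pairing A (\<lambda>k z. H k z * q z) F z = pairing A H F z * q z"
  by (simp add: pairing_def sum_distrib_right mult.assoc)

lemma dual_ball_norming:
  assumes A: "finite A"
  obtains H where "H \<in> dual_ball A (L2_set (\<lambda>k. cmod (v k)) A)"
    "\<And>F. F (1/2) = v \<Longrightarrow> pairing A H F (1/2) = of_real ((L2_set (\<lambda>k. cmod (v k)) A)\<^sup>2)"
proof -
  obtain Y where Y: "\<And>k. strip_fun (Y k)" "\<And>k. k \<in> A \<Longrightarrow> Y k (1/2) = cnj (v k)"
    "\<And>k t. cmod (Y k (line0 t)) \<le> L2_set (\<lambda>k. cmod (cnj (v k))) A"
    "\<And>t. (\<Sum>k\<in>A. cmod (Y k (line1 t))) \<le> L2_set (\<lambda>k. cmod (cnj (v k))) A"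
    by (rule extremal_L2[OF A, of "\<lambda>k. cnj (v k)"]) (rule that)
  show ?thesis
  proof
    fix F :: "complex \<Rightarrow> nat \<Rightarrow> complex" assume F: "F (1/2) = v"
    have "pairing A (\<lambda>k z. Y k (1 - z)) F (1/2) = (\<Sum>k\<in>A. of_real ((cmod (v k))\<^sup>2))"
      unfolding pairing_def F
      by (intro sum.cong refl) (simp add: Y(2) complex_norm_square flip: of_real_power)
    then show "pairing A (\<lambda>k z. Y k (1 - z)) F (1/2) = of_real ((L2_set (\<lambda>k. cmod (v k)) A)\<^sup>2)"
      by (simp add: L2_set_def sum_nonneg)
  next
    show "(\<lambda>k z. Y k (1 - z)) \<in> dual_ball A (L2_set (\<lambda>k. cmod (v k)) A)"
      unfolding dual_ball_def mem_Collect_eq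
    proof (intro conjI allI ballI)
      show "strip_fun (\<lambda>z. Y k (1 - z))" for k by (intro strip_fun_reflect Y)
      show "(\<Sum>k\<in>A. cmod (Y k (1 - line0 t))) \<le> L2_set (\<lambda>k. cmod (v k)) A" for t
        using Y(4)[of "-t"] by simp
      show "cmod (Y k (1 - line1 t)) \<le> L2_set (\<lambda>k. cmod (v k)) A" for k t
        using Y(3)[of k "-t"] by simp
    qed
  qed
qed

lemma strip_fun_pairing: "F \<in> calderon \<Longrightarrow> H \<in> dual_ball A D \<Longrightarrow> strip_fun (pairing A H F)"
  unfolding pairing_def[abs_def] by (intro strip_fun_sum strip_fun_mult calderon_coord_strip_fun dual_ballD)

lemma pairing_line0_le:
  assumes F: "F \<in> calderon" and H: "H \<in> dual_ball A D"
  shows "cmod (pairing A H F (line0 t)) \<le> calderon_norm F * D"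
proof -
  have "cmod (pairing A H F (line0 t)) \<le> (\<Sum>k\<in>A. calderon_norm F * cmod (H k (line0 t)))"
    unfolding pairing_def by (rule sum_norm_le) (simp add: norm_mult mult_right_mono calderon_norm_line0 F)
  also have "\<dots> \<le> calderon_norm F * D"
    unfolding sum_distrib_left[symmetric] by (intro mult_left_mono dual_ballD[OF H] calderon_norm_nonneg F)
  finally show ?thesis .
qed

lemma pairing_line1_le:
  assumes "H \<in> dual_ball A D"
  shows "cmod (pairing A H F (line1 t)) \<le> (\<Sum>k\<in>A. cmod (F (line1 t) k)) * D"
  unfolding pairing_def sum_distrib_right
  by (rule sum_norm_le) (simp add: norm_mult mult_left_mono dual_ballD[OF assms])

lemma pairing_line_le:
  assumes F: "F \<in> calderon" and H: "H \<in> dual_ball A D" and A: "finite A" and D: "0 \<le> D"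
  shows "cmod (pairing A H F (line0 t)) \<le> calderon_norm F * D" "cmod (pairing A H F (line1 t)) \<le> calderon_norm F * D"
proof -
  show "cmod (pairing A H F (line0 t)) \<le> calderon_norm F * D" by (rule pairing_line0_le[OF F H])
  have "cmod (pairing A H F (line1 t)) \<le> (\<Sum>k\<in>A. cmod (F (line1 t) k)) * D"
    by (rule pairing_line1_le[OF H])
  also have "\<dots> \<le> calderon_norm F * D" by (intro mult_right_mono calderon_norm_line1 F A D)
  finally show "cmod (pairing A H F (line1 t)) \<le> calderon_norm F * D" .
qed

lemma germ_pairing_nth:
  assumes F: "F \<in> calderon" and H: "H \<in> dual_ball A D"
  shows "fps_nth (germ (pairing A H F)) j
    = (\<Sum>k\<in>A. \<Sum>u=0..j. taylor_coeff F u k * fps_nth (germ (H k)) (j - u))"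
  unfolding pairing_def[abs_def] using calderon_coord_strip_fun[OF F] dual_ballD(1)[OF H]
  by (subst germ_sum) (auto simp: fps_sum_nth germ_mult fps_mult_nth taylor_coeff_germ)

lemma L2_le_rnorm:
  assumes x: "x \<in> representable m" and m: "m > 0" and A: "finite A"
  shows "L2_set (\<lambda>k. cmod (x 0 k)) A \<le> rnorm m x"
proof (rule le_rnormI[OF x])
  fix f assume f: "represents m f x"
  note fc = representsD(1)[OF f]
  define s where "s = L2_set (\<lambda>k. cmod (x 0 k)) A"
  have s: "s \<ge> 0" by (simp add: s_def L2_set_nonneg)
  obtain H where H: "H \<in> dual_ball A s" "\<And>F. F (1/2) = x 0 \<Longrightarrow> pairing A H F (1/2) = of_real (s\<^sup>2)"
    by (rule dual_ball_norming[OF A, of "x 0", folded s_def]) (rule that)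
  have "pairing A H f (1/2) = of_real (s\<^sup>2)"
    using representsD(2)[OF f m] by (intro H(2) ext) (simp add: taylor_coeff_0)
  moreover have "cmod (pairing A H f (1/2)) \<le> calderon_norm f * s"
    by (rule strip_fun_maximum_principle[OF strip_fun_pairing[OF fc H(1)]
          pairing_line_le[OF fc H(1) A s] half_in_cstrip])
  ultimately have "s * s \<le> calderon_norm f * s" by (simp add: norm_mult power2_eq_square s)
  then show "L2_set (\<lambda>k. cmod (x 0 k)) A \<le> calderon_norm f"
    using s calderon_norm_nonneg[OF fc] unfolding s_def[symmetric] by (cases "s = 0") auto
qed

lemma fps_mult_nth_low_order:
  fixes F G :: "'a::comm_semiring_1 fps"
  assumes G: "\<And>i. i < m \<Longrightarrow> fps_nth G i = (if i = 0 then a else 0)"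
    and F: "\<And>i. i < l \<Longrightarrow> fps_nth F i = 0" and j: "j < m + l"
  shows "fps_nth (G * F) j = a * fps_nth F j"
proof -
  have "fps_nth (G * F) j = (\<Sum>i=0..j. if i = 0 then a * fps_nth F j else 0)"
    unfolding fps_mult_nth
  proof (rule sum.cong[OF refl])
    fix i assume "i \<in> {0..j}"
    then show "fps_nth G i * fps_nth F (j - i) = (if i = 0 then a * fps_nth F j else 0)"
      using G[of i] F[of "j - i"] j by (cases "i < m") auto
  qed
  then show ?thesis by simp
qed

lemma rnorm_Suc_le_L2:
  obtains C where "C > 0"
    "\<And>A x. finite A \<Longrightarrow> supported_in A x \<Longrightarrow> vanishes_below l x
      \<Longrightarrow> rnorm (Suc l) x \<le> C * L2_set (\<lambda>k. cmod (x l k)) A"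
proof -
  obtain e C where C: "C > 0" "\<And>z. z \<in> cstrip \<Longrightarrow> cmod (e z) \<le> C"
    and e: "strip_fun e" "\<And>i. i < Suc l \<Longrightarrow> fps_nth (germ e) i = (if i = l then 1 else 0)"
    by (rule strip_fun_monomials[of "Suc l"]) (use that lessI in blast)
  show ?thesis
  proof (rule that[OF C(1)])
    fix A x assume A: "finite A" "supported_in A x" and x: "vanishes_below l x"
    obtain Y where Y: "\<And>k. strip_fun (Y k)" "\<And>k. k \<in> A \<Longrightarrow> Y k (1/2) = x l k"
      "\<And>k t. cmod (Y k (line0 t)) \<le> L2_set (\<lambda>k. cmod (x l k)) A"
      "\<And>t. (\<Sum>k\<in>A. cmod (Y k (line1 t))) \<le> L2_set (\<lambda>k. cmod (x l k)) A"
      by (rule extremal_L2[OF A(1), of "x l"]) (rule that)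
    show "rnorm (Suc l) x \<le> C * L2_set (\<lambda>k. cmod (x l k)) A"
    proof (rule rnorm_finite_support_le[OF A])
      show "strip_fun (\<lambda>z. Y k z * e z)" for k by (intro strip_fun_mult Y e)
      fix j k assume j: "j < Suc l" and k: "k \<in> A"
      have "fps_nth (germ (Y k) * germ e) j = x l k * fps_nth (germ e) j"
        by (rule fps_mult_nth_low_order[of 1 _ _ l]) (use e(2) j k Y(2) in auto)
      then show "fps_nth (germ (\<lambda>z. Y k z * e z)) j = x j k"
        using e j x by (auto simp: germ_mult Y vanishes_below_def)
    next
      show "cmod (Y k (line0 t) * e (line0 t)) \<le> C * L2_set (\<lambda>k. cmod (x l k)) A" if "k \<in> A" for t k
        unfolding norm_mult mult.commute[of C] by (intro mult_mono Y C) auto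
      fix t
      have "(\<Sum>k\<in>A. cmod (Y k (line1 t) * e (line1 t))) \<le> (\<Sum>k\<in>A. C * cmod (Y k (line1 t)))"
        unfolding norm_mult mult.commute[of _ "cmod (e _)"] by (intro sum_mono mult_right_mono C) auto
      then show "(\<Sum>k\<in>A. cmod (Y k (line1 t) * e (line1 t))) \<le> C * L2_set (\<lambda>k. cmod (x l k)) A"
        using mult_left_mono[OF Y(4)[of t], of C] C(1) unfolding sum_distrib_left[symmetric] by linarith
    qed
  qed
qed

lemma dual_ball_normalized:
  assumes A: "finite A" and d: "0 < d" "d \<le> L2_set (\<lambda>k. cmod (v k)) A"
  obtains H where "H \<in> dual_ball A (1 / d)" "\<And>F. F (1/2) = v \<Longrightarrow> pairing A H F (1/2) = 1"
proof -
  define s where "s = L2_set (\<lambda>k. cmod (v k)) A"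
  have s: "s > 0" "1 / s \<le> 1 / d" using d unfolding s_def[symmetric] by (simp_all add: frac_le)
  obtain Y where Y: "Y \<in> dual_ball A s" "\<And>F. F (1/2) = v \<Longrightarrow> pairing A Y F (1/2) = of_real (s\<^sup>2)"
    by (rule dual_ball_norming[OF A, of v, folded s_def]) (rule that)
  have "(\<lambda>k z. Y k z * of_real (1 / s\<^sup>2)) \<in> dual_ball A (s * (1 / s\<^sup>2))"
    by (intro dual_ball_mult[OF Y(1)] strip_fun_const) (simp_all add: norm_divide norm_power)
  then have "(\<lambda>k z. Y k z * of_real (1 / s\<^sup>2)) \<in> dual_ball A (1 / d)"
    by (rule dual_ball_mono) (use s in \<open>simp add: power2_eq_square\<close>)
  moreover have "pairing A (\<lambda>k z. Y k z * of_real (1 / s\<^sup>2)) F (1/2) = 1" if "F (1/2) = v" for F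
    using Y(2)[of F, OF that] s(1) unfolding pairing_mult by simp
  ultimately show ?thesis by (rule that)
qed

definition biorthogonal_bound :: "nat \<Rightarrow> real \<Rightarrow> real \<Rightarrow> real" where
  "biorthogonal_bound m M d = 1 / d * (\<Sum>r<m. (1 + M / d) ^ r)"

lemma biorthogonal_bound_pos:
  assumes "0 < m" "0 < M" "0 < d"
  shows "0 < biorthogonal_bound m M d"
  using assms unfolding biorthogonal_bound_def
  by (intro mult_pos_pos sum_pos zero_less_power) (auto intro: add_pos_pos simp: lessThan_empty_iff)

text \<open>Pairing a representative of \<open>w\<close> with its norming family gives a function equal to \<open>1\<close> at
  \<open>1/2\<close>; multiplying the family by a truncated inverse of this function makes the germ of the pairing
  constant up to order \<open>m\<close>.\<close>

lemma dual_ball_biorthogonal: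
  assumes w: "w \<in> representable m" "rnorm m w < M" and m: "0 < m" and A: "finite A"
    and d: "0 < d" "d \<le> L2_set (\<lambda>k. cmod (w 0 k)) A"
  obtains H where "H \<in> dual_ball A (biorthogonal_bound m M d)"
    "\<And>F a j. F \<in> calderon \<Longrightarrow> \<forall>u<m. \<forall>k\<in>A. taylor_coeff F u k = a * w u k \<Longrightarrow> j < m
      \<Longrightarrow> fps_nth (germ (pairing A H F)) j = (if j = 0 then a else 0)"
proof -
  obtain f where f: "represents m f w" "calderon_norm f < M" by (rule rnorm_obtain[OF w])
  note fc = representsD(1)[OF f(1)]
  obtain H where H: "H \<in> dual_ball A (1 / d)" "\<And>F. F (1/2) = w 0 \<Longrightarrow> pairing A H F (1/2) = 1"
    by (rule dual_ball_normalized[OF A d]) (rule that)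
  define h where "h = pairing A H f"
  have h: "strip_fun h" unfolding h_def by (rule strip_fun_pairing[OF fc H(1)])
  have h_half: "h (1/2) = 1"
    unfolding h_def using representsD(2)[OF f(1) m] by (intro H(2) ext) (simp add: taylor_coeff_0)
  define q where "q = truncated_inverse m h"
  have q: "strip_fun q" unfolding q_def by (rule strip_fun_truncated_inverse[OF h])
  have "calderon_norm f * (1 / d) \<le> M / d" using f(2) d(1) by (simp add: divide_right_mono)
  then have q_le: "cmod (q (line0 t)) \<le> (\<Sum>r<m. (1 + M / d) ^ r)" "cmod (q (line1 t)) \<le> (\<Sum>r<m. (1 + M / d) ^ r)" for t
    using pairing_line_le[OF fc H(1) A, of t] d(1) unfolding q_def h_def
    by (auto intro!: norm_truncated_inverse_le)
  show ?thesis
  proof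
    show "(\<lambda>k z. H k z * q z) \<in> dual_ball A (biorthogonal_bound m M d)"
      unfolding biorthogonal_bound_def by (rule dual_ball_mult[OF H(1) q q_le])
    fix F a j assume F: "F \<in> calderon" and coeff: "\<forall>u<m. \<forall>k\<in>A. taylor_coeff F u k = a * w u k" and j: "j < m"
    have scaled: "fps_nth (germ (pairing A H F)) i = a * fps_nth (germ h) i" if "i \<le> j" for i
      unfolding h_def germ_pairing_nth[OF F H(1)] germ_pairing_nth[OF fc H(1)] sum_distrib_left
      using that j representsD(2)[OF f(1)] by (intro sum.cong refl) (simp add: coeff)
    have "germ (pairing A (\<lambda>k z. H k z * q z) F) = germ (pairing A H F) * germ q"
      unfolding pairing_mult[abs_def] by (intro germ_mult strip_fun_pairing[OF F H(1)] q)
    then have "fps_nth (germ (pairing A (\<lambda>k z. H k z * q z) F)) j = a * fps_nth (germ h * germ q) j"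
      by (simp add: fps_mult_nth sum_distrib_left scaled mult.assoc)
    then show "fps_nth (germ (pairing A (\<lambda>k z. H k z * q z) F)) j = (if j = 0 then a else 0)"
      unfolding q_def by (simp add: germ_mult_truncated_inverse_nth[OF h h_half j])
  qed
qed

section \<open>Comparison with unit vectors\<close>

definition single_row :: "nat \<Rightarrow> (nat \<Rightarrow> complex) \<Rightarrow> array" where
  "single_row N a = (\<lambda>j k. if j = 0 \<and> k < N then a k else 0)"

abbreviation lincomb :: "nat \<Rightarrow> (nat \<Rightarrow> complex) \<Rightarrow> (nat \<Rightarrow> array) \<Rightarrow> array" where
  "lincomb N a w \<equiv> \<Sum>i<N. scal (a i) (w i)"

definition upper_estimate :: "nat \<Rightarrow> nat \<Rightarrow> real \<Rightarrow> (nat \<Rightarrow> array) \<Rightarrow> bool" where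
  "upper_estimate m n C w \<longleftrightarrow> (\<forall>N a. rnorm n (lincomb N a w) \<le> C * rnorm m (single_row N a))"

definition lower_estimate :: "nat \<Rightarrow> nat \<Rightarrow> real \<Rightarrow> (nat \<Rightarrow> array) \<Rightarrow> bool" where
  "lower_estimate m n c w \<longleftrightarrow> (\<forall>N a. c * rnorm m (single_row N a) \<le> rnorm n (lincomb N a w))"

lemma supported_in_single_row: "supported_in {..<N} (single_row N a)"
  by (simp add: supported_in_def single_row_def)

lemma single_row_representable: "single_row N a \<in> representable m"
  by (rule finite_support_representable[OF finite_lessThan supported_in_single_row])

lemma coeff_le_rnorm_single_row:
  assumes "m > 0" "i < N"
  shows "cmod (a i) \<le> rnorm m (single_row N a)"
  using coord_le_rnorm[OF single_row_representable assms(1), of N a i] assms by (simp add: single_row_def)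

lemma sqrt_le_rnorm_single_row:
  assumes "m > 0"
  shows "sqrt (real N) \<le> rnorm m (single_row N (\<lambda>i. 1))"
  using L2_le_rnorm[OF single_row_representable[of N "\<lambda>i. 1"] assms finite_lessThan[of N]]
  by (simp add: single_row_def L2_set_def)

text \<open>With \<open>h z = exp (2 ln r (z - 1/2))\<close>, which is small on the right edge when \<open>r\<close> is small, take the
  product of \<open>h\<close> and its truncated inverse.\<close>

lemma strip_fun_unit_germ_small_line1:
  assumes e: "e > 0"
  obtains q where "strip_fun q" "\<And>j. j < m \<Longrightarrow> fps_nth (germ q) j = (if j = 0 then 1 else 0)"
    "\<And>t. cmod (q (line1 t)) \<le> e"
proof -
  define S where "S = 1 + (\<Sum>s<m. (1 + 1) ^ s :: real)"
  have S: "S > 0" unfolding S_def by (intro add_pos_nonneg sum_nonneg) auto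
  define r where "r = min 1 (e / S)"
  have r: "0 < r" "r \<le> 1" "r \<le> e / S" using e S by (simp_all add: r_def)
  define h where "h z = exp (of_real (2 * ln r) * z) * of_real (1 / r)" for z :: complex
  have h: "strip_fun h" unfolding h_def by (intro strip_fun_mult strip_fun_exp strip_fun_const)
  have h_half: "h (1/2) = 1" using r(1) by (simp add: h_def exp_of_real)
  have h_line1: "cmod (h (line1 t)) = r" for t
    using r(1) by (simp add: h_def norm_mult norm_divide exp_double power2_eq_square)
  show ?thesis
  proof
    show "strip_fun (\<lambda>z. h z * truncated_inverse m h z)"
      by (intro strip_fun_mult strip_fun_truncated_inverse h)
    show "fps_nth (germ (\<lambda>z. h z * truncated_inverse m h z)) j = (if j = 0 then 1 else 0)" if "j < m" for j
      using germ_mult_truncated_inverse_nth[OF h h_half that]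
      by (simp add: germ_mult h strip_fun_truncated_inverse)
    fix t
    have "cmod (truncated_inverse m h (line1 t)) \<le> S"
      using norm_truncated_inverse_le[of h "line1 t" 1 m] r(2) by (simp add: h_line1 S_def)
    then have "cmod (h (line1 t) * truncated_inverse m h (line1 t)) \<le> r * S"
      unfolding norm_mult h_line1 using r(1) by (rule mult_left_mono[OF _ less_imp_le])
    then show "cmod (h (line1 t) * truncated_inverse m h (line1 t)) \<le> e"
      using r(3) S by (simp add: pos_le_divide_eq)
  qed
qed

lemma rnorm_single_row_sublinear:
  assumes e: "e > 0"
  obtains K where "K \<ge> 0"
    "\<And>N a. \<forall>i<N. cmod (a i) \<le> 1 \<Longrightarrow> rnorm m (single_row N a) \<le> K + e * real N"
proof -
  obtain q where q: "strip_fun q" "\<And>j. j < m \<Longrightarrow> fps_nth (germ q) j = (if j = 0 then 1 else 0)"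
    "\<And>t. cmod (q (line1 t)) \<le> e"
    by (rule strip_fun_unit_germ_small_line1[OF e, of m]) (rule that)
  obtain K where K: "K > 0" "\<And>z. z \<in> cstrip \<Longrightarrow> cmod (q z) \<le> K"
    by (rule strip_fun_boundedE[OF q(1)]) (rule that)
  show ?thesis
  proof (rule that[OF less_imp_le[OF K(1)]])
    fix N :: nat and a :: "nat \<Rightarrow> complex" assume a: "\<forall>i<N. cmod (a i) \<le> 1"
    have scaled: "cmod (a k * q z) \<le> B" if "k < N" "cmod (q z) \<le> B" for k z B
      using mult_mono[of "cmod (a k)" 1 "cmod (q z)" B] a that by (simp add: norm_mult)
    show "rnorm m (single_row N a) \<le> K + e * real N"
    proof (rule rnorm_finite_support_le[OF finite_lessThan supported_in_single_row])
      show "strip_fun (\<lambda>z. a k * q z)" for k by (intro strip_fun_mult strip_fun_const q)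
      show "fps_nth (germ (\<lambda>z. a k * q z)) j = single_row N a j k" if "j < m" "k \<in> {..<N}" for j k
        using q(2)[OF that(1)] that(2) q(1) by (simp add: germ_mult single_row_def)
      show "cmod (a k * q (line0 t)) \<le> K + e * real N" if "k \<in> {..<N}" for t k
        using scaled[of k "line0 t" K] K(2)[of "line0 t"] that e by (simp add: add_increasing2)
      show "(\<Sum>k<N. cmod (a k * q (line1 t))) \<le> K + e * real N" for t
        using sum_bounded_above[of "{..<N}" "\<lambda>k. cmod (a k * q (line1 t))" e] scaled q(3) K(1)
        by (fastforce simp: mult.commute)
    qed
  qed
qed

lemma rnorm_lincomb_small:
  assumes m: "m > 0" and rep: "\<And>i. p i \<in> representable n" and small: "\<And>i. rnorm n (p i) \<le> h * (1/2) ^ i"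
  shows "rnorm n (lincomb N a p) \<le> 2 * h * rnorm m (single_row N a)"
proof -
  define R where "R = rnorm m (single_row N a)"
  have R: "0 \<le> R" unfolding R_def by (rule rnorm_nonneg[OF single_row_representable])
  have h: "0 \<le> h" using order_trans[OF rnorm_nonneg[OF rep[of 0]] small[of 0]] by simp
  have "rnorm n (lincomb N a p) \<le> (\<Sum>i<N. rnorm n (scal (a i) (p i)))"
    by (rule rnorm_sum) (intro representable_scal rep)
  also have "\<dots> \<le> (\<Sum>i<N. R * (h * (1/2) ^ i))"
  proof (rule sum_mono)
    fix i assume "i \<in> {..<N}"
    then have "cmod (a i) \<le> R" unfolding R_def using m by (intro coeff_le_rnorm_single_row) auto
    then have "cmod (a i) * rnorm n (p i) \<le> R * (h * (1/2) ^ i)"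
      using small R rnorm_nonneg[OF rep] by (intro mult_mono) auto
    then show "rnorm n (scal (a i) (p i)) \<le> R * (h * (1/2) ^ i)"
      using rnorm_scal_le[OF rep[of i], of "a i"] by linarith
  qed
  also have "\<dots> = R * h * (\<Sum>i<N. (1/2) ^ i)" by (simp add: sum_distrib_left mult.assoc)
  also have "\<dots> \<le> R * h * 2"
    using R h by (intro mult_left_mono) (auto simp: sum_gp_strict)
  finally show ?thesis by (simp add: R_def mult_ac)
qed

lemma lincomb_perturbation:
  assumes m: "m > 0" and z: "\<And>i. z i \<in> rochberg n" and w: "\<And>i. w i \<in> rochberg n"
    and close: "\<And>i. rnorm n (z i - w i) \<le> h * (1/2) ^ i"
  shows "\<bar>rnorm n (lincomb N a z) - rnorm n (lincomb N a w)\<bar> \<le> 2 * h * rnorm m (single_row N a)"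
proof -
  have "lincomb N a z - lincomb N a w = lincomb N a (\<lambda>i. z i - w i)"
    by (simp add: array.scale_right_diff_distrib sum_subtractf)
  moreover have "rnorm n (lincomb N a (\<lambda>i. z i - w i)) \<le> 2 * h * rnorm m (single_row N a)"
    by (intro rnorm_lincomb_small[OF m _ close] rochberg_representable rochberg_diff z w)
  moreover have "lincomb N a z \<in> representable n" "lincomb N a w \<in> representable n"
    by (intro rochberg_representable rochberg_sum rochberg_scal z w)+
  ultimately show ?thesis
    using rnorm_triangle_sub[of "lincomb N a z" n "lincomb N a w"]
      rnorm_triangle_sub[of "lincomb N a w" n "lincomb N a z"]
      rnorm_minus_commute[of n "lincomb N a z" "lincomb N a w"] by simp
qed

lemma upper_estimate_perturbation:
  assumes "m > 0" "\<And>i. z i \<in> rochberg n" "\<And>i. w i \<in> rochberg n"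
    and "\<And>i. rnorm n (z i - w i) \<le> h * (1/2) ^ i" and "upper_estimate m n C w"
  shows "upper_estimate m n (C + 2 * h) z"
  unfolding upper_estimate_def
proof (intro allI)
  fix N a
  have "rnorm n (lincomb N a w) \<le> C * rnorm m (single_row N a)" using assms(5) by (simp add: upper_estimate_def)
  then show "rnorm n (lincomb N a z) \<le> (C + 2 * h) * rnorm m (single_row N a)"
    using lincomb_perturbation[OF assms(1-4), where N = N and a = a] unfolding distrib_right by linarith
qed

lemma lower_estimate_perturbation:
  assumes "m > 0" "\<And>i. z i \<in> rochberg n" "\<And>i. w i \<in> rochberg n"
    and "\<And>i. rnorm n (z i - w i) \<le> h * (1/2) ^ i" and "lower_estimate m n c w"
  shows "lower_estimate m n (c - 2 * h) z"
  unfolding lower_estimate_def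
proof (intro allI)
  fix N a
  have "c * rnorm m (single_row N a) \<le> rnorm n (lincomb N a w)" using assms(5) by (simp add: lower_estimate_def)
  then show "(c - 2 * h) * rnorm m (single_row N a) \<le> rnorm n (lincomb N a z)"
    using lincomb_perturbation[OF assms(1-4), where N = N and a = a] unfolding left_diff_distrib by linarith
qed

section \<open>Block sequences\<close>

definition block_system :: "nat \<Rightarrow> nat \<Rightarrow> (nat \<Rightarrow> nat set) \<Rightarrow> (nat \<Rightarrow> array) \<Rightarrow> bool" where
  "block_system n l A w \<longleftrightarrow> disjoint_family A \<and>
     (\<forall>i. finite (A i) \<and> supported_in (A i) (w i) \<and> w i \<in> rochberg n \<and> vanishes_below l (w i))"

lemma block_systemD:
  assumes "block_system n l A w"
  shows "disjoint_family A" "finite (A i)" "supported_in (A i) (w i)" "w i \<in> rochberg n" "vanishes_below l (w i)"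
  using assms by (auto simp: block_system_def)

lemma lincomb_on_block:
  assumes disj: "disjoint_family A" and supp: "\<And>i. supported_in (A i) (w i)" and i: "i < N" "k \<in> A i"
  shows "lincomb N a w j k = a i * w i j k"
proof -
  have "w i' j k = 0" if "i' \<noteq> i" for i'
    using disj[unfolded disjoint_family_on_def, rule_format, of i' i] supp[of i'] that i(2)
    by (auto simp: supported_in_def)
  then show ?thesis
    unfolding sum_array_apply using i(1) by (subst sum.remove[of _ i]) auto
qed

lemma supported_in_lincomb:
  "(\<And>i. supported_in (A i) (w i)) \<Longrightarrow> supported_in (\<Union>i<N. A i) (lincomb N a w)"
  by (auto simp: supported_in_def sum_array_apply)

lemma vanishes_below_lincomb:
  "(\<And>i. vanishes_below l (w i)) \<Longrightarrow> vanishes_below l (lincomb N a w)"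
  by (auto simp: vanishes_below_def sum_array_apply)

lemma sum_UN_blocks:
  fixes g :: "'a \<Rightarrow> 'b::comm_monoid_add" and N :: nat
  assumes "disjoint_family A" "\<And>i. finite (A i)"
  shows "(\<Sum>k\<in>(\<Union>i<N. A i). g k) = (\<Sum>i<N. \<Sum>k\<in>A i. g k)"
  using assms by (intro sum.UNION_disjoint) (auto simp: disjoint_family_on_def)

lemma germ_single_row_mult_nth:
  assumes g: "represents (n - l) g (single_row N a)" and f: "represents n f w"
    and w: "vanishes_below l w" and i: "i < N" and j: "j < n" and l: "l \<le> n"
  shows "fps_nth (germ (\<lambda>z. g z i * f z k)) j = a i * w j k"
proof -
  have "fps_nth (germ (\<lambda>z. g z i)) s = (if s = 0 then a i else 0)" if "s < n - l" for s
    using representsD(2)[OF g that, of i] i by (simp add: taylor_coeff_germ single_row_def)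
  moreover have f_germ: "fps_nth (germ (\<lambda>z. f z k)) s = w s k" if "s < n" for s
    using representsD(2)[OF f that, of k] by (simp add: taylor_coeff_germ)
  then have "fps_nth (germ (\<lambda>z. f z k)) s = 0" if "s < l" for s
    using that l w by (simp add: vanishes_below_def)
  ultimately have "fps_nth (germ (\<lambda>z. g z i) * germ (\<lambda>z. f z k)) j = a i * w j k"
    using l j by (subst fps_mult_nth_low_order[of "n - l" _ "a i" l]) (auto simp: f_germ)
  then show ?thesis by (simp add: germ_mult calderon_coord_strip_fun representsD(1)[OF f] representsD(1)[OF g])
qed

text \<open>If \<open>g\<close> represents \<open>(0, \<dots>, 0, a)\<close> and \<open>f i\<close> represents \<open>w i\<close>, then the function equal to
  \<open>g i * f i\<close> on the block \<open>A i\<close> represents the linear combination.\<close>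

lemma rnorm_lincomb_blocks_le:
  assumes blocks: "block_system n l A w" and f: "\<And>i. represents n (f i) (w i)" "\<And>i. calderon_norm (f i) \<le> M"
    and g: "represents (n - l) g (single_row N a)" and l: "l \<le> n"
  shows "rnorm n (lincomb N a w) \<le> calderon_norm g * M"
proof -
  note block = block_systemD[OF blocks] and fc = representsD(1)[OF f(1)] and gc = representsD(1)[OF g]
  have M: "0 \<le> M" by (rule order_trans[OF calderon_norm_nonneg[OF fc] f(2)])
  define U where "U = (\<Union>i<N. A i)"
  have U: "finite U" "supported_in U (lincomb N a w)"
    unfolding U_def using block(2) supported_in_lincomb[OF block(3)] by auto
  have "\<exists>b. \<forall>k\<in>U. b k < N \<and> k \<in> A (b k)" unfolding U_def by (intro bchoice) auto
  then obtain b where b: "\<And>k. k \<in> U \<Longrightarrow> b k < N" "\<And>k. k \<in> U \<Longrightarrow> k \<in> A (b k)" by metis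
  have b_eq: "b k = i" if "i < N" "k \<in> A i" for i k
    using block(1) b[of k] that unfolding U_def disjoint_family_on_def by auto
  show ?thesis
  proof (rule rnorm_finite_support_le[OF U])
    show "strip_fun (\<lambda>z. g z (b k) * f (b k) z k)" for k
      by (intro strip_fun_mult calderon_coord_strip_fun gc fc)
    show "fps_nth (germ (\<lambda>z. g z (b k) * f (b k) z k)) j = lincomb N a w j k" if "j < n" "k \<in> U" for j k
      unfolding lincomb_on_block[OF block(1,3) b[OF that(2)]]
      by (rule germ_single_row_mult_nth[OF g f(1) block(5) b(1)[OF that(2)] that(1) l])
    show "cmod (g (line0 t) (b k) * f (b k) (line0 t) k) \<le> calderon_norm g * M" for t k
      unfolding norm_mult
      by (intro mult_mono calderon_norm_line0 gc calderon_norm_nonneg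
          order_trans[OF calderon_norm_line0[OF fc] f(2)]) auto
    fix t
    have "(\<Sum>k\<in>U. cmod (g (line1 t) (b k) * f (b k) (line1 t) k))
        = (\<Sum>i<N. cmod (g (line1 t) i) * (\<Sum>k\<in>A i. cmod (f i (line1 t) k)))"
      unfolding U_def sum_UN_blocks[OF block(1,2)] by (simp add: b_eq norm_mult sum_distrib_left)
    also have "\<dots> \<le> (\<Sum>i<N. cmod (g (line1 t) i) * M)"
      using order_trans[OF calderon_norm_line1[OF fc block(2)] f(2)]
      by (intro sum_mono mult_left_mono) auto
    also have "\<dots> \<le> calderon_norm g * M"
      unfolding sum_distrib_right[symmetric]
      using M by (intro mult_right_mono calderon_norm_line1 gc) auto
    finally show "(\<Sum>k\<in>U. cmod (g (line1 t) (b k) * f (b k) (line1 t) k)) \<le> calderon_norm g * M" .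
  qed
qed

lemma upper_estimate_blocks:
  assumes blocks: "block_system n l A w" and bound: "\<And>i. rnorm n (w i) < M" and l: "l \<le> n"
  shows "upper_estimate (n - l) n M w"
  unfolding upper_estimate_def
proof (intro allI)
  fix N :: nat and a :: "nat \<Rightarrow> complex"
  have w: "w i \<in> representable n" for i by (rule rochberg_representable[OF block_systemD(4)[OF blocks]])
  have M: "0 < M" using order_le_less_trans[OF rnorm_nonneg[OF w] bound] .
  have "\<exists>f. represents n f (w i) \<and> calderon_norm f < M" for i
    using rnorm_obtain[OF w bound] by metis
  then obtain f where f: "\<And>i. represents n (f i) (w i)" "\<And>i. calderon_norm (f i) < M" by metis
  have "rnorm n (lincomb N a w) / M \<le> rnorm (n - l) (single_row N a)"
  proof (rule le_rnormI[OF single_row_representable])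
    fix g assume "represents (n - l) g (single_row N a)"
    then have "rnorm n (lincomb N a w) \<le> calderon_norm g * M"
      by (rule rnorm_lincomb_blocks_le[OF blocks f(1) less_imp_le[OF f(2)] _ l])
    then show "rnorm n (lincomb N a w) / M \<le> calderon_norm g" using M by (simp add: pos_divide_le_eq)
  qed
  then show "rnorm n (lincomb N a w) \<le> M * rnorm (n - l) (single_row N a)"
    using M by (simp add: pos_divide_le_eq mult.commute)
qed

lemma lower_estimate_blocks_of_L2:
  assumes blocks: "disjoint_family A" "\<And>i. finite (A i)" "\<And>i. supported_in (A i) (w i)"
    and w: "\<And>i. w i \<in> representable m" "\<And>i. rnorm m (w i) < M"
    and m: "0 < m" and d: "0 < d" "\<And>i. d \<le> L2_set (\<lambda>k. cmod (w i 0 k)) (A i)"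
  shows "lower_estimate m m (1 / biorthogonal_bound m M d) w"
  unfolding lower_estimate_def
proof (intro allI)
  fix N a
  define K where "K = biorthogonal_bound m M d"
  have "0 < M" using order_le_less_trans[OF rnorm_nonneg[OF w(1)] w(2)] .
  then have K: "0 < K" unfolding K_def using m d(1) by (intro biorthogonal_bound_pos)
  have "\<exists>H. H \<in> dual_ball (A i) K \<and>
      (\<forall>F a j. F \<in> calderon \<longrightarrow> (\<forall>u<m. \<forall>k\<in>A i. taylor_coeff F u k = a * w i u k) \<longrightarrow> j < m
        \<longrightarrow> fps_nth (germ (pairing (A i) H F)) j = (if j = 0 then a else 0))" for i
    unfolding K_def by (rule dual_ball_biorthogonal[OF w m blocks(2) d]) blast
  then obtain H where H: "\<And>i. H i \<in> dual_ball (A i) K"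
    and H_germ: "\<And>i F a j. F \<in> calderon \<Longrightarrow> \<forall>u<m. \<forall>k\<in>A i. taylor_coeff F u k = a * w i u k \<Longrightarrow> j < m
        \<Longrightarrow> fps_nth (germ (pairing (A i) (H i) F)) j = (if j = 0 then a else 0)" by metis
  have "rnorm m (single_row N a) / K \<le> rnorm m (lincomb N a w)"
  proof (rule le_rnormI)
    show "lincomb N a w \<in> representable m" by (intro representable_sum representable_scal w)
    fix F assume F: "represents m F (lincomb N a w)"
    note Fc = representsD(1)[OF F]
    have "rnorm m (single_row N a) \<le> calderon_norm F * K"
    proof (rule rnorm_finite_support_le[OF finite_lessThan supported_in_single_row])
      show "strip_fun (pairing (A i) (H i) F)" for i by (rule strip_fun_pairing[OF Fc H])
      show "fps_nth (germ (pairing (A i) (H i) F)) j = single_row N a j i" if "j < m" "i \<in> {..<N}" for j i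
        using that representsD(2)[OF F] lincomb_on_block[OF blocks(1,3), of i N]
        by (subst H_germ[OF Fc, of i "a i"]) (auto simp: single_row_def)
      show "cmod (pairing (A i) (H i) F (line0 t)) \<le> calderon_norm F * K" for t i
        by (rule pairing_line0_le[OF Fc H])
      fix t
      have "(\<Sum>i<N. cmod (pairing (A i) (H i) F (line1 t))) \<le> (\<Sum>i<N. (\<Sum>k\<in>A i. cmod (F (line1 t) k)) * K)"
        by (intro sum_mono pairing_line1_le H)
      also have "\<dots> = (\<Sum>k\<in>(\<Union>i<N. A i). cmod (F (line1 t) k)) * K"
        by (simp only: sum_UN_blocks[OF blocks(1,2)] sum_distrib_right)
      also have "\<dots> \<le> calderon_norm F * K"
        using K blocks(2) by (intro mult_right_mono calderon_norm_line1 Fc) auto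
      finally show "(\<Sum>i<N. cmod (pairing (A i) (H i) F (line1 t))) \<le> calderon_norm F * K" .
    qed
    then show "rnorm m (single_row N a) / K \<le> calderon_norm F" using K by (simp add: pos_divide_le_eq)
  qed
  then show "1 / biorthogonal_bound m M d * rnorm m (single_row N a) \<le> rnorm m (lincomb N a w)"
    unfolding K_def by simp
qed

lemma lower_estimate_of_shift:
  assumes w: "\<And>i. w i \<in> representable (m + l)" "\<And>i. vanishes_below l (w i)"
    and lower: "lower_estimate m m c (\<lambda>i j. w i (j + l))"
  shows "lower_estimate m (m + l) (c / 2 ^ l) w"
  unfolding lower_estimate_def
proof (intro allI)
  fix N a
  have "c * rnorm m (single_row N a) \<le> rnorm m (lincomb N a (\<lambda>i j. w i (j + l)))"
    using lower by (simp add: lower_estimate_def)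
  also have "lincomb N a (\<lambda>i j. w i (j + l)) = (\<lambda>j. lincomb N a w (j + l))"
    by (intro ext) (simp add: sum_array_apply)
  also have "rnorm m \<dots> \<le> 2 ^ l * rnorm (m + l) (lincomb N a w)"
    by (intro conjunct2[OF rnorm_shift] vanishes_below_lincomb w representable_sum representable_scal)
  finally show "c / 2 ^ l * rnorm m (single_row N a) \<le> rnorm (m + l) (lincomb N a w)"
    by (simp add: pos_divide_le_eq mult.commute)
qed

lemma lower_estimate_blocks:
  assumes l: "l < n" and M: "0 < M" and d: "0 < d"
  obtains c where "0 < c"
    "\<And>A w. block_system n l A w \<Longrightarrow> \<forall>i. rnorm n (w i) < M \<and> d \<le> rnorm (Suc l) (w i)
      \<Longrightarrow> lower_estimate (n - l) n c w"
proof -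
  obtain C where C: "C > 0"
    "\<And>A x. finite A \<Longrightarrow> supported_in A x \<Longrightarrow> vanishes_below l x
      \<Longrightarrow> rnorm (Suc l) x \<le> C * L2_set (\<lambda>k. cmod (x l k)) A"
    by (rule rnorm_Suc_le_L2[of l]) (rule that)
  obtain m where m: "0 < m" "n = m + l" using l less_imp_add_positive[OF l] by (auto simp: add.commute)
  define K where "K = biorthogonal_bound m (2 ^ l * M) (d / C)"
  have K: "K > 0" unfolding K_def using m M d C(1) by (intro biorthogonal_bound_pos) auto
  show ?thesis
  proof (rule that[of "1 / K / 2 ^ l"])
    show "0 < 1 / K / 2 ^ l" using K by simp
    fix A w assume blocks: "block_system n l A w"
      and bound: "\<forall>i. rnorm n (w i) < M \<and> d \<le> rnorm (Suc l) (w i)"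
    note block = block_systemD[OF blocks]
    have w: "w i \<in> representable (m + l)" for i
      using rochberg_representable[OF block(4)] by (simp add: m(2))
    have "lower_estimate m m (1 / K) (\<lambda>i j. w i (j + l))"
      unfolding K_def
    proof (rule lower_estimate_blocks_of_L2[OF block(1,2) _ conjunct1[OF rnorm_shift[OF w block(5)]] _ m(1)])
      show "supported_in (A i) (\<lambda>j. w i (j + l))" for i using block(3) by (simp add: supported_in_def)
      show "rnorm m (\<lambda>j. w i (j + l)) < 2 ^ l * M" for i
        using conjunct2[OF rnorm_shift[OF w[of i] block(5)]] bound m(2)
          mult_strict_left_mono[of "rnorm n (w i)" M "2 ^ l"] by (auto intro: order_le_less_trans)
      show "0 < d / C" using d C(1) by simp
      show "d / C \<le> L2_set (\<lambda>k. cmod (w i (0 + l) k)) (A i)" for i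
        using order_trans[OF _ C(2)[OF block(2,3,5)], of d i] bound C(1)
        by (simp add: pos_divide_le_eq mult.commute)
    qed
    then show "lower_estimate (n - l) n (1 / K / 2 ^ l) w"
      using lower_estimate_of_shift[of w m l "1 / K", OF w block(5)] by (simp add: m(2))
  qed
qed

definition near_blocks :: "nat \<Rightarrow> nat \<Rightarrow> (nat \<Rightarrow> nat set) \<Rightarrow> real \<Rightarrow> (nat \<Rightarrow> array) \<Rightarrow> bool" where
  "near_blocks n l A h z \<longleftrightarrow> (\<exists>w. block_system n l A w \<and> (\<forall>i. rnorm n (z i - w i) < h * (1/2) ^ i))"

lemma near_blocksE:
  assumes "near_blocks n l A h z" "\<And>i. z i \<in> rochberg n"
  obtains w where "block_system n l A w" "\<And>i. rnorm n (z i - w i) \<le> h * (1/2) ^ i"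
    "\<And>i. rnorm n (z i - w i) < h" "\<And>i. rnorm n (w i) < rnorm n (z i) + h"
proof -
  obtain w where w: "block_system n l A w" "\<And>i. rnorm n (z i - w i) < h * (1/2) ^ i"
    using assms(1) unfolding near_blocks_def by blast
  have rep: "z i \<in> representable n" "w i \<in> representable n" for i
    by (intro rochberg_representable assms(2) block_systemD[OF w(1)])+
  have h: "0 < h" using order_le_less_trans[OF rnorm_nonneg[OF representable_diff[OF rep]] w(2), of 0] by simp
  have "h * (1/2) ^ i \<le> h * 1" for i using h by (intro mult_left_mono power_le_one) auto
  then have close: "rnorm n (z i - w i) < h" for i using less_le_trans[OF w(2)] by simp
  have "rnorm n (w i) < rnorm n (z i) + h" for i
    using close[of i] rnorm_triangle_sub[OF rep(2,1)[of i]] rnorm_minus_commute[of n "w i" "z i"] by simp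
  with w close show ?thesis by (intro that[of w]) (auto intro: less_imp_le)
qed

lemma upper_estimate_near_blocks:
  assumes near: "near_blocks n l A h z" and l: "l < n" and z: "\<And>i. z i \<in> rochberg n" "\<And>i. rnorm n (z i) \<le> M"
  shows "upper_estimate (n - l) n (M + 3 * h) z"
proof -
  obtain w where w: "block_system n l A w" "\<And>i. rnorm n (z i - w i) \<le> h * (1/2) ^ i"
    "\<And>i. rnorm n (w i) < rnorm n (z i) + h"
    by (rule near_blocksE[OF near z(1)]) (rule that)
  have "rnorm n (w i) < M + h" for i using w(3)[of i] z(2)[of i] by linarith
  then have "upper_estimate (n - l) n (M + h) w" using l by (intro upper_estimate_blocks[OF w(1)]) auto
  then have "upper_estimate (n - l) n ((M + h) + 2 * h) z"
    using l by (intro upper_estimate_perturbation[OF _ z(1) block_systemD(4)[OF w(1)] w(2)]) auto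
  then show ?thesis by (simp add: add.assoc)
qed

lemma lower_estimate_near_blocks:
  assumes l: "l < n" and M: "0 \<le> M" and d: "0 < d"
  obtains c h where "0 < c" "0 < h"
    "\<And>A z. near_blocks n l A h z \<Longrightarrow> \<forall>i. z i \<in> rochberg n \<and> rnorm n (z i) \<le> M \<and> d \<le> rnorm (Suc l) (z i)
      \<Longrightarrow> lower_estimate (n - l) n c z"
proof -
  have "0 < M + d" "0 < d / 2" using M d by simp_all
  then obtain c where c: "0 < c"
    "\<And>A w. block_system n l A w \<Longrightarrow> \<forall>i. rnorm n (w i) < M + d \<and> d / 2 \<le> rnorm (Suc l) (w i)
      \<Longrightarrow> lower_estimate (n - l) n c w"
    by (rule lower_estimate_blocks[OF l]) (rule that)
  define h where "h = min (c / 4) (d / 2)"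
  have h: "0 < h" "h \<le> c / 4" "h \<le> d / 2" using c(1) d by (auto simp: h_def)
  show ?thesis
  proof (rule that[of "c - 2 * h" h])
    show "0 < c - 2 * h" "0 < h" using c(1) h by simp_all
    fix A z assume near: "near_blocks n l A h z"
      and "\<forall>i. z i \<in> rochberg n \<and> rnorm n (z i) \<le> M \<and> d \<le> rnorm (Suc l) (z i)"
    then have z: "z i \<in> rochberg n" "rnorm n (z i) \<le> M" "d \<le> rnorm (Suc l) (z i)" for i by auto
    obtain w where w: "block_system n l A w" "\<And>i. rnorm n (z i - w i) \<le> h * (1/2) ^ i"
      "\<And>i. rnorm n (z i - w i) < h" "\<And>i. rnorm n (w i) < rnorm n (z i) + h"
      by (rule near_blocksE[OF near z(1)]) (rule that)
    note w_mem = block_systemD(4)[OF w(1)]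
    have "rnorm n (w i) < M + d" "d / 2 \<le> rnorm (Suc l) (w i)" for i
      using w(3,4)[of i] z(2,3)[of i] h d l rnorm_le_add_rnorm_diff[OF z(1) w_mem, of "Suc l" i i] by simp_all
    then have "lower_estimate (n - l) n c w" by (intro c(2)[OF w(1)]) auto
    then show "lower_estimate (n - l) n (c - 2 * h) z"
      using l by (intro lower_estimate_perturbation[OF _ z(1) w_mem w(2)]) auto
  qed
qed

section \<open>Convergence of coordinate projections\<close>

lemma critical_level:
  assumes x: "\<And>i. x i \<in> representable n" "\<And>i. rnorm n (x i) \<le> M"
    and k: "k < n" and d: "d > 0" "\<And>i. d \<le> rnorm (Suc k) (x i)"
  obtains j d' and r :: "nat \<Rightarrow> nat" where "j \<le> k" "d' > 0" "strict_mono r"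
    "(\<lambda>i. rnorm j (x (r i))) \<longlonglongrightarrow> 0" "\<And>i. d' \<le> rnorm (Suc j) (x (r i))"
proof -
  have bounds: "0 \<le> rnorm l (x i)" "rnorm l (x i) \<le> M" if "l \<le> n" for l i
    using rnorm_nonneg[OF representable_mono[OF x(1) that]] rnorm_mono[OF x(1) that] x(2)[of i] order_trans
    by blast+
  obtain r :: "nat \<Rightarrow> nat" where r: "strict_mono r" "\<And>l. l \<in> {..n} \<Longrightarrow> \<exists>L. (\<lambda>i. rnorm l (x (r i))) \<longlonglongrightarrow> L"
    by (rule function_convergent_subsequence[of "{..n}" "\<lambda>i l. rnorm l (x i)" M])
       (use bounds in \<open>auto intro: that\<close>)
  then obtain L where L: "\<And>l. l \<le> n \<Longrightarrow> (\<lambda>i. rnorm l (x (r i))) \<longlonglongrightarrow> L l" by (metis atMost_iff)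
  have L_nonneg: "0 \<le> L l" if "l \<le> n" for l
    using L[OF that] bounds(1)[OF that] by (intro LIMSEQ_le_const) auto
  have "L 0 = 0" using L[of 0] by (simp add: rnorm_order_0 LIMSEQ_const_iff)
  moreover have "d \<le> L (Suc k)" using L[of "Suc k"] d(2) k by (intro LIMSEQ_le_const) auto
  ultimately obtain j where j: "j < Suc k" "\<not> 0 < L j" "0 < L (Suc j)"
    using ex_least_nat_less[of "\<lambda>l. 0 < L l" "Suc k"] d(1) by auto
  have "L j = 0" using j L_nonneg[of j] k by simp
  have "\<forall>\<^sub>F i in sequentially. L (Suc j) / 2 < rnorm (Suc j) (x (r i))"
    using L[of "Suc j"] j k by (intro order_tendstoD(1)) auto
  then obtain N where N: "\<And>i. i \<ge> N \<Longrightarrow> L (Suc j) / 2 < rnorm (Suc j) (x (r i))"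
    by (auto simp: eventually_sequentially)
  show ?thesis
  proof (rule that[of j "L (Suc j) / 2" "\<lambda>i. r (i + N)"])
    show "strict_mono (\<lambda>i. r (i + N))" using r(1) by (simp add: strict_mono_def)
    show "(\<lambda>i. rnorm j (x (r (i + N)))) \<longlonglongrightarrow> 0"
      using LIMSEQ_ignore_initial_segment[OF L[of j], of N] j k \<open>L j = 0\<close> by simp
  qed (use j N in \<open>auto intro: less_imp_le\<close>)
qed

lemma eventually_strict_mono_choice:
  assumes "\<And>m::nat. \<forall>\<^sub>F i in sequentially. P m i"
  obtains r :: "nat \<Rightarrow> nat" where "strict_mono r" "\<And>m. P m (r m)"
proof -
  have "\<exists>r. \<forall>m. P m (r m) \<and> r m < r (Suc m)"
  proof (rule dependent_nat_choice)
    show "\<exists>i. P 0 i" using eventually_happens'[OF sequentially_bot assms] .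
    show "\<exists>j. P (Suc m) j \<and> i < j" for i m
      using eventually_happens'[OF sequentially_bot eventually_conj[OF assms eventually_gt_at_top]] .
  qed
  then show ?thesis using that by (auto simp: strict_mono_Suc_iff)
qed

lemma near_blocks_of_blocks:
  assumes blocks: "disjoint_family A" "\<And>i. finite (A i)" "\<And>i. supported_in (A i) (w i)"
    and w: "\<And>i. w i \<in> rochberg n" "(\<lambda>i. rnorm l (w i)) \<longlonglongrightarrow> 0" and l: "l \<le> n" and h: "h > 0"
  obtains r :: "nat \<Rightarrow> nat" where "strict_mono r" "near_blocks n l (\<lambda>i. A (r i)) h (\<lambda>i. w (r i))"
proof -
  have "\<forall>\<^sub>F i in sequentially. rnorm l (w i) < h * (1/2) ^ m" for m
    using h by (intro order_tendstoD(2)[OF w(2)]) simp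
  then obtain r where r: "strict_mono r" "\<And>m. rnorm l (w (r m)) < h * (1/2) ^ m"
    by (rule eventually_strict_mono_choice) (rule that)
  have "\<exists>v. v \<in> rochberg n \<and> supported_in (A (r m)) v \<and> vanishes_below l v \<and> rnorm n (w (r m) - v) < h * (1/2) ^ m" for m
    by (rule perturb_to_vanishing[OF w(1) blocks(3) r(2) l]) blast
  then obtain v where v: "\<And>m. v m \<in> rochberg n" "\<And>m. supported_in (A (r m)) (v m)" "\<And>m. vanishes_below l (v m)"
    "\<And>m. rnorm n (w (r m) - v m) < h * (1/2) ^ m" by metis
  have "disjoint_family (\<lambda>i. A (r i))"
    using blocks(1) strict_mono_eq[OF r(1)] by (simp add: disjoint_family_on_def)
  then have "near_blocks n l (\<lambda>i. A (r i)) h (\<lambda>i. w (r i))"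
    unfolding near_blocks_def block_system_def using v blocks(2) by blast
  with r(1) show ?thesis by (rule that)
qed

lemma disjoint_family_intervals: "mono p \<Longrightarrow> disjoint_family (\<lambda>i. {p i..<p (Suc i) :: nat})"
proof -
  assume "mono p"
  then have "disjoint_family (\<lambda>i. {..<p (Suc i)} - {..<p i})"
    by (intro disjoint_family_Suc) (simp add: monoD)
  moreover have "{..<p (Suc i)} - {..<p i} = {p i..<p (Suc i)}" for i by auto
  ultimately show ?thesis by simp
qed

lemma coord_proj_disjoint_sum:
  fixes N :: nat
  assumes "disjoint_family A"
  shows "(\<Sum>i<N. coord_proj (A i) u) = coord_proj (\<Union>i<N. A i) u"
proof (induction N)
  case 0
  show ?case by (simp add: fun_eq_iff)
next
  case (Suc N)
  have "A i \<inter> A N = {}" if "i < N" for i using assms that by (simp add: disjoint_family_on_def)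
  then have disjoint: "k \<notin> A N" if "i < N" "k \<in> A i" for i k using that by blast
  have "(\<Sum>i<Suc N. coord_proj (A i) u) = coord_proj (\<Union>i<N. A i) u + coord_proj (A N) u"
    by (simp only: sum.lessThan_Suc Suc.IH)
  also have "\<dots> = coord_proj (\<Union>i<Suc N. A i) u"
    using disjoint by (auto simp: fun_eq_iff less_Suc_eq)
  finally show ?case .
qed

text \<open>The sums of the projections \<open>coord_proj (A i) u\<close> stay bounded, whereas a lower estimate would
  make them grow like the square root of their number.\<close>

lemma no_lower_estimate_coord_proj:
  assumes u: "u \<in> representable n" and A: "disjoint_family A" and m: "m > 0" and c: "c > 0"
  shows "\<not> lower_estimate m n c (\<lambda>i. coord_proj (A i) u)"
proof
  assume lower: "lower_estimate m n c (\<lambda>i. coord_proj (A i) u)"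
  have "c * sqrt (real N) \<le> rnorm n u" for N
  proof -
    have "c * sqrt (real N) \<le> c * rnorm m (single_row N (\<lambda>i. 1))"
      using c m by (intro mult_left_mono sqrt_le_rnorm_single_row) auto
    also have "\<dots> \<le> rnorm n (\<Sum>i<N. scal 1 (coord_proj (A i) u))"
      using lower unfolding lower_estimate_def by blast
    also have "\<dots> = rnorm n (coord_proj (\<Union>i<N. A i) u)"
      by (simp only: array.scale_one coord_proj_disjoint_sum[OF A])
    also have "\<dots> \<le> rnorm n u" by (rule rnorm_coord_proj_le[OF u])
    finally show ?thesis .
  qed
  moreover obtain N :: nat where "real N > (rnorm n u / c)\<^sup>2" using reals_Archimedean2 by blast
  then have "rnorm n u / c < sqrt (real N)" by (rule real_less_rsqrt)
  then have "rnorm n u < c * sqrt (real N)" using c by (simp add: pos_divide_less_eq mult.commute)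
  ultimately show False by (meson not_le)
qed

lemma rochberg_tails_small:
  assumes u: "u \<in> rochberg n" and d: "d > 0"
  shows "\<exists>N. \<forall>N'\<ge>N. rnorm n (coord_proj {N..<N'} u) < d"
proof (rule ccontr)
  assume "\<not> ?thesis"
  then have "\<forall>N. \<exists>N'\<ge>N. d \<le> rnorm n (coord_proj {N..<N'} u)" by (meson not_less)
  then obtain F where F: "\<And>N. N \<le> F N" "\<And>N. d \<le> rnorm n (coord_proj {N..<F N} u)" by metis
  define p where "p i = (F ^^ i) 0" for i
  have p_Suc: "p (Suc i) = F (p i)" for i by (simp add: p_def)
  define A where "A i = {p i..<p (Suc i)}" for i
  have disj: "disjoint_family A"
    unfolding A_def using F(1) by (intro disjoint_family_intervals) (simp add: mono_iff_le_Suc p_Suc)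
  define w where "w i = coord_proj (A i) u" for i
  have w: "w i \<in> rochberg n" "rnorm n (w i) \<le> rnorm n u" "d \<le> rnorm n (w i)" "supported_in (A i) (w i)" for i
    unfolding w_def using F(2)
    by (auto simp: A_def p_Suc supported_in_coord_proj
        intro: rochberg_coord_proj rnorm_coord_proj_le rochberg_representable u)
  have n: "n > 0" using w(3)[of 0] d by (cases n) (auto simp: rnorm_order_0)
  obtain j d' and r :: "nat \<Rightarrow> nat" where r: "j \<le> n - 1" "d' > 0" "strict_mono r"
    "(\<lambda>i. rnorm j (w (r i))) \<longlonglongrightarrow> 0" "\<And>i. d' \<le> rnorm (Suc j) (w (r i))"
    by (rule critical_level[of w n "rnorm n u" "n - 1" d])
       (use w n d in \<open>auto intro: rochberg_representable that\<close>)
  have j: "j < n" using r(1) n by simp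
  obtain c h where ch: "0 < c" "0 < h"
    "\<And>A z. near_blocks n j A h z \<Longrightarrow> \<forall>i. z i \<in> rochberg n \<and> rnorm n (z i) \<le> rnorm n u \<and> d' \<le> rnorm (Suc j) (z i)
      \<Longrightarrow> lower_estimate (n - j) n c z"
    by (rule lower_estimate_near_blocks[OF j rnorm_nonneg[OF rochberg_representable[OF u]] r(2)]) (rule that)
  have disj_r: "disjoint_family (\<lambda>i. A (s i))" if "strict_mono s" for s :: "nat \<Rightarrow> nat"
    using disj strict_mono_eq[OF that] by (simp add: disjoint_family_on_def)
  obtain s :: "nat \<Rightarrow> nat" where s: "strict_mono s" "near_blocks n j (\<lambda>i. A (r (s i))) h (\<lambda>i. w (r (s i)))"
    by (rule near_blocks_of_blocks[OF disj_r[OF r(3)] _ w(4) w(1) r(4) less_imp_le[OF j] ch(2)])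
       (auto simp: A_def intro: that)
  have "lower_estimate (n - j) n c (\<lambda>i. w (r (s i)))"
    using ch(3)[OF s(2)] w r(5) by blast
  moreover have "\<not> lower_estimate (n - j) n c (\<lambda>i. w (r (s i)))"
    unfolding w_def using j ch(1) disj_r strict_mono_o[OF r(3) s(1)]
    by (intro no_lower_estimate_coord_proj rochberg_representable[OF u]) (auto simp: o_def)
  ultimately show False by contradiction
qed

lemma limitin_coord_tendsto:
  assumes s: "\<And>i. s i \<in> rochberg n" and lim: "limitin (rochberg.mtopology n) s x F"
  shows "((\<lambda>i. s i j k) \<longlongrightarrow> x j k) F"
proof (cases "j < n")
  case True
  have x: "x \<in> rochberg n" and null: "((\<lambda>i. rnorm n (s i - x)) \<longlongrightarrow> 0) F"
    using lim by (simp_all add: rochberg_limitin s)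
  have "norm (s i j k - x j k) \<le> 4 ^ j * rnorm n (s i - x)" for i
    using coord_le_rnorm[OF rochberg_representable[OF rochberg_diff[OF s x]] True, of i k] by simp
  then have "((\<lambda>i. s i j k - x j k) \<longlongrightarrow> 0) F"
    by (rule Lim_null_comparison[OF always_eventually[OF allI] tendsto_mult_right_zero[OF null]])
  then show ?thesis by (rule LIM_zero_cancel)
next
  case False
  then have "x j k = 0" "s i j k = 0" for i
    using lim s by (auto simp: rochberg_limitin rochberg_iff)
  then show ?thesis by simp
qed

theorem coord_proj_lessThan_tendsto:
  assumes u: "u \<in> rochberg n"
  shows "(\<lambda>N. rnorm n (u - coord_proj {..<N} u)) \<longlonglongrightarrow> 0"
proof -
  define x where "x N = coord_proj {..<N} u" for N
  have x: "x N \<in> rochberg n" for N unfolding x_def by (rule rochberg_coord_proj[OF u])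
  have dist: "rdist n (x p) (x q) = rnorm n (coord_proj {p..<q} u)" if "p \<le> q" for p q
  proof -
    have "x q - x p = coord_proj {p..<q} u" using that by (auto simp: fun_eq_iff x_def)
    then show ?thesis using rnorm_minus_commute[of n "x p" "x q"] by (simp add: rdist_rochberg x)
  qed
  have "rochberg.MCauchy n x"
    unfolding rochberg.MCauchy_def
  proof (intro conjI allI impI)
    show "range x \<subseteq> rochberg n" using x by blast
    fix e :: real assume "e > 0"
    then obtain N where N: "\<And>q. q \<ge> N \<Longrightarrow> rdist n (x N) (x q) < e / 2"
      using rochberg_tails_small[OF u half_gt_zero] dist by metis
    have "rdist n (x p) (x q) < e" if "N \<le> p" "N \<le> q" for p q
      using rochberg.triangle''[OF x[of p] x[of N] x[of q]] N[OF that(1)] N[OF that(2)] by linarith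
    then show "\<exists>N. \<forall>p q. N \<le> p \<longrightarrow> N \<le> q \<longrightarrow> rdist n (x p) (x q) < e" by blast
  qed
  then obtain L where L: "limitin (rochberg.mtopology n) x L sequentially"
    using rochberg_mcomplete unfolding rochberg.mcomplete_def by blast
  have "L j k = u j k" for j k
  proof (rule LIMSEQ_unique[OF limitin_coord_tendsto[OF x L]])
    have "\<forall>\<^sub>F N in sequentially. x N j k = u j k"
      using eventually_gt_at_top[of k] by eventually_elim (simp add: x_def)
    then show "(\<lambda>N. x N j k) \<longlonglongrightarrow> u j k" by (rule tendsto_eventually)
  qed
  then have "L = u" by (intro ext)
  then show ?thesis
    using L rnorm_minus_commute[of n u] by (simp add: rochberg_limitin x x_def[symmetric])
qed

section \<open>Coordinatewise null sequences\<close>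

definition coord_null :: "(nat \<Rightarrow> array) \<Rightarrow> bool" where
  "coord_null y \<longleftrightarrow> (\<forall>j k. (\<lambda>i. y i j k) \<longlonglongrightarrow> 0)"

lemma coord_null_subseq: "coord_null y \<Longrightarrow> strict_mono r \<Longrightarrow> coord_null (\<lambda>i. y (r i))"
  unfolding coord_null_def using LIMSEQ_subseq_LIMSEQ by (fastforce simp: o_def)

definition near_block :: "nat \<Rightarrow> nat \<Rightarrow> real \<Rightarrow> nat \<Rightarrow> nat \<Rightarrow> array \<Rightarrow> bool" where
  "near_block n l e N N' y \<longleftrightarrow>
     (\<exists>v. v \<in> rochberg n \<and> supported_in {N..<N'} v \<and> vanishes_below l v \<and> rnorm n (y - v) < e)"

lemma coord_null_head_tendsto:
  assumes null: "coord_null y" and A: "finite A"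
  shows "(\<lambda>i. rnorm n (coord_proj A (y i))) \<longlonglongrightarrow> 0"
proof -
  obtain C where C: "C > 0" "\<And>A x. finite A \<Longrightarrow> supported_in A x
      \<Longrightarrow> x \<in> representable n \<and> rnorm n x \<le> C * (\<Sum>k\<in>A. \<Sum>j<n. cmod (x j k))"
    by (rule rnorm_le_sum_coords[of n]) (rule that)
  have "(\<lambda>i. C * (\<Sum>k\<in>A. \<Sum>j<n. cmod (y i j k))) \<longlonglongrightarrow> C * (\<Sum>k\<in>A. \<Sum>j<n. 0)"
    using null unfolding coord_null_def by (intro tendsto_intros tendsto_norm_zero) auto
  then have "(\<lambda>i. C * (\<Sum>k\<in>A. \<Sum>j<n. cmod (y i j k))) \<longlonglongrightarrow> 0" by simp
  moreover have "norm (rnorm n (coord_proj A (y i))) \<le> C * (\<Sum>k\<in>A. \<Sum>j<n. cmod (y i j k))" for i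
    using C(2)[OF A supported_in_coord_proj[of A "y i"]] rnorm_nonneg[of "coord_proj A (y i)" n] by simp
  ultimately show ?thesis by (rule Lim_null_comparison[OF always_eventually[OF allI], rotated])
qed

lemma eventually_near_block:
  assumes y: "\<And>i. y i \<in> rochberg n" and null: "coord_null y"
    and level: "(\<lambda>i. rnorm l (y i)) \<longlonglongrightarrow> 0" and l: "l \<le> n" and e: "e > 0"
  shows "\<forall>\<^sub>F i in sequentially. \<forall>\<^sub>F N' in sequentially. near_block n l e N N' (y i)"
proof -
  have third: "e / 3 > 0" using e by simp
  have "\<forall>\<^sub>F i in sequentially. rnorm n (coord_proj {..<N} (y i)) < e / 3"
    by (rule order_tendstoD(2)[OF coord_null_head_tendsto[OF null finite_lessThan] third])
  moreover have "\<forall>\<^sub>F i in sequentially. rnorm l (y i) < e / 3"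
    by (rule order_tendstoD(2)[OF level third])
  ultimately show ?thesis
  proof eventually_elim
    case (elim i)
    note head = elim(1) and low = elim(2)
    have "\<forall>\<^sub>F N' in sequentially. rnorm n (y i - coord_proj {..<N'} (y i)) < e / 3"
      by (rule order_tendstoD(2)[OF coord_proj_lessThan_tendsto[OF y] third])
    then show ?case
      using eventually_ge_at_top[of N]
    proof eventually_elim
      case (elim N')
      define b where "b = coord_proj {N..<N'} (y i)"
      have b: "b \<in> rochberg n" "supported_in {N..<N'} b"
        unfolding b_def by (rule rochberg_coord_proj[OF y], rule supported_in_coord_proj)
      have "rnorm l b < e / 3"
        using rnorm_coord_proj_le[OF rochberg_representable_le[OF y l], of "{N..<N'}" i] low by (simp add: b_def)
      then obtain v where v: "v \<in> rochberg n" "supported_in {N..<N'} v" "vanishes_below l v" "rnorm n (b - v) < e / 3"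
        by (rule perturb_to_vanishing[OF b _ l]) (rule that)
      have "rnorm n (y i - v) = rnorm n ((coord_proj {..<N} (y i) + (y i - coord_proj {..<N'} (y i))) + (b - v))"
        using elim(2) by (intro arg_cong[where f = "rnorm n"]) (auto simp: fun_eq_iff b_def)
      also have "\<dots> \<le> (rnorm n (coord_proj {..<N} (y i)) + rnorm n (y i - coord_proj {..<N'} (y i))) + rnorm n (b - v)"
        by (intro order_trans[OF rnorm_triangle] add_mono rnorm_triangle order_refl rochberg_representable
            rochberg_add rochberg_diff rochberg_coord_proj y b v)
      also have "\<dots> < e" using head elim(1) v(4) by linarith
      finally show ?case unfolding near_block_def using v(1-3) by blast
    qed
  qed
qed

lemma gliding_hump:
  assumes Q: "\<And>m N. \<forall>\<^sub>F i in sequentially. \<forall>\<^sub>F N' in sequentially. Q m N N' i"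
  obtains r p :: "nat \<Rightarrow> nat" where "strict_mono r" "mono p" "\<And>m. Q m (p m) (p (Suc m)) (r m)"
proof -
  have step: "\<exists>i N'. i0 < i \<and> N \<le> N' \<and> Q m N N' i" for m N i0
  proof -
    have "\<forall>\<^sub>F i in sequentially. i0 < i \<and> (\<forall>\<^sub>F N' in sequentially. N \<le> N' \<and> Q m N N' i)"
      using eventually_gt_at_top[of i0] Q[of m N]
      by eventually_elim (auto intro: eventually_conj eventually_ge_at_top)
    then obtain i where "i0 < i" "\<forall>\<^sub>F N' in sequentially. N \<le> N' \<and> Q m N N' i"
      using eventually_happens'[OF sequentially_bot] by blast
    then show ?thesis using eventually_happens'[OF sequentially_bot] by blast
  qed
  have "\<exists>f. \<forall>m. (fst (f m) \<le> snd (snd (f m)) \<and> Q m (fst (f m)) (snd (snd (f m))) (fst (snd (f m)))) \<and>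
      (fst (f (Suc m)) = snd (snd (f m)) \<and> fst (snd (f m)) < fst (snd (f (Suc m))))"
  proof (rule dependent_nat_choice)
    show "\<exists>x. fst x \<le> snd (snd x) \<and> Q 0 (fst x) (snd (snd x)) (fst (snd x))"
      using step[of 0 0 0] by auto
    show "\<exists>y. (fst y \<le> snd (snd y) \<and> Q (Suc m) (fst y) (snd (snd y)) (fst (snd y))) \<and>
        (fst y = snd (snd x) \<and> fst (snd x) < fst (snd y))" for x m
      using step[of "fst (snd x)" "snd (snd x)" "Suc m"] by auto
  qed
  then obtain f where f: "\<And>m. fst (f m) \<le> snd (snd (f m))"
    "\<And>m. Q m (fst (f m)) (snd (snd (f m))) (fst (snd (f m)))"
    "\<And>m. fst (f (Suc m)) = snd (snd (f m))" "\<And>m. fst (snd (f m)) < fst (snd (f (Suc m)))" by blast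
  show ?thesis
    by (rule that[of "\<lambda>m. fst (snd (f m))" "\<lambda>m. fst (f m)"])
       (simp_all add: strict_mono_Suc_iff mono_iff_le_Suc f)
qed

lemma near_blocksI:
  assumes "mono p" "\<And>m. near_block n l (h * (1/2) ^ m) (p m) (p (Suc m)) (z m)"
  shows "near_blocks n l (\<lambda>m. {p m..<p (Suc m)}) h z"
proof -
  obtain v where "\<And>m. v m \<in> rochberg n" "\<And>m. supported_in {p m..<p (Suc m)} (v m)"
    "\<And>m. vanishes_below l (v m)" "\<And>m. rnorm n (z m - v m) < h * (1/2) ^ m"
    using assms(2) unfolding near_block_def by metis
  then show ?thesis
    unfolding near_blocks_def block_system_def using disjoint_family_intervals[OF assms(1)] by blast
qed

lemma near_blocks_common_subsequence:
  assumes x: "\<And>i. x i \<in> rochberg n" "coord_null x" "(\<lambda>i. rnorm k (x i)) \<longlonglongrightarrow> 0" "k \<le> n"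
    and y: "\<And>i. y i \<in> rochberg n" "coord_null y" "(\<lambda>i. rnorm l (y i)) \<longlonglongrightarrow> 0" "l \<le> n"
    and h: "h > 0"
  obtains A and r :: "nat \<Rightarrow> nat" where "strict_mono r"
    "near_blocks n k A h (\<lambda>i. x (r i))" "near_blocks n l A h (\<lambda>i. y (r i))"
proof -
  have "\<forall>\<^sub>F i in sequentially. \<forall>\<^sub>F N' in sequentially.
      near_block n k (h * (1/2) ^ m) N N' (x i) \<and> near_block n l (h * (1/2) ^ m) N N' (y i)" for m N
    using eventually_near_block[OF x, of "h * (1/2) ^ m" N] eventually_near_block[OF y, of "h * (1/2) ^ m" N] h
    by (simp add: eventually_conj_iff)
  then obtain r p where "strict_mono r" "mono p" "\<And>m. near_block n k (h * (1/2) ^ m) (p m) (p (Suc m)) (x (r m))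
      \<and> near_block n l (h * (1/2) ^ m) (p m) (p (Suc m)) (y (r m))"
    by (rule gliding_hump) (rule that)
  then show ?thesis by (intro that[of r "\<lambda>m. {p m..<p (Suc m)}"] near_blocksI) auto
qed

section \<open>Bounded functionals and operators\<close>

lemma lincomb_homomorphism:
  fixes f :: "array \<Rightarrow> 'b::ab_group_add" and act :: "complex \<Rightarrow> 'b \<Rightarrow> 'b"
  assumes add: "\<And>x y. x \<in> rochberg n \<Longrightarrow> y \<in> rochberg n \<Longrightarrow> f (x + y) = f x + f y"
    and scale: "\<And>c x. x \<in> rochberg n \<Longrightarrow> f (scal c x) = act c (f x)"
    and z: "\<And>i. z i \<in> rochberg n"
  shows "f (lincomb N a z) = (\<Sum>i<N. act (a i) (f (z i)))"
proof (induction N)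
  case 0
  have "f 0 = 0" using add[OF rochberg_zero rochberg_zero] by simp
  then show ?case by (simp only: lessThan_0 sum.empty)
next
  case (Suc N)
  have "f (lincomb N a z + scal (a N) (z N)) = f (lincomb N a z) + act (a N) (f (z N))"
    by (simp only: add scale rochberg_sum rochberg_scal z)
  then show ?case by (simp only: Suc sum.lessThan_Suc)
qed

definition bounded_functional :: "nat \<Rightarrow> (array \<Rightarrow> complex) \<Rightarrow> bool" where
  "bounded_functional n f \<longleftrightarrow>
     (\<forall>x\<in>rochberg n. \<forall>y\<in>rochberg n. f (x + y) = f x + f y) \<and>
     (\<forall>x\<in>rochberg n. \<forall>c. f (scal c x) = c * f x) \<and>
     (\<exists>K. \<forall>x\<in>rochberg n. cmod (f x) \<le> K * rnorm n x)"

lemma rnorm_bound_pos: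
  assumes "\<forall>x\<in>rochberg n. g x \<le> K * rnorm n x"
  obtains K' where "K' > 0" "\<And>x. x \<in> rochberg n \<Longrightarrow> g x \<le> K' * rnorm n x"
proof (rule that)
  show "\<bar>K\<bar> + 1 > 0" by simp
  fix x assume x: "x \<in> rochberg n"
  have "K * rnorm n x \<le> (\<bar>K\<bar> + 1) * rnorm n x"
    by (intro mult_right_mono rnorm_nonneg rochberg_representable x) simp
  then show "g x \<le> (\<bar>K\<bar> + 1) * rnorm n x" using assms x by (meson order_trans)
qed

lemma norming_coefficients:
  fixes v :: "nat \<Rightarrow> complex"
  obtains a where "\<And>i. cmod (a i) \<le> 1" "\<And>N. (\<Sum>i<N. a i * v i) = of_real (\<Sum>i<N. cmod (v i))"
proof (rule that)
  show "cmod (cnj (sgn (v i))) \<le> 1" for i by (simp add: norm_sgn)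
  have "cnj w * w = of_real (cmod w) * of_real (cmod w)" for w
    using complex_norm_square[of w] by (simp add: power2_eq_square mult.commute)
  then have "cnj (sgn (v i)) * v i = of_real (cmod (v i))" for i by (simp add: sgn_eq)
  then show "(\<Sum>i<N. cnj (sgn (v i)) * v i) = of_real (\<Sum>i<N. cmod (v i))" for N by simp
qed

lemma bounded_functional_sum_cmod_le:
  assumes f: "bounded_functional n f" and z: "\<And>i. z i \<in> rochberg n" and upper: "upper_estimate m n C z"
  obtains L where "L > 0"
    "\<And>N. \<exists>a. (\<forall>i. cmod (a i) \<le> 1) \<and> (\<Sum>i<N. cmod (f (z i))) \<le> L * rnorm m (single_row N a)"
proof -
  obtain K where K: "K > 0" "\<And>x. x \<in> rochberg n \<Longrightarrow> cmod (f x) \<le> K * rnorm n x"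
    using f unfolding bounded_functional_def by (elim conjE exE rnorm_bound_pos) (rule that)
  obtain a where a: "\<And>i. cmod (a i) \<le> 1" "\<And>N. (\<Sum>i<N. a i * f (z i)) = of_real (\<Sum>i<N. cmod (f (z i)))"
    by (rule norming_coefficients[of "\<lambda>i. f (z i)"]) (rule that)
  have "(\<Sum>i<N. cmod (f (z i))) \<le> K * (\<bar>C\<bar> + 1) * rnorm m (single_row N a)" for N
  proof -
    have "f (lincomb N a z) = (\<Sum>i<N. a i * f (z i))"
      by (rule lincomb_homomorphism[where n = n and act = "(*)", OF _ _ z])
         (use f in \<open>unfold bounded_functional_def, blast\<close>)+
    then have "(\<Sum>i<N. cmod (f (z i))) = cmod (f (lincomb N a z))"
      by (simp add: a(2) sum_nonneg del: of_real_sum)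
    also have "\<dots> \<le> K * rnorm n (lincomb N a z)"
      by (intro K(2) rochberg_sum rochberg_scal z)
    also have "\<dots> \<le> K * (C * rnorm m (single_row N a))"
      using upper K(1) by (intro mult_left_mono) (auto simp: upper_estimate_def)
    also have "\<dots> \<le> K * (\<bar>C\<bar> + 1) * rnorm m (single_row N a)"
      using K(1) rnorm_nonneg[OF single_row_representable[of N a m]]
      unfolding mult.assoc by (intro mult_left_mono mult_right_mono) auto
    finally show ?thesis .
  qed
  then show ?thesis using a(1) K(1) by (intro that[of "K * (\<bar>C\<bar> + 1)"]) auto
qed

lemma bounded_functional_lower_bound_nonpos:
  assumes f: "bounded_functional n f" and z: "\<And>i. z i \<in> rochberg n"
    and upper: "upper_estimate m n C z" and large: "\<And>i. d \<le> cmod (f (z i))"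
  shows "d \<le> 0"
proof (rule ccontr)
  assume "\<not> d \<le> 0"
  then have d: "d > 0" by simp
  obtain L where L: "L > 0"
    "\<And>N. \<exists>a. (\<forall>i. cmod (a i) \<le> 1) \<and> (\<Sum>i<N. cmod (f (z i))) \<le> L * rnorm m (single_row N a)"
    by (rule bounded_functional_sum_cmod_le[OF f z upper]) (rule that)
  define e where "e = d / (2 * L)"
  have e: "e > 0" using d L by (simp add: e_def)
  obtain B where B: "B \<ge> 0" "\<And>N a. \<forall>i<N. cmod (a i) \<le> 1 \<Longrightarrow> rnorm m (single_row N a) \<le> B + e * real N"
    by (rule rnorm_single_row_sublinear[OF e, of m]) (rule that)
  obtain N :: nat where "real N > L * B / (d / 2)" using reals_Archimedean2 by blast
  then have N: "real N * (d / 2) > L * B" using d by (simp add: pos_divide_less_eq)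
  obtain a where a: "\<forall>i. cmod (a i) \<le> 1" "(\<Sum>i<N. cmod (f (z i))) \<le> L * rnorm m (single_row N a)"
    using L(2)[of N] by blast
  have "real N * d \<le> (\<Sum>i<N. cmod (f (z i)))"
    using sum_bounded_below[of "{..<N}" d "\<lambda>i. cmod (f (z i))"] large by simp
  also have "\<dots> \<le> L * (B + e * real N)"
    using L(1) B(2)[of N a] a by (auto intro: order_trans mult_left_mono)
  also have "\<dots> = L * B + real N * (d / 2)" using L(1) by (simp add: e_def field_simps)
  finally show False using N by simp
qed

lemma not_tendsto_zero_subsequence:
  fixes g :: "nat \<Rightarrow> 'a::real_normed_vector"
  assumes "\<not> g \<longlonglongrightarrow> 0"
  obtains d and r :: "nat \<Rightarrow> nat" where "d > 0" "strict_mono r" "\<And>i. d \<le> norm (g (r i))"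
proof -
  obtain d where d: "d > 0" "\<not> (\<forall>\<^sub>F i in sequentially. norm (g i) < d)"
    using assms by (auto simp: tendsto_iff)
  then show ?thesis using not_eventually_sequentiallyD[OF d(2)] that by (auto simp: not_less)
qed

theorem bounded_functional_coord_null:
  assumes f: "bounded_functional n f" and n: "n > 0"
    and y: "\<And>i. y i \<in> rochberg n" "\<And>i. rnorm n (y i) \<le> M" "coord_null y"
  shows "(\<lambda>i. f (y i)) \<longlonglongrightarrow> 0"
proof (rule ccontr)
  assume "\<not> ?thesis"
  then obtain d and s :: "nat \<Rightarrow> nat" where s: "d > 0" "strict_mono s" "\<And>i. d \<le> cmod (f (y (s i)))"
    by (rule not_tendsto_zero_subsequence) (rule that)
  have level: "(\<lambda>i. rnorm 0 (y (s i))) \<longlonglongrightarrow> 0" by (simp add: rnorm_order_0)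
  note null = coord_null_subseq[OF y(3) s(2)]
  obtain A and r :: "nat \<Rightarrow> nat" where "near_blocks n 0 A 1 (\<lambda>i. y (s (r i)))"
    by (rule near_blocks_common_subsequence[OF y(1) null level le0 y(1) null level le0 zero_less_one]) (rule that)
  then have "upper_estimate (n - 0) n (M + 3 * 1) (\<lambda>i. y (s (r i)))"
    using n y by (intro upper_estimate_near_blocks)
  then have "d \<le> 0" using y(1) s(3) by (intro bounded_functional_lower_bound_nonpos[OF f])
  with s(1) show False by simp
qed

lemma bounded_operatorD:
  assumes "bounded_operator n T"
  shows "x \<in> rochberg n \<Longrightarrow> T x \<in> rochberg n"
    "x \<in> rochberg n \<Longrightarrow> y \<in> rochberg n \<Longrightarrow> T (x + y) = T x + T y"
    "x \<in> rochberg n \<Longrightarrow> T (scal c x) = scal c (T x)"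
  using assms by (simp_all add: bounded_operator_def vadd_eq_plus)

lemma bounded_operator_diff:
  assumes T: "bounded_operator n T" and "x \<in> rochberg n" "y \<in> rochberg n"
  shows "T (x - y) = T x - T y"
  using bounded_operatorD(2)[OF T, of "x - y" y] assms by (simp add: rochberg_diff)

lemma bounded_operator_lincomb:
  "bounded_operator n T \<Longrightarrow> (\<And>i. z i \<in> rochberg n) \<Longrightarrow> T (lincomb N a z) = lincomb N a (\<lambda>i. T (z i))"
  by (rule lincomb_homomorphism[where n = n]) (rule bounded_operatorD; assumption)+

lemma bounded_operator_bound:
  assumes "bounded_operator n T"
  obtains K where "K > 0" "\<And>x. x \<in> rochberg n \<Longrightarrow> rnorm n (T x) \<le> K * rnorm n x"
  using assms unfolding bounded_operator_def by (elim conjE exE rnorm_bound_pos) (rule that)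

lemma bounded_operator_bounded_sequence:
  assumes T: "bounded_operator n T" and "\<And>i. u i \<in> rochberg n" "\<And>i. rnorm n (u i) \<le> M"
  obtains M' where "\<And>i. rnorm n (T (u i)) \<le> M'"
proof -
  obtain K where K: "K > 0" "\<And>x. x \<in> rochberg n \<Longrightarrow> rnorm n (T x) \<le> K * rnorm n x"
    by (rule bounded_operator_bound[OF T]) (rule that)
  have "rnorm n (T (u i)) \<le> K * M" for i
    using K(2)[OF assms(2)] mult_left_mono[OF assms(3)] K(1) by (meson less_imp_le order_trans)
  then show ?thesis by (rule that)
qed

lemma bounded_functional_coord:
  assumes T: "bounded_operator n T" and j: "j < n"
  shows "bounded_functional n (\<lambda>x. T x j k)"
proof -
  obtain K where K: "K > 0" "\<And>x. x \<in> rochberg n \<Longrightarrow> rnorm n (T x) \<le> K * rnorm n x"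
    by (rule bounded_operator_bound[OF T]) (rule that)
  have "cmod (T x j k) \<le> 4 ^ j * K * rnorm n x" if x: "x \<in> rochberg n" for x
  proof -
    have "cmod (T x j k) \<le> 4 ^ j * rnorm n (T x)"
      by (rule coord_le_rnorm[OF rochberg_representable[OF bounded_operatorD(1)[OF T x]] j])
    also have "\<dots> \<le> 4 ^ j * (K * rnorm n x)" using K(2)[OF x] by (intro mult_left_mono) auto
    finally show ?thesis by simp
  qed
  then show ?thesis
    unfolding bounded_functional_def using bounded_operatorD(2,3)[OF T] by auto
qed

lemma bounded_operator_coord_null:
  assumes T: "bounded_operator n T" and y: "\<And>i. y i \<in> rochberg n" "\<And>i. rnorm n (y i) \<le> M" "coord_null y"
  shows "coord_null (\<lambda>i. T (y i))"
  unfolding coord_null_def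
proof (intro allI)
  fix j k
  show "(\<lambda>i. T (y i) j k) \<longlonglongrightarrow> 0"
  proof (cases "j < n")
    case True
    then show ?thesis by (intro bounded_functional_coord_null[OF bounded_functional_coord[OF T] _ y]) auto
  next
    case False
    then have "T (y i) j k = 0" for i using bounded_operatorD(1)[OF T y(1)] by (simp add: rochberg_iff)
    then show ?thesis by simp
  qed
qed

section \<open>Operators bounded below on a sequence\<close>

lemma rochberg_limitin_add:
  assumes s: "\<And>i. s i \<in> rochberg n" "limitin (rochberg.mtopology n) s x F"
    and t: "\<And>i. t i \<in> rochberg n" "limitin (rochberg.mtopology n) t y F"
  shows "limitin (rochberg.mtopology n) (\<lambda>i. s i + t i) (x + y) F"
proof -
  have x: "x \<in> rochberg n" "((\<lambda>i. rnorm n (s i - x)) \<longlongrightarrow> 0) F"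
    and y: "y \<in> rochberg n" "((\<lambda>i. rnorm n (t i - y)) \<longlongrightarrow> 0) F"
    using s t by (simp_all add: rochberg_limitin)
  have "norm (rnorm n (s i + t i - (x + y))) \<le> rnorm n (s i - x) + rnorm n (t i - y)" for i
  proof -
    have "s i - x \<in> representable n" "t i - y \<in> representable n"
      by (intro rochberg_representable rochberg_diff s t x y)+
    moreover have "s i + t i - (x + y) = (s i - x) + (t i - y)" by simp
    moreover have "0 \<le> rnorm n (s i + t i - (x + y))"
      by (intro rnorm_nonneg rochberg_representable rochberg_diff rochberg_add s t x y)
    ultimately show ?thesis using rnorm_triangle[of "s i - x" n "t i - y"] by (simp only: real_norm_def abs_of_nonneg)
  qed
  then have "((\<lambda>i. rnorm n (s i + t i - (x + y))) \<longlongrightarrow> 0) F"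
    by (rule Lim_null_comparison[OF always_eventually[OF allI] tendsto_add_zero[OF x(2) y(2)]])
  then show ?thesis by (simp add: rochberg_limitin rochberg_add s t x y)
qed

lemma bounded_operator_limitin:
  assumes T: "bounded_operator n T" and s: "\<And>i. s i \<in> rochberg n" "limitin (rochberg.mtopology n) s x F"
  shows "limitin (rochberg.mtopology n) (\<lambda>i. T (s i)) (T x) F"
proof -
  obtain K where K: "K > 0" "\<And>x. x \<in> rochberg n \<Longrightarrow> rnorm n (T x) \<le> K * rnorm n x"
    by (rule bounded_operator_bound[OF T]) (rule that)
  have x: "x \<in> rochberg n" "((\<lambda>i. rnorm n (s i - x)) \<longlongrightarrow> 0) F"
    using s by (simp_all add: rochberg_limitin)
  note maps = bounded_operatorD(1)[OF T]
  have "norm (rnorm n (T (s i) - T x)) \<le> K * rnorm n (s i - x)" for i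
    using K(2)[OF rochberg_diff[OF s(1) x(1)]]
      rnorm_nonneg[OF rochberg_representable[OF rochberg_diff[OF maps[OF s(1)] maps[OF x(1)]]]]
    by (simp add: bounded_operator_diff[OF T s(1) x(1)])
  then have "((\<lambda>i. rnorm n (T (s i) - T x)) \<longlongrightarrow> 0) F"
    by (rule Lim_null_comparison[OF always_eventually[OF allI] tendsto_mult_right_zero[OF x(2)]])
  then show ?thesis by (simp add: rochberg_limitin maps s x)
qed

lemma bounded_operator_scal: "bounded_operator n (scal c)"
  unfolding bounded_operator_def vadd_eq_plus
  by (auto simp: array.scale_right_distrib mult.commute
      intro!: rochberg_scal exI[of _ "cmod c"] rnorm_scal_le rochberg_representable)

lemma rnorm_tendsto:
  assumes s: "\<And>i. s i \<in> rochberg n" "limitin (rochberg.mtopology n) s x F"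
  shows "((\<lambda>i. rnorm n (s i)) \<longlongrightarrow> rnorm n x) F"
proof -
  have x: "x \<in> rochberg n" "((\<lambda>i. rnorm n (s i - x)) \<longlongrightarrow> 0) F"
    using s by (simp_all add: rochberg_limitin)
  have "norm (rnorm n (s i) - rnorm n x) \<le> rnorm n (s i - x)" for i
    using rnorm_triangle_sub[OF rochberg_representable[OF s(1)] rochberg_representable[OF x(1)], of i]
      rnorm_triangle_sub[OF rochberg_representable[OF x(1)] rochberg_representable[OF s(1)], of i]
      rnorm_minus_commute[of n x "s i"] by simp
  then have "((\<lambda>i. rnorm n (s i) - rnorm n x) \<longlongrightarrow> 0) F"
    by (rule Lim_null_comparison[OF always_eventually[OF allI] x(2)])
  then show ?thesis by (rule LIM_zero_cancel)
qed

lemma closure_of_subspace_sequentially: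
  assumes "L \<subseteq> rochberg n" "x \<in> rochberg.mtopology n closure_of L"
  obtains s where "\<And>i. s i \<in> L" "limitin (rochberg.mtopology n) s x sequentially"
  using assms unfolding rochberg.closure_of_sequentially by blast

lemma closed_subspace_closure_of:
  assumes L: "L \<subseteq> rochberg n" "array.subspace L"
  shows "closed_subspace n (rochberg.mtopology n closure_of L)" (is "closed_subspace n ?Y")
  unfolding closed_subspace_def vadd_eq_plus vsub_eq_minus
proof (intro conjI ballI allI impI)
  show Y: "?Y \<subseteq> rochberg n" by (auto simp: rochberg.closure_of_sequentially)
  have L_Y: "L \<subseteq> ?Y" using L(1) by (intro closure_of_subset) simp
  show "(\<lambda>j k. 0) \<in> ?Y" using L_Y array.subspace_0[OF L(2)] by (auto simp: zero_fun_def)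
  have in_Y: "x \<in> ?Y" if "\<And>i. s i \<in> L" "limitin (rochberg.mtopology n) s x sequentially" for s x
    using that L(1) rochberg.limitin_mspace unfolding rochberg.closure_of_sequentially by blast
  show "x + y \<in> ?Y" if "x \<in> ?Y" "y \<in> ?Y" for x y
  proof -
    obtain s where s: "\<And>i. s i \<in> L" "limitin (rochberg.mtopology n) s x sequentially"
      by (rule closure_of_subspace_sequentially[OF L(1) \<open>x \<in> ?Y\<close>]) (rule that)
    obtain t where t: "\<And>i. t i \<in> L" "limitin (rochberg.mtopology n) t y sequentially"
      by (rule closure_of_subspace_sequentially[OF L(1) \<open>y \<in> ?Y\<close>]) (rule that)
    have "s i + t i \<in> L" for i by (rule array.subspace_add[OF L(2) s(1) t(1)])
    then show ?thesis
      by (rule in_Y) (rule rochberg_limitin_add[OF _ s(2) _ t(2)]; use s(1) t(1) L(1) in blast)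
  qed
  show "scal c x \<in> ?Y" if x: "x \<in> ?Y" for c x
  proof -
    obtain s where s: "\<And>i. s i \<in> L" "limitin (rochberg.mtopology n) s x sequentially"
      by (rule closure_of_subspace_sequentially[OF L(1) x]) (rule that)
    have "scal c (s i) \<in> L" for i by (rule array.subspace_scale[OF L(2) s(1)])
    then show ?thesis
      by (rule in_Y) (rule bounded_operator_limitin[OF bounded_operator_scal _ s(2)], use s(1) L(1) in blast)
  qed
  fix s x assume s: "(\<forall>i. s i \<in> ?Y) \<and> x \<in> rochberg n \<and> (\<lambda>i. rnorm n (s i - x)) \<longlonglongrightarrow> 0"
  then have "limitin (rochberg.mtopology n) s x sequentially"
    using Y by (subst rochberg_limitin) auto
  then show "x \<in> ?Y"
    using closedin_closure_of[of "rochberg.mtopology n" L] s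
    unfolding rochberg.metric_closedin_iff_sequentially_closed by blast
qed

lemma iso_on_closure_of:
  assumes T: "bounded_operator n T" and L: "L \<subseteq> rochberg n"
    and c: "c > 0" and below: "\<And>x. x \<in> L \<Longrightarrow> c * rnorm n x \<le> rnorm n (T x)"
  shows "iso_on n T (rochberg.mtopology n closure_of L)"
  unfolding iso_on_def
proof (intro exI[of _ c] conjI ballI c)
  fix x assume "x \<in> rochberg.mtopology n closure_of L"
  then obtain s where s: "\<And>i. s i \<in> L" "limitin (rochberg.mtopology n) s x sequentially"
    by (rule closure_of_subspace_sequentially[OF L]) (rule that)
  have s_mem: "s i \<in> rochberg n" for i using s(1) L by blast
  show "c * rnorm n x \<le> rnorm n (T x)"
  proof (rule LIMSEQ_le)
    show "(\<lambda>i. c * rnorm n (s i)) \<longlonglongrightarrow> c * rnorm n x"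
      by (intro tendsto_mult_left rnorm_tendsto s_mem s)
    show "(\<lambda>i. rnorm n (T (s i))) \<longlonglongrightarrow> rnorm n (T x)"
      by (intro rnorm_tendsto bounded_operatorD(1)[OF T s_mem] bounded_operator_limitin[OF T s_mem] s)
  qed (use below s(1) in blast)
qed

lemma sum_over_range_lincomb:
  assumes t: "finite t" "t \<subseteq> range z"
  obtains N a where "(\<Sum>v\<in>t. scal (u v) v) = lincomb N a z" "\<And>v. v \<in> t \<Longrightarrow> \<exists>i<N. a i = u v"
proof -
  obtain I where I: "inj_on z I" "t = z ` I" using t(2) unfolding subset_image_inj by blast
  then have "finite I" using t(1) finite_image_iff by blast
  then obtain N where N: "I \<subseteq> {..<N}" using finite_nat_iff_bounded by blast
  define a where "a i = (if i \<in> I then u (z i) else 0)" for i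
  have "(\<Sum>v\<in>t. scal (u v) v) = (\<Sum>i\<in>I. scal (a i) (z i))"
    unfolding I(2) sum.reindex[OF I(1)] by (intro sum.cong) (simp_all add: a_def)
  also have "\<dots> = lincomb N a z"
    using N by (intro sum.mono_neutral_left) (auto simp: a_def)
  finally show ?thesis using N I(2) by (intro that) (auto simp: a_def)
qed

lemma span_range_lincomb:
  assumes "x \<in> array.span (range z)"
  obtains N a where "x = lincomb N a z"
proof -
  obtain t u where t: "finite t" "t \<subseteq> range z" and x: "x = (\<Sum>v\<in>t. scal (u v) v)"
    using assms unfolding array.span_explicit by (elim CollectE exE conjE) (rule that)
  show ?thesis by (rule sum_over_range_lincomb[OF t, of u]) (rule that, simp only: x)
qed

lemma lower_estimate_coeff:
  assumes lower: "lower_estimate m n c z" and m: "m > 0" and c: "c > 0" and i: "i < N"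
    and zero: "lincomb N a z = 0"
  shows "a i = 0"
proof -
  have "c * cmod (a i) \<le> c * rnorm m (single_row N a)"
    using c m i by (intro mult_left_mono coeff_le_rnorm_single_row) auto
  also have "\<dots> \<le> rnorm n (lincomb N a z)" using lower by (simp add: lower_estimate_def)
  finally show ?thesis using c by (simp add: zero mult_le_0_iff)
qed

lemma independent_of_lower_estimate:
  assumes lower: "lower_estimate m n c z" and m: "m > 0" and c: "c > 0"
  shows "inj z" "array.independent (range z)"
proof -
  note coeff = lower_estimate_coeff[OF lower m c]
  show "inj z"
  proof (rule injI, rule ccontr)
    fix i i' assume eq: "z i = z i'" and ne: "i \<noteq> i'"
    define N where "N = Suc (max i i')"
    have N: "i < N" "i' < N" by (simp_all add: N_def)
    define a :: "nat \<Rightarrow> complex" where "a l = of_bool (l = i) - of_bool (l = i')" for l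
    have "lincomb N a z = (\<Sum>l<N. if l = i then z l else 0) - (\<Sum>l<N. if l = i' then z l else 0)"
      unfolding sum_subtractf[symmetric] by (intro sum.cong) (auto simp: a_def)
    also have "\<dots> = 0"
      using N eq by (simp only: sum.delta finite_lessThan lessThan_iff if_True diff_self)
    finally have "a i = 0" by (rule coeff[OF N(1)])
    then show False using ne by (simp add: a_def)
  qed
  show "array.independent (range z)"
    unfolding array.dependent_explicit
  proof (intro notI, elim exE conjE bexE)
    fix t u v assume t: "finite t" "t \<subseteq> range z" "(\<Sum>v\<in>t. scal (u v) v) = 0" and v: "v \<in> t" "u v \<noteq> 0"
    obtain N a where a: "(\<Sum>v\<in>t. scal (u v) v) = lincomb N a z" "\<And>v. v \<in> t \<Longrightarrow> \<exists>i<N. a i = u v"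
      by (rule sum_over_range_lincomb[OF t(1,2), of u]) (rule that)
    show False using a(2)[OF v(1)] coeff[of _ N a] a(1) t(3) v(2) by auto
  qed
qed

lemma infinite_dimensional_of_lower_estimate:
  assumes lower: "lower_estimate m n c z" and m: "m > 0" and c: "c > 0" and Y: "range z \<subseteq> Y"
  shows "infinite_dimensional Y"
proof -
  note indep = independent_of_lower_estimate[OF lower m c]
  have not_in_span: "\<not> range z \<subseteq> array.span B" if "finite B" for B
    using array.independent_span_bound[OF that indep(2)] range_inj_infinite[OF indep(1)] by blast
  have span: "{(\<lambda>j k. \<Sum>b\<in>B. c b * b j k) | c. True} = array.span B" if "finite B" for B
  proof -
    have "(\<Sum>b\<in>B. scal (c b) b) = (\<lambda>j k. \<Sum>b\<in>B. c b * b j k)" for c :: "array \<Rightarrow> complex"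
      by (simp add: fun_eq_iff sum_array_apply)
    then show ?thesis unfolding array.span_finite[OF that] by auto
  qed
  show ?thesis
    unfolding infinite_dimensional_def
  proof (intro allI impI)
    fix B :: "array set" assume B: "finite B"
    show "\<not> Y \<subseteq> {(\<lambda>j k. \<Sum>b\<in>B. c b * b j k) | c. True}"
      unfolding span[OF B] using not_in_span[OF B] Y by blast
  qed
qed

lemma not_strictly_singular_of_estimates:
  assumes T: "bounded_operator n T" and z: "\<And>i. z i \<in> rochberg n"
    and upper: "upper_estimate l n C z" and lower: "lower_estimate m n c (\<lambda>i. T (z i))"
    and m: "0 < m" "l \<le> m" and c: "c > 0" and C: "C > 0"
  shows "\<not> strictly_singular n T"
proof -
  define L where "L = array.span (range z)"
  define Y where "Y = rochberg.mtopology n closure_of L"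
  have L: "L \<subseteq> rochberg n" "array.subspace L"
    using array.span_minimal[OF _ subspace_rochberg, of "range z" n] z by (auto simp: L_def)
  have T_lincomb: "c * rnorm m (single_row N a) \<le> rnorm n (T (lincomb N a z))" for N a
    using lower by (simp add: lower_estimate_def bounded_operator_lincomb[OF T z])
  have "c / C * rnorm n x \<le> rnorm n (T x)" if x: "x \<in> L" for x
  proof -
    obtain N a where a: "x = lincomb N a z" by (rule span_range_lincomb[OF x[unfolded L_def]])
    have "rnorm n x \<le> C * rnorm l (single_row N a)" using upper by (simp add: upper_estimate_def a)
    also have "\<dots> \<le> C * rnorm m (single_row N a)"
      using C m by (intro mult_left_mono rnorm_mono single_row_representable) auto
    finally have "c / C * rnorm n x \<le> c / C * (C * rnorm m (single_row N a))"
      using c C by (intro mult_left_mono) auto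
    also have "\<dots> \<le> rnorm n (T x)" using T_lincomb[of N a] C by (simp add: a)
    finally show ?thesis .
  qed
  then have "iso_on n T Y"
    unfolding Y_def using c C by (intro iso_on_closure_of[OF T L(1), of "c / C"]) auto
  moreover have "infinite_dimensional Y"
  proof -
    obtain K where K: "K > 0" "\<And>x. x \<in> rochberg n \<Longrightarrow> rnorm n (T x) \<le> K * rnorm n x"
      by (rule bounded_operator_bound[OF T]) (rule that)
    have "c * rnorm m (single_row N a) \<le> K * rnorm n (lincomb N a z)" for N a
      by (rule order_trans[OF T_lincomb K(2)]) (intro rochberg_sum rochberg_scal z)
    then have "lower_estimate m n (c / K) z"
      using K(1) by (simp add: lower_estimate_def pos_divide_le_eq mult.commute)
    moreover have "range z \<subseteq> Y"
      using array.span_superset[of "range z"] closure_of_subset[of L "rochberg.mtopology n"] L(1)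
      unfolding Y_def L_def by (simp add: order_trans)
    ultimately show ?thesis
      using m(1) c K(1) by (intro infinite_dimensional_of_lower_estimate[of m n "c / K" z]) auto
  qed
  moreover have "closed_subspace n Y" unfolding Y_def by (rule closed_subspace_closure_of[OF L])
  ultimately show ?thesis by (auto simp: strictly_singular_def)
qed

section \<open>Strictly singular operators\<close>

text \<open>If the level did not rise, a subsequence of \<open>u\<close> would satisfy the upper block estimate at level
  \<open>k\<close> and its image the lower block estimate at some level \<open>j \<le> k\<close>, so \<open>T\<close> would be bounded below
  on the span of that subsequence.\<close>

theorem strictly_singular_raises_level:
  assumes T: "strictly_singular n T"
    and u: "\<And>i. u i \<in> rochberg n" "\<And>i. rnorm n (u i) \<le> M" "coord_null u"
    and level: "(\<lambda>i. rnorm k (u i)) \<longlonglongrightarrow> 0" and k: "k < n"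
  shows "(\<lambda>i. rnorm (Suc k) (T (u i))) \<longlonglongrightarrow> 0"
proof (rule ccontr)
  have bo: "bounded_operator n T" using T by (simp add: strictly_singular_def)
  have Tu: "T (u i) \<in> rochberg n" for i by (rule bounded_operatorD(1)[OF bo u(1)])
  obtain M' where M': "\<And>i. rnorm n (T (u i)) \<le> M'"
    by (rule bounded_operator_bounded_sequence[OF bo u(1,2)]) (rule that)
  have bounds: "0 \<le> M" "0 \<le> M'"
    using rnorm_nonneg[OF rochberg_representable] u(1,2) Tu M' by (meson order_trans)+
  assume "\<not> ?thesis"
  then obtain d and s :: "nat \<Rightarrow> nat" where s: "d > 0" "strict_mono s"
    "\<And>i. d \<le> norm (rnorm (Suc k) (T (u (s i))))"
    by (rule not_tendsto_zero_subsequence) (rule that)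
  have large: "d \<le> rnorm (Suc k) (T (u (s i)))" for i
    using s(3)[of i] rnorm_nonneg[OF rochberg_representable_le[OF Tu, of "Suc k" "s i"]] k by simp
  obtain j d' and t :: "nat \<Rightarrow> nat" where t: "j \<le> k" "d' > 0" "strict_mono t"
    "(\<lambda>i. rnorm j (T (u (s (t i))))) \<longlonglongrightarrow> 0" "\<And>i. d' \<le> rnorm (Suc j) (T (u (s (t i))))"
    by (rule critical_level[OF rochberg_representable[OF Tu] M' k s(1) large]) (rule that)
  have j: "j < n" using t(1) k by simp
  define v where "v i = u (s (t i))" for i
  have mono: "strict_mono (\<lambda>i. s (t i))" using s(2) t(3) by (simp add: strict_mono_def)
  have v: "v i \<in> rochberg n" "rnorm n (v i) \<le> M" "T (v i) \<in> rochberg n" "rnorm n (T (v i)) \<le> M'"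
    "d' \<le> rnorm (Suc j) (T (v i))" for i
    unfolding v_def by (rule u Tu M' t)+
  have v_null: "coord_null v" unfolding v_def by (rule coord_null_subseq[OF u(3) mono])
  have v_level: "(\<lambda>i. rnorm k (v i)) \<longlonglongrightarrow> 0"
    using LIMSEQ_subseq_LIMSEQ[OF level mono] by (simp add: v_def o_def)
  obtain c h where ch: "0 < c" "0 < h"
    "\<And>A z. near_blocks n j A h z \<Longrightarrow> \<forall>i. z i \<in> rochberg n \<and> rnorm n (z i) \<le> M' \<and> d' \<le> rnorm (Suc j) (z i)
      \<Longrightarrow> lower_estimate (n - j) n c z"
    by (rule lower_estimate_near_blocks[OF j bounds(2) t(2)]) (rule that)
  obtain A and r :: "nat \<Rightarrow> nat" where r: "near_blocks n k A h (\<lambda>i. v (r i))" "near_blocks n j A h (\<lambda>i. T (v (r i)))"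
    by (rule near_blocks_common_subsequence[OF v(1) v_null v_level less_imp_le[OF k] v(3)
          bounded_operator_coord_null[OF bo v(1,2) v_null] t(4)[folded v_def] less_imp_le[OF j] ch(2)]) (rule that)
  have upper: "upper_estimate (n - k) n (M + 3 * h) (\<lambda>i. v (r i))"
    by (rule upper_estimate_near_blocks[OF r(1) k v(1,2)])
  have lower: "lower_estimate (n - j) n c (\<lambda>i. T (v (r i)))"
    using ch(3)[OF r(2)] v(3-5) by blast
  have "\<not> strictly_singular n T"
    by (rule not_strictly_singular_of_estimates[OF bo v(1) upper lower])
       (use j t(1) ch(1,2) bounds(1) in auto)
  with T show False by contradiction
qed

lemma compose_ops_Nil: "compose_ops [] x = x"
  and compose_ops_Cons: "compose_ops (T # Ts) x = T (compose_ops Ts x)"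
  by (simp_all add: compose_ops_def)

lemma bounded_operator_compose:
  assumes S: "bounded_operator n S" and T: "bounded_operator n T"
  shows "bounded_operator n (\<lambda>x. S (T x))"
proof -
  obtain K where K: "K > 0" "\<And>x. x \<in> rochberg n \<Longrightarrow> rnorm n (S x) \<le> K * rnorm n x"
    by (rule bounded_operator_bound[OF S]) (rule that)
  obtain L where L: "L > 0" "\<And>x. x \<in> rochberg n \<Longrightarrow> rnorm n (T x) \<le> L * rnorm n x"
    by (rule bounded_operator_bound[OF T]) (rule that)
  have "rnorm n (S (T x)) \<le> (K * L) * rnorm n x" if x: "x \<in> rochberg n" for x
  proof -
    have "rnorm n (S (T x)) \<le> K * rnorm n (T x)" by (rule K(2)[OF bounded_operatorD(1)[OF T x]])
    also have "\<dots> \<le> K * (L * rnorm n x)" using K(1) L(2)[OF x] by (intro mult_left_mono) auto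
    finally show ?thesis by simp
  qed
  then have "\<exists>K. \<forall>x\<in>rochberg n. rnorm n (S (T x)) \<le> K * rnorm n x" by blast
  then show ?thesis
    unfolding bounded_operator_def vadd_eq_plus by (simp add: bounded_operatorD[OF S] bounded_operatorD[OF T])
qed

lemma bounded_operator_compose_ops:
  assumes "\<And>T. T \<in> set Ts \<Longrightarrow> bounded_operator n T"
  shows "bounded_operator n (compose_ops Ts)"
  using assms
proof (induction Ts)
  case Nil
  have "\<exists>K. \<forall>x\<in>rochberg n. rnorm n x \<le> K * rnorm n x" by (intro exI[of _ 1]) simp
  then show ?case unfolding bounded_operator_def compose_ops_Nil by simp
next
  case (Cons T Ts)
  have T: "bounded_operator n T" and Ts: "bounded_operator n (compose_ops Ts)" using Cons by auto
  have "bounded_operator n (\<lambda>x. T (compose_ops Ts x))" by (rule bounded_operator_compose[OF T Ts])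
  then show ?case by (simp add: compose_ops_def o_def)
qed

lemma compose_strictly_singular_level:
  assumes "\<And>T. T \<in> set Ts \<Longrightarrow> strictly_singular n T" "length Ts \<le> n"
    and u: "\<And>i. u i \<in> rochberg n" "\<And>i. rnorm n (u i) \<le> M" "coord_null u"
  shows "(\<lambda>i. rnorm (length Ts) (compose_ops Ts (u i))) \<longlonglongrightarrow> 0"
  using assms(1,2)
proof (induction Ts)
  case Nil
  then show ?case by (simp add: rnorm_order_0)
next
  case (Cons T Ts)
  have bo: "bounded_operator n (compose_ops Ts)"
    using Cons.prems(1) by (intro bounded_operator_compose_ops) (auto simp: strictly_singular_def)
  obtain M' where M': "\<And>i. rnorm n (compose_ops Ts (u i)) \<le> M'"
    by (rule bounded_operator_bounded_sequence[OF bo u(1,2)]) (rule that)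
  have "(\<lambda>i. rnorm (Suc (length Ts)) (T (compose_ops Ts (u i)))) \<longlonglongrightarrow> 0"
    by (rule strictly_singular_raises_level[OF _ bounded_operatorD(1)[OF bo u(1)] M'
          bounded_operator_coord_null[OF bo u]])
       (use Cons in auto)
  then show ?case by (simp add: compose_ops_Cons)
qed

lemma coordinatewise_convergent_subsequence:
  assumes s: "\<And>i. s i \<in> rochberg n" "\<And>i. rnorm n (s i) \<le> M"
  obtains r :: "nat \<Rightarrow> nat" and l where "strict_mono r" "\<And>j k. (\<lambda>i. s (r i) j k) \<longlonglongrightarrow> l j k"
proof -
  have M: "0 \<le> M" using order_trans[OF rnorm_nonneg[OF rochberg_representable[OF s(1)]] s(2)] .
  have bound: "norm (s i (fst x) (snd x)) \<le> 4 ^ n * M" for i x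
  proof (cases "fst x < n")
    case True
    have "norm (s i (fst x) (snd x)) \<le> 4 ^ fst x * rnorm n (s i)"
      by (rule coord_le_rnorm[OF rochberg_representable[OF s(1)] True])
    also have "\<dots> \<le> 4 ^ n * M"
      using True M s(2) rnorm_nonneg[OF rochberg_representable[OF s(1)]] by (intro mult_mono power_increasing) auto
    finally show ?thesis .
  next
    case False
    then show ?thesis using s(1)[of i] M by (simp add: rochberg_iff)
  qed
  obtain r :: "nat \<Rightarrow> nat" where r: "strict_mono r" "\<And>x. \<exists>l. (\<lambda>i. s (r i) (fst x) (snd x)) \<longlonglongrightarrow> l"
    by (rule function_convergent_subsequence[of "UNIV :: (nat \<times> nat) set" "\<lambda>i x. s i (fst x) (snd x)", OF _ bound])
       (auto intro: that)
  have "\<exists>l. (\<lambda>i. s (r i) j k) \<longlonglongrightarrow> l" for j k using r(2)[of "(j, k)"] by simp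
  then obtain l where "\<And>j k. (\<lambda>i. s (r i) j k) \<longlonglongrightarrow> l j k" by metis
  with r(1) show ?thesis by (rule that)
qed

lemma MCauchy_image_of_coordinatewise_convergent:
  assumes P: "bounded_operator n P"
    and null: "\<And>u M. (\<And>i. u i \<in> rochberg n) \<Longrightarrow> (\<And>i. rnorm n (u i) \<le> M) \<Longrightarrow> coord_null u
      \<Longrightarrow> (\<lambda>i. rnorm n (P (u i))) \<longlonglongrightarrow> 0"
    and s: "\<And>i. s i \<in> rochberg n" "\<And>i. rnorm n (s i) \<le> M" "\<And>j k. (\<lambda>i. s i j k) \<longlonglongrightarrow> l j k"
  shows "rochberg.MCauchy n (\<lambda>i. P (s i))"
proof (rule ccontr)
  note Ps = bounded_operatorD(1)[OF P s(1)]
  assume "\<not> ?thesis"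
  then obtain e where e: "e > 0" "\<forall>N. \<exists>p q. N \<le> p \<and> N \<le> q \<and> e \<le> rdist n (P (s p)) (P (s q))"
    using Ps unfolding rochberg.MCauchy_def by (auto simp: not_less)
  then obtain p q where pq: "\<And>N. N \<le> p N" "\<And>N. N \<le> q N" "\<And>N. e \<le> rdist n (P (s (p N))) (P (s (q N)))"
    by metis
  define u where "u N = s (p N) - s (q N)" for N
  have u: "u N \<in> rochberg n" for N unfolding u_def by (intro rochberg_diff s)
  have u_bound: "rnorm n (u N) \<le> M + M" for N
    unfolding u_def
    by (rule order_trans[OF rnorm_triangle_diff add_mono[OF s(2) s(2)]]) (intro rochberg_representable s)+
  have "filterlim p at_top sequentially" "filterlim q at_top sequentially"
    using pq(1,2) by (auto intro: filterlim_at_top_mono[OF filterlim_ident])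
  then have "(\<lambda>N. u N j k) \<longlonglongrightarrow> l j k - l j k" for j k
    unfolding u_def fun_diff_def by (intro tendsto_diff filterlim_compose[OF s(3)])
  then have "(\<lambda>N. rnorm n (P (u N))) \<longlonglongrightarrow> 0"
    by (intro null[OF u u_bound]) (simp add: coord_null_def)
  moreover have "e \<le> rnorm n (P (u N))" for N
    using pq(3)[of N] by (simp add: u_def bounded_operator_diff[OF P s(1) s(1)] rdist_rochberg[OF Ps Ps])
  ultimately show False using e(1) LIMSEQ_le_const[of "\<lambda>N. rnorm n (P (u N))" 0 e] by fastforce
qed

lemma compact_operatorI_coord_null:
  assumes P: "bounded_operator n P"
    and null: "\<And>u M. (\<And>i. u i \<in> rochberg n) \<Longrightarrow> (\<And>i. rnorm n (u i) \<le> M) \<Longrightarrow> coord_null u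
      \<Longrightarrow> (\<lambda>i. rnorm n (P (u i))) \<longlonglongrightarrow> 0"
  shows "compact_operator n P"
  unfolding compact_operator_def vsub_eq_minus
proof (intro conjI P allI impI, elim conjE exE)
  fix s :: "nat \<Rightarrow> array" and M assume s: "\<forall>i. s i \<in> rochberg n" "\<forall>i. rnorm n (s i) \<le> M"
  obtain r :: "nat \<Rightarrow> nat" and l where r: "strict_mono r" "\<And>j k. (\<lambda>i. s (r i) j k) \<longlonglongrightarrow> l j k"
    by (rule coordinatewise_convergent_subsequence[OF s[rule_format]]) (rule that)
  have "rochberg.MCauchy n (\<lambda>i. P (s (r i)))"
  proof (rule MCauchy_image_of_coordinatewise_convergent[OF P _ _ _ r(2)])
    show "s (r i) \<in> rochberg n" "rnorm n (s (r i)) \<le> M" for i using s by auto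
  qed (rule null)
  then obtain L where "limitin (rochberg.mtopology n) (\<lambda>i. P (s (r i))) L sequentially"
    using rochberg_mcomplete unfolding rochberg.mcomplete_def by blast
  then have "L \<in> rochberg n" "(\<lambda>i. rnorm n (P (s (r i)) - L)) \<longlonglongrightarrow> 0"
    using bounded_operatorD(1)[OF P] s(1) by (simp_all add: rochberg_limitin)
  with r(1) show "\<exists>r L. strict_mono (r :: nat \<Rightarrow> nat) \<and> L \<in> rochberg n \<and> (\<lambda>i. rnorm n (P (s (r i)) - L)) \<longlonglongrightarrow> 0"
    by blast
qed

theorem theorem5p9:
  fixes n :: nat and S :: "nat \<Rightarrow> (nat \<Rightarrow> nat \<Rightarrow> complex) \<Rightarrow> (nat \<Rightarrow> nat \<Rightarrow> complex)"
  assumes "n \<ge> 1"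
    and "\<forall>i\<in>{1..n}. strictly_singular n (S i)"
  shows "compact_operator n (compose_ops (map S [1..<n+1]))"
proof (rule compact_operatorI_coord_null)
  define Ts where "Ts = map S [1..<n+1]"
  have length: "length Ts = n" by (simp add: Ts_def)
  have singular: "strictly_singular n T" if "T \<in> set Ts" for T
    using that assms(2) by (auto simp: Ts_def)
  then show "bounded_operator n (compose_ops (map S [1..<n+1]))"
    unfolding Ts_def[symmetric] by (intro bounded_operator_compose_ops) (simp add: strictly_singular_def)
  fix u M assume "\<And>i. u i \<in> rochberg n" "\<And>i. rnorm n (u i) \<le> M" "coord_null u"
  then have "(\<lambda>i. rnorm (length Ts) (compose_ops Ts (u i))) \<longlonglongrightarrow> 0"
    using singular length by (intro compose_strictly_singular_level) auto
  then show "(\<lambda>i. rnorm n (compose_ops (map S [1..<n+1]) (u i))) \<longlonglongrightarrow> 0"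
    unfolding length unfolding Ts_def .
qed

end
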